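(* Let $(X,\|\cdot\|,\tau)$ be a sequentially complete d-consistent Mazur--Saks space and $(T(t))_{t\geq 0}$ a bi-continuous semigroup on $X$ with generator $(A,D(A))$. Suppose that $X$ is $\bullet$-reflexive w.r.t. $(T(t))_{t\geq 0}$. Let $\Lambda$ be the set of all $\lambda\in\rho(A)$ such that $R(\lambda,A)^{\bullet}X^{\bullet}\subset D(A^{\bullet})$, and let $B_{(X,\|\cdot\|^{\bullet})}=\{x\in X : \|x\|^{\bullet}\le 1\}$. Then the following assertions are equivalent, where in (ii) and (iii) "for some (all)" means that the version with "some" and the version with "all" are each equivalent to the other assertions: (i) The canonical map $j\colon X\to (X^{\bullet})'$ is surjective. (ii) $R(\lambda,A)B_{(X,\|\cdot\|^{\bullet})}$ is $\sigma(X,X^{\circ})$-compact for some (all) $\lambda\in\Lambda$. (iii) $R(\lambda,A)B_{(X,\|\cdot\|^{\bullet})}$ is $\sigma(X,X^{\bullet})$-compact for some (all) $\lambda\in\Lambda$. (iv) $B_{(X,\|\cdot\|^{\bullet})}$ is $\sigma(X,X^{\bullet})$-compact. Each of the assertions (i)-(iv) implies $Fav(T)=D(A)$.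
   Context: Vector spaces are over $\mathbb{K}=\mathbb{R}$ or $\mathbb{C}$. For a Banach space $(X,\|\cdot\|)$, $X'$ is the norm dual with dual norm $\|\cdot\|_{X'}$ and $\mathcal{L}(X)$ the bounded operators on $X$. Let $(X,\|\cdot\|)$ be a Banach space and $\tau$ a Hausdorff locally convex topology on $X$ coarser than the norm topology $\tau_{\|\cdot\|}$. The mixed topology $\gamma=\gamma(\|\cdot\|,\tau)$ is the finest linear topology on $X$ that coincides with $\tau$ on $\|\cdot\|$-bounded sets and satisfies $\tau\le\gamma\le\tau_{\|\cdot\|}$ (it is Hausdorff locally convex). $(X,\|\cdot\|,\tau)$ is a Saks space if there is a directed system of seminorms $\mathcal{P}_\tau$ generating $\tau$ with $\|x\|=\sup_{p\in\mathcal{P}_\tau}p(x)$ for all $x\in X$; it is sequentially complete if $(X,\gamma)$ is sequentially complete; it is Mazur (a Mazur--Saks space) if every linear $\gamma$-sequentially continuous functional on $X$ is $\gamma$-continuous. $X^{\circ}=\{x'\in X' : x' \text{ is } \tau\text{-sequentially continuous on } \|\cdot\|\text{-bounded sets}\}$, a closed subspace of $X'$. $(X,\|\cdot\|,\tau)$ is d-consistent if (i) $X^{\circ}\cap\{x'\in X':\|x'\|_{X'}\le1\}$ is sequentially complete w.r.t. $\sigma(X^{\circ},X)$, and (ii) every $\|\cdot\|_{X'}$-bounded $\sigma(X^{\circ},X)$-null sequence in $X^{\circ}$ is $\tau$-equicontinuous on $\|\cdot\|$-bounded sets (i.e. its restriction to every $\|\cdot\|$-bounded set $B$ is equicontinuous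 for the topology induced by $\tau$ on $B$). A bi-continuous semigroup on $X$ is a family $(T(t))_{t\ge0}$ in $\mathcal{L}(X)$ with $T(0)=\mathrm{id}$, $T(t+s)=T(t)T(s)$; $t\mapsto T(t)x\in(X,\gamma)$ continuous on $[0,\infty)$ for every $x\in X$; and, whenever $x_n\to x$ in $(X,\gamma)$, $T(t)(x_n-x)\to0$ in $(X,\gamma)$ locally uniformly in $t\in[0,\infty)$. Its generator is $Ax=\gamma\text{-}\lim_{t\to0+}\frac{T(t)x-x}{t}$ with $D(A)$ the set of $x\in X$ for which this limit exists in $X$. $\rho(A)$ is the set of scalars $\lambda$ such that $\lambda-A\colon D(A)\to X$ is bijective with $R(\lambda,A)=(\lambda-A)^{-1}\in\mathcal{L}(X)$. $X_{\mathrm{cont}}=\{x\in X:\lim_{t\to0+}\|T(t)x-x\|=0\}$. The dual operators $T(t)'$ leave $X^\circ$ invariant; $T^{\circ}(t)=T(t)'|_{X^{\circ}}$. The bi-sun dual is $X^{\bullet}=\{x^{\circ}\in X^{\circ} : \lim_{t\to0+}\|T^{\circ}(t)x^{\circ}-x^{\circ}\|_{X'}=0\}$, a norm-closed $T^\circ$-invariant subspace; $T^{\bullet}(t)=T^{\circ}(t)|_{X^{\bullet}}$ is a norm-strongly continuous semigroup on $X^\bullet$ (normed by $\|\cdot\|_{X'}$) with generator $(A^{\bullet},D(A^{\bullet}))$. For $\lambda\in\rho(A)$, $R(\lambda,A)^{\bullet}=R(\lambda,A)'|_{X^{\bullet}}$ (restriction of the Banach space adjoint). $\|x\|^{\bullet}=\sup\{|\langle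 x^{\bullet},x\rangle| : x^{\bullet}\in X^{\bullet},\ \|x^{\bullet}\|_{X'}\le1\}$ for $x\in X$. The bi-sun-sun dual is $X^{\bullet\bullet}=\{y\in(X^{\bullet})' : \lim_{t\to0+}\|T^{\bullet}(t)'y-y\|_{(X^{\bullet})'}=0\}$. The canonical map $j\colon X\to(X^{\bullet})'$ is $\langle j(x),x^{\bullet}\rangle=\langle x^{\bullet},x\rangle$. $X$ is $\bullet$-reflexive w.r.t. $(T(t))_{t\ge0}$ if $j(X_{\mathrm{cont}})=X^{\bullet\bullet}$. The Favard space is $Fav(T)=\{x\in X : \limsup_{t\to0+}\frac1t\|T(t)x-x\|<\infty\}$. *)

theory Defs
  imports "HOL-Analysis.Analysis"
begin

text \<open>Up to isometric isomorphism the only instances are \<open>\<real>\<close> (take \<open>i = 0\<close>)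
  and \<open>\<complex>\<close> (take \<open>i * i = - 1\<close>).\<close>

class real_or_complex = real_normed_field +
  assumes real_or_complex:
    "\<exists>i. (i = 0 \<or> i * i = - 1) \<and> (\<forall>z. \<exists>a b. z = a *\<^sub>R 1 + b *\<^sub>R i)"

instance real :: real_or_complex
proof
  have "\<forall>z::real. \<exists>a b. z = a *\<^sub>R 1 + b *\<^sub>R 0"
    by simp
  then show "\<exists>i::real. (i = 0 \<or> i * i = - 1) \<and> (\<forall>z. \<exists>a b. z = a *\<^sub>R 1 + b *\<^sub>R i)"
    by blast
qed

instance complex :: real_or_complex
proof
  have "z = Re z *\<^sub>R 1 + Im z *\<^sub>R \<i>" for z :: complex
    by (simp add: complex_eq_iff)
  moreover have "\<i> * \<i> = - 1"
    by simp
  ultimately show "\<exists>i::complex. (i = 0 \<or> i * i = - 1) \<and> (\<forall>z. \<exists>a b. z = a *\<^sub>R 1 + b *\<^sub>R i)"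
    by blast
qed

text \<open>A Banach space over the scalar field \<open>'k\<close>: the type class \<open>banach\<close> supplies the norm,
  completeness and the underlying real structure, which \<open>sc\<close> extends to \<open>'k\<close>.\<close>

locale banach_space_over = vector_space sc
  for sc :: "'k::real_or_complex \<Rightarrow> 'a::banach \<Rightarrow> 'a" +
  assumes sc_of_real: "sc (of_real r) x = r *\<^sub>R x"
    and norm_sc: "norm (sc c x) = norm c * norm x"

text \<open>\<open>X'\<close> and \<open>\<L>(X)\<close>. The norm of the type \<open>\<Rightarrow>\<^sub>L\<close> is the operator norm, so on \<open>X'\<close> it is
  the dual norm; only linearity over \<open>'k\<close> has to be added.\<close>

definition norm_dual :: "('k::real_or_complex \<Rightarrow> 'a::banach \<Rightarrow> 'a) \<Rightarrow> ('a \<Rightarrow>\<^sub>L 'k) set" where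
  "norm_dual sc = {f :: 'a \<Rightarrow>\<^sub>L 'k. \<forall>c x. f (sc c x) = c * f x}"

definition bounded_ops :: "('k::real_or_complex \<Rightarrow> 'a::banach \<Rightarrow> 'a) \<Rightarrow> ('a \<Rightarrow>\<^sub>L 'a) set" where
  "bounded_ops sc = {S :: 'a \<Rightarrow>\<^sub>L 'a. \<forall>c x. S (sc c x) = sc c (S x)}"

definition dual_op :: "('a::banach \<Rightarrow>\<^sub>L 'a) \<Rightarrow> ('a \<Rightarrow>\<^sub>L 'k::real_or_complex) \<Rightarrow> ('a \<Rightarrow>\<^sub>L 'k)" where
  "dual_op S f = f o\<^sub>L S"

definition scale_fun :: "'k::real_or_complex \<Rightarrow> ('a::banach \<Rightarrow>\<^sub>L 'k) \<Rightarrow> ('a \<Rightarrow>\<^sub>L 'k)" where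
  "scale_fun c f = blinfun_mult_right c o\<^sub>L f"

definition coarser :: "'a topology \<Rightarrow> 'a topology \<Rightarrow> bool" where
  "coarser \<tau>1 \<tau>2 \<longleftrightarrow> (\<forall>U. openin \<tau>1 U \<longrightarrow> openin \<tau>2 U)"

definition linear_topology :: "('k::real_or_complex \<Rightarrow> 'a::banach \<Rightarrow> 'a) \<Rightarrow> 'a topology \<Rightarrow> bool" where
  "linear_topology sc \<tau> \<longleftrightarrow>
     topspace \<tau> = UNIV \<and>
     continuous_map (prod_topology \<tau> \<tau>) \<tau> (\<lambda>(x, y). x + y) \<and>
     continuous_map (prod_topology euclidean \<tau>) \<tau> (\<lambda>(c, x). sc c x)"

definition locally_convex_topology :: "('k::real_or_complex \<Rightarrow> 'a::banach \<Rightarrow> 'a) \<Rightarrow> 'a topology \<Rightarrow> bool" where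
  "locally_convex_topology sc \<tau> \<longleftrightarrow>
     linear_topology sc \<tau> \<and>
     (\<forall>U. openin \<tau> U \<and> 0 \<in> U \<longrightarrow> (\<exists>V. openin \<tau> V \<and> 0 \<in> V \<and> convex V \<and> V \<subseteq> U))"

text \<open>Cauchy sequences for the uniformity of a (translation invariant) group topology.\<close>

definition top_Cauchy :: "'v::ab_group_add topology \<Rightarrow> (nat \<Rightarrow> 'v) \<Rightarrow> bool" where
  "top_Cauchy \<tau> s \<longleftrightarrow>
     (\<forall>U. openin \<tau> U \<and> 0 \<in> U \<longrightarrow> (\<exists>N. \<forall>m\<ge>N. \<forall>n\<ge>N. s m - s n \<in> U))"

definition sequentially_complete_in :: "'v::ab_group_add topology \<Rightarrow> 'v set \<Rightarrow> bool" where
  "sequentially_complete_in \<tau> S \<longleftrightarrow>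
     (\<forall>s. range s \<subseteq> S \<and> top_Cauchy \<tau> s \<longrightarrow> (\<exists>l\<in>S. limitin \<tau> s l sequentially))"

text \<open>The weak topology \<open>\<sigma>(V, W)\<close> on \<open>V\<close> with respect to a pairing \<open>b\<close>: the topology of pointwise
  convergence on \<open>W\<close>.\<close>

definition weak_topology :: "'v set \<Rightarrow> 'w set \<Rightarrow> ('v \<Rightarrow> 'w \<Rightarrow> 'k::real_or_complex) \<Rightarrow> 'v topology" where
  "weak_topology V W b =
     pullback_topology V (\<lambda>v. restrict (b v) W) (product_topology (\<lambda>_. euclidean) W)"

text \<open>\<open>\<sigma>(X, W)\<close> and \<open>\<sigma>(W, X)\<close> for a set \<open>W\<close> of functionals on \<open>X\<close>.\<close>

definition weak_top_space :: "('a::banach \<Rightarrow>\<^sub>L 'k::real_or_complex) set \<Rightarrow> 'a topology" where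
  "weak_top_space W = weak_topology UNIV W (\<lambda>x f. blinfun_apply f x)"

definition weak_top_dual :: "('a::banach \<Rightarrow>\<^sub>L 'k::real_or_complex) set \<Rightarrow> ('a \<Rightarrow>\<^sub>L 'k) topology" where
  "weak_top_dual W = weak_topology W UNIV blinfun_apply"

definition mixed_candidate ::
  "('k::real_or_complex \<Rightarrow> 'a::banach \<Rightarrow> 'a) \<Rightarrow> 'a topology \<Rightarrow> 'a topology \<Rightarrow> bool" where
  "mixed_candidate sc \<tau> \<gamma> \<longleftrightarrow>
     linear_topology sc \<gamma> \<and> coarser \<tau> \<gamma> \<and> coarser \<gamma> euclidean \<and>
     (\<forall>B. bounded B \<longrightarrow> subtopology \<gamma> B = subtopology \<tau> B)"

definition mixed_topology ::
  "('k::real_or_complex \<Rightarrow> 'a::banach \<Rightarrow> 'a) \<Rightarrow> 'a topology \<Rightarrow> 'a topology" where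
  "mixed_topology sc \<tau> =
     (THE \<gamma>. mixed_candidate sc \<tau> \<gamma> \<and> (\<forall>\<gamma>'. mixed_candidate sc \<tau> \<gamma>' \<longrightarrow> coarser \<gamma>' \<gamma>))"

definition seminorm :: "('k::real_or_complex \<Rightarrow> 'a::banach \<Rightarrow> 'a) \<Rightarrow> ('a \<Rightarrow> real) \<Rightarrow> bool" where
  "seminorm sc p \<longleftrightarrow>
     (\<forall>x. p x \<ge> 0) \<and> (\<forall>x y. p (x + y) \<le> p x + p y) \<and> (\<forall>c x. p (sc c x) = norm c * p x)"

definition directed_seminorms :: "('a \<Rightarrow> real) set \<Rightarrow> bool" where
  "directed_seminorms P \<longleftrightarrow>
     P \<noteq> {} \<and> (\<forall>p\<in>P. \<forall>q\<in>P. \<exists>r\<in>P. \<forall>x. max (p x) (q x) \<le> r x)"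

definition seminorm_topology :: "('a::banach \<Rightarrow> real) set \<Rightarrow> 'a topology" where
  "seminorm_topology P = topology_generated_by {{y. p (y - x) < e} | p x e. p \<in> P \<and> e > 0}"

text \<open>\<open>bdd_above\<close> is needed because the supremum of an unbounded set of reals is a junk value.\<close>

definition saks_space :: "('k::real_or_complex \<Rightarrow> 'a::banach \<Rightarrow> 'a) \<Rightarrow> 'a topology \<Rightarrow> bool" where
  "saks_space sc \<tau> \<longleftrightarrow>
     banach_space_over sc \<and>
     locally_convex_topology sc \<tau> \<and> Hausdorff_space \<tau> \<and> coarser \<tau> euclidean \<and>
     (\<exists>P. directed_seminorms P \<and> (\<forall>p\<in>P. seminorm sc p) \<and> \<tau> = seminorm_topology P \<and>
          (\<forall>x. bdd_above ((\<lambda>p. p x) ` P) \<and> norm x = (SUP p\<in>P. p x)))"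

definition seq_complete_saks ::
  "('k::real_or_complex \<Rightarrow> 'a::banach \<Rightarrow> 'a) \<Rightarrow> 'a topology \<Rightarrow> bool" where
  "seq_complete_saks sc \<tau> \<longleftrightarrow> sequentially_complete_in (mixed_topology sc \<tau>) UNIV"

definition mazur_saks ::
  "('k::real_or_complex \<Rightarrow> 'a::banach \<Rightarrow> 'a) \<Rightarrow> 'a topology \<Rightarrow> bool" where
  "mazur_saks sc \<tau> \<longleftrightarrow>
     (\<forall>f :: 'a \<Rightarrow> 'k. Vector_Spaces.linear sc (*) f \<and>
        (\<forall>s x. limitin (mixed_topology sc \<tau>) s x sequentially \<longrightarrow> (\<lambda>n. f (s n)) \<longlonglongrightarrow> f x) \<longrightarrow>
        continuous_map (mixed_topology sc \<tau>) euclidean f)"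

definition circ_dual ::
  "('k::real_or_complex \<Rightarrow> 'a::banach \<Rightarrow> 'a) \<Rightarrow> 'a topology \<Rightarrow> ('a \<Rightarrow>\<^sub>L 'k) set" where
  "circ_dual sc \<tau> = {f \<in> norm_dual sc. \<forall>B. bounded B \<longrightarrow>
     (\<forall>s x. range s \<subseteq> B \<and> x \<in> B \<and> limitin \<tau> s x sequentially \<longrightarrow> (\<lambda>n. f (s n)) \<longlonglongrightarrow> f x)}"

definition d_consistent ::
  "('k::real_or_complex \<Rightarrow> 'a::banach \<Rightarrow> 'a) \<Rightarrow> 'a topology \<Rightarrow> bool" where
  "d_consistent sc \<tau> \<longleftrightarrow>
     sequentially_complete_in (weak_top_dual (circ_dual sc \<tau>))
       {f \<in> circ_dual sc \<tau>. norm f \<le> 1} \<and>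
     (\<forall>s. range s \<subseteq> circ_dual sc \<tau> \<and> bounded (range s) \<and>
          limitin (weak_top_dual (circ_dual sc \<tau>)) s 0 sequentially \<longrightarrow>
        (\<forall>B. bounded B \<longrightarrow> (\<forall>x\<in>B. \<forall>e>0. \<exists>U. openin (subtopology \<tau> B) U \<and> x \<in> U \<and>
           (\<forall>y\<in>U. \<forall>n. norm (s n y - s n x) < e))))"

text \<open>Only the values \<open>T t\<close> with \<open>t \<ge> 0\<close> are meaningful, here and below. Locally uniform convergence
  on \<open>[0, \<infinity>)\<close> is uniform convergence on every \<open>[0, a]\<close>.\<close>

definition bicontinuous_semigroup ::
  "('k::real_or_complex \<Rightarrow> 'a::banach \<Rightarrow> 'a) \<Rightarrow> 'a topology \<Rightarrow> (real \<Rightarrow> 'a \<Rightarrow>\<^sub>L 'a) \<Rightarrow> bool" where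
  "bicontinuous_semigroup sc \<tau> T \<longleftrightarrow>
     (\<forall>t\<ge>0. T t \<in> bounded_ops sc) \<and>
     T 0 = id_blinfun \<and>
     (\<forall>t\<ge>0. \<forall>s\<ge>0. T (t + s) = T t o\<^sub>L T s) \<and>
     (\<forall>x. continuous_map (top_of_set {0..}) (mixed_topology sc \<tau>) (\<lambda>t. T t x)) \<and>
     (\<forall>s x. limitin (mixed_topology sc \<tau>) s x sequentially \<longrightarrow>
        (\<forall>a\<ge>0. \<forall>U. openin (mixed_topology sc \<tau>) U \<and> 0 \<in> U \<longrightarrow>
           (\<forall>\<^sub>F n in sequentially. \<forall>t\<in>{0..a}. T t (s n - x) \<in> U)))"

definition gen_domain ::
  "('k::real_or_complex \<Rightarrow> 'a::banach \<Rightarrow> 'a) \<Rightarrow> 'a topology \<Rightarrow> (real \<Rightarrow> 'a \<Rightarrow>\<^sub>L 'a) \<Rightarrow> 'a set" where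
  "gen_domain sc \<tau> T =
     {x. \<exists>y. limitin (mixed_topology sc \<tau>) (\<lambda>t. (1 / t) *\<^sub>R (T t x - x)) y (at_right 0)}"

definition generator ::
  "('k::real_or_complex \<Rightarrow> 'a::banach \<Rightarrow> 'a) \<Rightarrow> 'a topology \<Rightarrow> (real \<Rightarrow> 'a \<Rightarrow>\<^sub>L 'a) \<Rightarrow> 'a \<Rightarrow> 'a" where
  "generator sc \<tau> T x =
     (THE y. limitin (mixed_topology sc \<tau>) (\<lambda>t. (1 / t) *\<^sub>R (T t x - x)) y (at_right 0))"

text \<open>For an operator \<open>A\<close> with domain \<open>D\<close>; \<open>resolvent\<close> is meaningful for \<open>\<mu>\<close> in \<open>resolvent_set\<close>.\<close>

definition resolvent_fun ::
  "('k::real_or_complex \<Rightarrow> 'a::banach \<Rightarrow> 'a) \<Rightarrow> 'a set \<Rightarrow> ('a \<Rightarrow> 'a) \<Rightarrow> 'k \<Rightarrow> 'a \<Rightarrow> 'a" where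
  "resolvent_fun sc D A \<mu> = the_inv_into D (\<lambda>x. sc \<mu> x - A x)"

definition resolvent_set ::
  "('k::real_or_complex \<Rightarrow> 'a::banach \<Rightarrow> 'a) \<Rightarrow> 'a set \<Rightarrow> ('a \<Rightarrow> 'a) \<Rightarrow> 'k set" where
  "resolvent_set sc D A =
     {\<mu>. bij_betw (\<lambda>x. sc \<mu> x - A x) D UNIV \<and>
         resolvent_fun sc D A \<mu> \<in> blinfun_apply ` bounded_ops sc}"

definition resolvent ::
  "('k::real_or_complex \<Rightarrow> 'a::banach \<Rightarrow> 'a) \<Rightarrow> 'a set \<Rightarrow> ('a \<Rightarrow> 'a) \<Rightarrow> 'k \<Rightarrow> ('a \<Rightarrow>\<^sub>L 'a)" where
  "resolvent sc D A \<mu> = Blinfun (resolvent_fun sc D A \<mu>)"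

definition cont_space :: "(real \<Rightarrow> 'a::banach \<Rightarrow>\<^sub>L 'a) \<Rightarrow> 'a set" where
  "cont_space T = {x. ((\<lambda>t. norm (T t x - x)) \<longlongrightarrow> 0) (at_right 0)}"

definition favard_space :: "(real \<Rightarrow> 'a::banach \<Rightarrow>\<^sub>L 'a) \<Rightarrow> 'a set" where
  "favard_space T = {x. Limsup (at_right 0) (\<lambda>t. ereal (1 / t * norm (T t x - x))) < \<infinity>}"

definition bullet_dual ::
  "('k::real_or_complex \<Rightarrow> 'a::banach \<Rightarrow> 'a) \<Rightarrow> 'a topology \<Rightarrow> (real \<Rightarrow> 'a \<Rightarrow>\<^sub>L 'a) \<Rightarrow>
   ('a \<Rightarrow>\<^sub>L 'k) set" where
  "bullet_dual sc \<tau> T =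
     {f \<in> circ_dual sc \<tau>. ((\<lambda>t. norm (dual_op (T t) f - f)) \<longlongrightarrow> 0) (at_right 0)}"

definition bullet_gen_domain ::
  "('k::real_or_complex \<Rightarrow> 'a::banach \<Rightarrow> 'a) \<Rightarrow> 'a topology \<Rightarrow> (real \<Rightarrow> 'a \<Rightarrow>\<^sub>L 'a) \<Rightarrow>
   ('a \<Rightarrow>\<^sub>L 'k) set" where
  "bullet_gen_domain sc \<tau> T =
     {f \<in> bullet_dual sc \<tau> T. \<exists>g\<in>bullet_dual sc \<tau> T.
        ((\<lambda>t. (1 / t) *\<^sub>R (dual_op (T t) f - f)) \<longlongrightarrow> g) (at_right 0)}"

definition bullet_norm ::
  "('k::real_or_complex \<Rightarrow> 'a::banach \<Rightarrow> 'a) \<Rightarrow> 'a topology \<Rightarrow> (real \<Rightarrow> 'a \<Rightarrow>\<^sub>L 'a) \<Rightarrow> 'a \<Rightarrow> real" where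
  "bullet_norm sc \<tau> T x = (SUP f\<in>{f \<in> bullet_dual sc \<tau> T. norm f \<le> 1}. norm (blinfun_apply f x))"

text \<open>The norm dual of a linear subspace \<open>V\<close> of \<open>X'\<close>. Since \<open>V\<close> is a set rather than a type, its
  functionals are functions normalised to be \<open>undefined\<close> outside \<open>V\<close>.\<close>

definition sub_dual :: "('a::banach \<Rightarrow>\<^sub>L 'k::real_or_complex) set \<Rightarrow> (('a \<Rightarrow>\<^sub>L 'k) \<Rightarrow> 'k) set" where
  "sub_dual V = {y \<in> extensional V.
     (\<forall>f\<in>V. \<forall>g\<in>V. y (f + g) = y f + y g) \<and>
     (\<forall>c. \<forall>f\<in>V. y (scale_fun c f) = c * y f) \<and>
     (\<exists>C. \<forall>f\<in>V. norm (y f) \<le> C * norm f)}"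

definition sub_dual_norm :: "('a::banach \<Rightarrow>\<^sub>L 'k::real_or_complex) set \<Rightarrow> (('a \<Rightarrow>\<^sub>L 'k) \<Rightarrow> 'k) \<Rightarrow> real" where
  "sub_dual_norm V y = (SUP f\<in>{f \<in> V. norm f \<le> 1}. norm (y f))"

definition bullet_bullet_dual ::
  "('k::real_or_complex \<Rightarrow> 'a::banach \<Rightarrow> 'a) \<Rightarrow> 'a topology \<Rightarrow> (real \<Rightarrow> 'a \<Rightarrow>\<^sub>L 'a) \<Rightarrow>
   (('a \<Rightarrow>\<^sub>L 'k) \<Rightarrow> 'k) set" where
  "bullet_bullet_dual sc \<tau> T =
     {y \<in> sub_dual (bullet_dual sc \<tau> T).
        ((\<lambda>t. sub_dual_norm (bullet_dual sc \<tau> T)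
                (\<lambda>f\<in>bullet_dual sc \<tau> T. y (dual_op (T t) f) - y f)) \<longlongrightarrow> 0) (at_right 0)}"

definition canonical_map ::
  "('k::real_or_complex \<Rightarrow> 'a::banach \<Rightarrow> 'a) \<Rightarrow> 'a topology \<Rightarrow> (real \<Rightarrow> 'a \<Rightarrow>\<^sub>L 'a) \<Rightarrow>
   'a \<Rightarrow> ('a \<Rightarrow>\<^sub>L 'k) \<Rightarrow> 'k" where
  "canonical_map sc \<tau> T x = (\<lambda>f\<in>bullet_dual sc \<tau> T. blinfun_apply f x)"

definition bullet_reflexive ::
  "('k::real_or_complex \<Rightarrow> 'a::banach \<Rightarrow> 'a) \<Rightarrow> 'a topology \<Rightarrow> (real \<Rightarrow> 'a \<Rightarrow>\<^sub>L 'a) \<Rightarrow> bool" where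
  "bullet_reflexive sc \<tau> T \<longleftrightarrow>
     canonical_map sc \<tau> T ` cont_space T = bullet_bullet_dual sc \<tau> T"

text \<open>The finest topology in the definition of \<open>mixed_topology\<close> exists, as the supremum of all
  candidates, so the definite description is proper.\<close>

lemma coarser_antisym: "coarser S T \<Longrightarrow> coarser T S \<Longrightarrow> S = T"
  unfolding coarser_def by (metis topology_eq)

lemma mixed_topology_ex:
  assumes tau: "linear_topology sc \<tau>" "coarser \<tau> euclidean"
  shows "\<exists>\<gamma>. mixed_candidate sc \<tau> \<gamma> \<and> (\<forall>\<gamma>'. mixed_candidate sc \<tau> \<gamma>' \<longrightarrow> coarser \<gamma>' \<gamma>)"
proof -
  define \<S> where "\<S> = {U. \<exists>\<gamma>'. mixed_candidate sc \<tau> \<gamma>' \<and> openin \<gamma>' U}"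
  define G where "G = topology_generated_by \<S>"
  have cand: "mixed_candidate sc \<tau> \<tau>"
    using tau by (auto simp: mixed_candidate_def coarser_def)
  have fine: "coarser \<gamma>' G" if "mixed_candidate sc \<tau> \<gamma>'" for \<gamma>'
    unfolding coarser_def G_def
    using that by (auto intro!: topology_generated_by_Basis simp: \<S>_def)
  have lin: "linear_topology sc \<gamma>'" if "mixed_candidate sc \<tau> \<gamma>'" for \<gamma>'
    using that by (simp add: mixed_candidate_def)
  have UN: "\<Union>\<S> = UNIV"
  proof -
    have "UNIV \<in> \<S>"
      using cand tau(1) openin_topspace[of \<tau>] by (auto simp: \<S>_def linear_topology_def)
    then show ?thesis by auto
  qed
  have top: "topspace G = UNIV"
    unfolding G_def topology_generated_by_topspace using UN by simp
  have gen: "continuous_map T G f"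
    if "\<And>U \<gamma>'. mixed_candidate sc \<tau> \<gamma>' \<Longrightarrow> openin \<gamma>' U \<Longrightarrow> openin T (f -` U \<inter> topspace T)" for T :: "'z topology" and f
    unfolding G_def
    by (rule continuous_on_generated_topo) (use that UN in \<open>auto simp: \<S>_def\<close>)
  have prod_fine: "openin (prod_topology T2 G) U" if "mixed_candidate sc \<tau> \<gamma>'" "openin (prod_topology T1 \<gamma>') U"
     "coarser T1 T2" for T1 T2 :: "'z topology" and \<gamma>' U
    using that fine[OF that(1)] unfolding openin_prod_topology_alt coarser_def by meson
  have add: "continuous_map (prod_topology G G) G (\<lambda>(x, y). x + y)"
  proof (rule gen)
    fix U \<gamma>' assume c: "mixed_candidate sc \<tau> \<gamma>'" and U: "openin \<gamma>' U"
    have "continuous_map (prod_topology \<gamma>' \<gamma>') \<gamma>' (\<lambda>(x, y). x + y)" "topspace \<gamma>' = UNIV"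
      using lin[OF c] by (auto simp: linear_topology_def)
    then have "openin (prod_topology \<gamma>' \<gamma>') ((\<lambda>(x, y). x + y) -` U)"
      using U by (auto simp: continuous_map_alt)
    from prod_fine[OF c this fine[OF c]]
    show "openin (prod_topology G G) ((\<lambda>(x, y). x + y) -` U \<inter> topspace (prod_topology G G))"
      by (simp add: top)
  qed
  have mul: "continuous_map (prod_topology euclidean G) G (\<lambda>(c, x). sc c x)"
  proof (rule gen)
    fix U \<gamma>' assume c: "mixed_candidate sc \<tau> \<gamma>'" and U: "openin \<gamma>' U"
    have "continuous_map (prod_topology euclidean \<gamma>') \<gamma>' (\<lambda>(c, x). sc c x)" "topspace \<gamma>' = UNIV"
      using lin[OF c] by (auto simp: linear_topology_def)
    then have "openin (prod_topology euclidean \<gamma>') ((\<lambda>(c, x). sc c x) -` U)"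
      using U by (auto simp: continuous_map_alt)
    from prod_fine[OF c this, of euclidean]
    show "openin (prod_topology euclidean G) ((\<lambda>(c, x). sc c x) -` U \<inter> topspace (prod_topology euclidean G))"
      by (simp add: top coarser_def)
  qed
  have norm: "coarser G euclidean"
  proof -
    have "continuous_map euclidean G (\<lambda>x. x)"
      by (rule gen) (auto simp: mixed_candidate_def coarser_def)
    then show ?thesis
      by (auto simp: coarser_def continuous_map_alt)
  qed
  have bd: "subtopology G B = subtopology \<tau> B" if B: "bounded B" for B
  proof (rule coarser_antisym)
    show "coarser (subtopology \<tau> B) (subtopology G B)"
      using fine[OF cand] unfolding coarser_def openin_subtopology by blast
    have "continuous_map (subtopology \<tau> B) G (\<lambda>x. x)"
    proof (rule gen)
      fix U \<gamma>' assume c: "mixed_candidate sc \<tau> \<gamma>'" and U: "openin \<gamma>' U"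
      then have "openin (subtopology \<tau> B) (U \<inter> B)"
        using B by (metis mixed_candidate_def openin_subtopology)
      moreover have "topspace \<tau> = UNIV"
        using tau(1) by (simp add: linear_topology_def)
      ultimately show "openin (subtopology \<tau> B) ((\<lambda>x. x) -` U \<inter> topspace (subtopology \<tau> B))"
        by simp
    qed
    moreover have "topspace \<tau> = UNIV"
      using tau(1) by (simp add: linear_topology_def)
    ultimately have "openin (subtopology \<tau> B) (U \<inter> B)" if "openin G U" for U
      using that by (auto simp: continuous_map_alt)
    then show "coarser (subtopology G B) (subtopology \<tau> B)"
      unfolding coarser_def openin_subtopology by blast
  qed
  have "mixed_candidate sc \<tau> G"
    using top add mul norm bd fine[OF cand] by (simp add: mixed_candidate_def linear_topology_def)
  with fine show ?thesis by blast
qed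

lemma mixed_topology:
  assumes "linear_topology sc \<tau>" "coarser \<tau> euclidean"
  shows "mixed_candidate sc \<tau> (mixed_topology sc \<tau>)"
    and "mixed_candidate sc \<tau> \<gamma>' \<Longrightarrow> coarser \<gamma>' (mixed_topology sc \<tau>)"
proof -
  let ?P = "\<lambda>\<gamma>. mixed_candidate sc \<tau> \<gamma> \<and> (\<forall>\<gamma>'. mixed_candidate sc \<tau> \<gamma>' \<longrightarrow> coarser \<gamma>' \<gamma>)"
  have "\<exists>!\<gamma>. ?P \<gamma>"
    using mixed_topology_ex[OF assms] coarser_antisym by blast
  then have "?P (mixed_topology sc \<tau>)"
    unfolding mixed_topology_def by (rule theI')
  then show "mixed_candidate sc \<tau> (mixed_topology sc \<tau>)"
    and "mixed_candidate sc \<tau> \<gamma>' \<Longrightarrow> coarser \<gamma>' (mixed_topology sc \<tau>)"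
    by blast+
qed

end

theory Submission
  imports Defs
begin

text \<open>The mixed topology matters here only through its convergent sequences. A sequence converges for
\<open>\<gamma>\<close> if and only if it is norm bounded and converges for \<open>\<tau>\<close>: a weighted supremum of countably many
of the seminorms of \<open>\<tau>\<close> is \<open>\<gamma>\<close>-continuous and detects unboundedness. So \<open>X\<^sup>\<circ>\<close>, the generator and
the continuity of the semigroup can all be expressed by the predicate \<open>conv\<close>.

The tool is the family of orbit integrals \<open>V\<^sub>t x = \<integral>\<^sub>0\<^sup>t T(s) x ds\<close>, which exist as \<open>\<gamma>\<close>-limits of Riemann
sums. They satisfy \<open>(T(h) - 1) V\<^sub>t = V\<^sub>h (T(t) - 1)\<close>, and \<open>V\<^sub>h x / h\<close> tends to \<open>x\<close>. This makes the
generator accessible (\<open>A V\<^sub>t x = T(t) x - x\<close>, and \<open>V\<^sub>t A x = T(t) x - x\<close> on the domain), yields a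
resolvent, and shows on the dual side that \<open>f \<circ> V\<^sub>t\<close> lies in the bi-sun dual for every
\<open>f\<close> in \<open>X\<^sup>\<circ>\<close>, with \<open>f \<circ> V\<^sub>h / h\<close> tending to \<open>f\<close> in norm if \<open>f\<close> is itself in the bi-sun dual.

Let \<open>B\<close> be the unit ball of the bullet norm. If the canonical map \<open>j\<close> is onto, then \<open>B\<close> is the preimage
of the dual unit ball, and the weak topology given by the bi-sun dual is the pullback of the weak-star
topology, so \<open>B\<close> is compact by Banach-Alaoglu. Conversely let \<open>y\<close> be a functional on the bi-sun dual.
The averages \<open>f \<mapsto> y(f \<circ> V\<^sub>h) / h\<close> belong to the bi-sun-sun dual, so by reflexivity they come from
points \<open>x\<^sub>h\<close>, and these lie in a fixed multiple of \<open>B\<close>; a cluster point of \<open>x\<^sub>h\<close> as \<open>h\<close> tends to \<open>0\<close>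
represents \<open>y\<close>. If only \<open>R(\<lambda>,A) B\<close> is compact, the same argument identifies \<open>y\<close> on the range of
\<open>R(\<lambda>,A)\<^sup>\<bullet>\<close>, which contains the domain of \<open>A\<^sup>\<bullet>\<close> and hence all \<open>f \<circ> V\<^sub>h\<close> with \<open>f\<close> in the bi-sun dual; it is thus dense
(\<open>canonical_map_surj_if_compact\<close>).

Compactness of \<open>B\<close> passes to \<open>R(\<lambda>,A) B\<close> for the finer topology given by \<open>X\<^sup>\<circ>\<close> because
\<open>R(\<lambda>,A)\<close> is continuous between the two weak topologies: its adjoint maps \<open>X\<^sup>\<circ>\<close> into the bi-sun dual. For one
resolvent this is a direct estimate, and the resolvent identity transfers it to every \<open>\<lambda>\<close> in \<open>\<Lambda>\<close>.

Finally, if \<open>x\<close> is in the Favard space, the quotients \<open>(T(t) x - x) / t\<close> are bounded for small \<open>t\<close>;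
a cluster point \<open>y\<close> for the weak topology on a multiple of \<open>B\<close> satisfies
\<open>x = R(\<mu>,A) (\<mu> x - y)\<close> when tested against the bi-sun dual, which separates points.\<close>

section \<open>The scalar field\<close>

text \<open>Multiplying \<open>a + b i\<close> by its conjugate gives \<open>a\<^sup>2 + b\<^sup>2 \<le> norm z * (\<bar>a\<bar> + \<bar>b\<bar>)\<close>, so the two real
coordinates are controlled by the norm. Compactness of balls and completeness of the scalar field follow.\<close>

lemma real_or_complex_repr:
  obtains i :: "'k::real_or_complex"
  where "i = 0 \<or> i * i = - 1"
    and "\<And>z. \<exists>a b. z = a *\<^sub>R 1 + b *\<^sub>R i \<and> \<bar>a\<bar> + \<bar>b\<bar> \<le> 2 * norm z"
proof -
  obtain i :: 'k where i: "i = 0 \<or> i * i = - 1" and rep: "\<And>z. \<exists>a b. z = a *\<^sub>R 1 + b *\<^sub>R i"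
    using real_or_complex by blast
  have "\<exists>a b. z = a *\<^sub>R 1 + b *\<^sub>R i \<and> \<bar>a\<bar> + \<bar>b\<bar> \<le> 2 * norm z" for z
  proof (cases "i = 0")
    case True
    obtain a b where "z = a *\<^sub>R 1 + b *\<^sub>R i"
      using rep by blast
    with True have "z = a *\<^sub>R 1 + 0 *\<^sub>R i \<and> \<bar>a\<bar> + \<bar>0\<bar> \<le> 2 * norm z"
      by simp
    then show ?thesis by blast
  next
    case False
    with i have ii: "i * i = - 1" by simp
    then have "norm i * norm i = 1"
      by (metis norm_minus_cancel norm_mult norm_one)
    then have ni: "norm i = 1"
      by (metis abs_norm_cancel real_sqrt_abs2 real_sqrt_one)
    obtain a b where z: "z = a *\<^sub>R 1 + b *\<^sub>R i"
      using rep by blast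
    have "z * (a *\<^sub>R 1 - b *\<^sub>R i) = (a * a + b * b) *\<^sub>R 1"
      by (simp add: z algebra_simps ii)
    then have "a * a + b * b = norm z * norm (a *\<^sub>R 1 - b *\<^sub>R i)"
      by (metis (no_types, lifting) abs_of_nonneg add_nonneg_nonneg mult.right_neutral norm_mult norm_one norm_scaleR zero_le_square)
    also have "\<dots> \<le> norm z * (\<bar>a\<bar> + \<bar>b\<bar>)"
      by (rule mult_left_mono) (use norm_triangle_ineq4[of "a *\<^sub>R (1::'k)" "b *\<^sub>R i"] ni in auto)
    finally have *: "a * a + b * b \<le> norm z * (\<bar>a\<bar> + \<bar>b\<bar>)" .
    have "(\<bar>a\<bar> + \<bar>b\<bar>) * (\<bar>a\<bar> + \<bar>b\<bar>) \<le> 2 * (a * a + b * b)"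
      using zero_le_square[of "\<bar>a\<bar> - \<bar>b\<bar>"] by (simp add: algebra_simps abs_mult_self_eq)
    also have "\<dots> \<le> 2 * (norm z * (\<bar>a\<bar> + \<bar>b\<bar>))"
      using * by simp
    finally have "(\<bar>a\<bar> + \<bar>b\<bar>) * (\<bar>a\<bar> + \<bar>b\<bar>) \<le> (2 * norm z) * (\<bar>a\<bar> + \<bar>b\<bar>)"
      by (simp add: mult.assoc)
    then have "\<bar>a\<bar> + \<bar>b\<bar> \<le> 2 * norm z"
      by (metis abs_ge_zero add_nonneg_nonneg add_nonneg_eq_0_iff mult_le_cancel_right_pos
          mult_nonneg_nonneg norm_ge_zero order_le_less zero_le_numeral)
    with z show ?thesis by blast
  qed
  with i show ?thesis by (rule that)
qed

text \<open>Used for completeness of the scalars and, in the proof of Banach-Alaoglu, for the factors of the product space.\<close>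

lemma compact_cball_scalar: "compact (cball (0::'k::real_or_complex) r)"
proof -
  obtain i :: 'k where i: "\<And>z::'k. \<exists>a b. z = a *\<^sub>R 1 + b *\<^sub>R i \<and> \<bar>a\<bar> + \<bar>b\<bar> \<le> 2 * norm z"
    using real_or_complex_repr by metis
  let ?h = "\<lambda>(a, b). a *\<^sub>R (1::'k) + b *\<^sub>R i"
  let ?K = "{- 2 * r..2 * r} \<times> {- 2 * r..2 * r}"
  have "compact (?h ` ?K)"
    by (intro compact_continuous_image compact_Times compact_Icc)
       (auto intro!: continuous_intros simp: case_prod_unfold)
  moreover have "cball 0 r \<subseteq> ?h ` ?K"
  proof
    fix z :: 'k assume "z \<in> cball 0 r"
    moreover obtain a b where "z = a *\<^sub>R 1 + b *\<^sub>R i" "\<bar>a\<bar> + \<bar>b\<bar> \<le> 2 * norm z"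
      using i by blast
    ultimately show "z \<in> ?h ` ?K"
      by (intro image_eqI[of _ _ "(a, b)"]) auto
  qed
  ultimately show ?thesis
    by (metis closed_cball compact_Int_closed inf.absorb_iff2)
qed

text \<open>Completeness of the scalars makes the integrals of the scalar functions \<open>s \<mapsto> f (T(s) x)\<close> available.\<close>

instance real_or_complex \<subseteq> banach
proof
  fix X :: "nat \<Rightarrow> 'a"
  assume X: "Cauchy X"
  then have "bounded (range X)"
    by (rule cauchy_imp_bounded)
  then obtain r where "\<And>n. norm (X n) \<le> r"
    by (auto simp: bounded_iff)
  then have "\<forall>n. X n \<in> cball 0 r"
    by simp
  with X show "convergent X"
    using compact_imp_complete[OF compact_cball_scalar[of r]]
    by (meson completeE convergentI)
qed

section \<open>Dominated linear functionals\<close>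

definition sublinear :: "('v::real_vector \<Rightarrow> real) \<Rightarrow> bool" where
  "sublinear q \<longleftrightarrow> (\<forall>x y. q (x + y) \<le> q x + q y) \<and> (\<forall>r\<ge>0. \<forall>x. q (r *\<^sub>R x) = r * q x)"

text \<open>The minorant is \<open>x \<mapsto> inf {q (x + t v) - t q v | t \<ge> 0}\<close>, which improves \<open>q\<close> towards being
additive in the direction \<open>v\<close>. A minimal sublinear functional equals all these minorants and is thus linear.\<close>

lemma sublinear_minorant:
  assumes q: "sublinear q"
  obtains r where "sublinear r" and "\<And>x. r x \<le> q x" and "\<And>x. r x \<le> q (x + v) - q v"
proof -
  have add: "q (x + y) \<le> q x + q y" and hom: "c \<ge> 0 \<Longrightarrow> q (c *\<^sub>R x) = c * q x" for x y c
    using q by (auto simp: sublinear_def)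
  define r where "r x = (INF t\<in>{0..}. q (x + t *\<^sub>R v) - t * q v)" for x
  have low: "- q (- x) \<le> q (x + t *\<^sub>R v) - t * q v" if "t \<ge> 0" for x t
    using add[of "x + t *\<^sub>R v" "- x"] hom[OF that, of v] by simp
  have bdd: "bdd_below ((\<lambda>t. q (x + t *\<^sub>R v) - t * q v) ` {0..})" for x
    by (rule bdd_belowI2[of _ "- q (- x)"]) (use low in auto)
  have le: "r x \<le> q (x + t *\<^sub>R v) - t * q v" if "t \<ge> 0" for x t
    unfolding r_def by (rule cINF_lower[OF bdd]) (use that in auto)
  have ge: "c \<le> r x" if "\<And>t. t \<ge> 0 \<Longrightarrow> c \<le> q (x + t *\<^sub>R v) - t * q v" for c x
    unfolding r_def by (rule cINF_greatest) (use that in auto)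
  have r_add: "r (x + y) \<le> r x + r y" for x y
  proof -
    have 1: "r (x + y) \<le> (q (x + s *\<^sub>R v) - s * q v) + (q (y + t *\<^sub>R v) - t * q v)" if "s \<ge> 0" "t \<ge> 0" for s t
      using le[of "s + t" "x + y"] add[of "x + s *\<^sub>R v" "y + t *\<^sub>R v"] that
      by (simp add: algebra_simps)
    have 2: "r (x + y) - (q (x + s *\<^sub>R v) - s * q v) \<le> r y" if "s \<ge> 0" for s
      by (rule ge) (use 1[OF that] in \<open>simp add: algebra_simps\<close>)
    have "r (x + y) - r y \<le> r x"
      by (rule ge) (use 2 in \<open>simp add: algebra_simps\<close>)
    then show ?thesis by simp
  qed
  have hom_le: "r (c *\<^sub>R x) \<le> c * r x" if "c > 0" for c x
  proof -
    have "r (c *\<^sub>R x) / c \<le> r x"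
    proof (rule ge)
      fix t :: real assume t: "t \<ge> 0"
      have "r (c *\<^sub>R x) \<le> q (c *\<^sub>R x + (c * t) *\<^sub>R v) - c * t * q v"
        using le[of "c * t" "c *\<^sub>R x"] t that by simp
      also have "\<dots> = c * (q (x + t *\<^sub>R v) - t * q v)"
        using hom[of c "x + t *\<^sub>R v"] that by (simp add: algebra_simps)
      finally show "r (c *\<^sub>R x) / c \<le> q (x + t *\<^sub>R v) - t * q v"
        using that by (simp add: pos_divide_le_eq mult.commute)
    qed
    then show ?thesis
      using that by (simp add: pos_divide_le_eq mult.commute)
  qed
  have q0: "q 0 = 0"
    using hom[of 0 0] by simp
  have r0: "r 0 = 0"
    using le[of 0 0] ge[of 0 0] by (auto simp: q0 hom intro!: antisym)
  have r_hom: "r (c *\<^sub>R x) = c * r x" if c: "c \<ge> 0" for c x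
  proof (cases "c = 0")
    case True
    then show ?thesis by (simp add: r0)
  next
    case False
    with c have c: "c > 0" by simp
    have "r x \<le> r (c *\<^sub>R x) / c"
      using hom_le[of "inverse c" "c *\<^sub>R x"] c by (simp add: divide_inverse mult.commute)
    then have "c * r x \<le> r (c *\<^sub>R x)"
      using c by (simp add: pos_le_divide_eq mult.commute)
    with hom_le[OF c, of x] show ?thesis by simp
  qed
  have "sublinear r"
    unfolding sublinear_def using r_add r_hom by blast
  moreover have "r x \<le> q x" for x
    using le[of 0 x] by simp
  moreover have "r x \<le> q (x + v) - q v" for x
    using le[of 1 x] by simp
  ultimately show ?thesis
    by (rule that)
qed

text \<open>Zorn's lemma: a chain of sublinear functionals below \<open>q\<close> has its pointwise infimum as a lower bound,
which is finite since \<open>- q (- x)\<close> bounds every member from below.\<close>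

lemma minimal_sublinear_exists:
  assumes q: "sublinear q"
  obtains m where "sublinear m" and "m \<le> q" and "\<And>r. sublinear r \<Longrightarrow> r \<le> m \<Longrightarrow> r = m"
proof -
  let ?A = "{r. sublinear r \<and> r \<le> q}"
  have "\<exists>m\<in>?A. \<forall>a\<in>?A. a \<le> m \<longrightarrow> a = m"
  proof (rule predicate_Zorn)
    show "partial_order_on ?A (relation_of (\<lambda>a b. b \<le> a) ?A)"
      by (rule partial_order_on_relation_ofI) auto
  next
    fix C assume "C \<in> Chains (relation_of (\<lambda>a b. b \<le> a) ?A)"
    then have CA: "\<And>r. r \<in> C \<Longrightarrow> sublinear r \<and> r \<le> q" and
      ch: "\<And>r s. r \<in> C \<Longrightarrow> s \<in> C \<Longrightarrow> s \<le> r \<or> r \<le> s"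
      by (auto simp: Chains_def relation_of_def)
    show "\<exists>u\<in>?A. \<forall>a\<in>C. u \<le> a"
    proof (cases "C = {}")
      case True
      with q show ?thesis by auto
    next
      case ne: False
      define u where "u x = (INF r\<in>C. r x)" for x
      have low: "- q (- x) \<le> r x" if "r \<in> C" for r x
      proof -
        have sr: "sublinear r" and rq: "r \<le> q"
          using CA[OF that] by auto
        have "r 0 = 0 * r 0"
          using sr by (metis order_refl scaleR_zero_left sublinear_def)
        then have "0 \<le> r x + r (- x)"
          using sr by (metis add.right_inverse mult_zero_left sublinear_def)
        with le_funD[OF rq, of "- x"] show ?thesis by linarith
      qed
      have bdd: "bdd_below ((\<lambda>r. r x) ` C)" for x
        by (rule bdd_belowI2[of _ "- q (- x)"]) (use low in auto)
      have le: "u x \<le> r x" if "r \<in> C" for r x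
        unfolding u_def by (rule cINF_lower[OF bdd that])
      have ge: "c \<le> u x" if "\<And>r. r \<in> C \<Longrightarrow> c \<le> r x" for c x
        unfolding u_def by (rule cINF_greatest[OF ne that])
      have add: "u (x + y) \<le> u x + u y" for x y
      proof -
        have 1: "u (x + y) \<le> r x + s y" if "r \<in> C" "s \<in> C" for r s
        proof -
          have "\<exists>t\<in>C. t \<le> r \<and> t \<le> s"
            using ch[OF that] that by auto
          then obtain t where t: "t \<in> C" "t \<le> r" "t \<le> s"
            by blast
          have "u (x + y) \<le> t (x + y)" using le t by blast
          also have "\<dots> \<le> t x + t y" using CA[OF t(1)] by (simp add: sublinear_def)
          also have "\<dots> \<le> r x + s y" using t by (intro add_mono) (auto dest: le_funD)
          finally show ?thesis .
        qed
        have 2: "u (x + y) - r x \<le> u y" if "r \<in> C" for r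
          by (rule ge) (use 1[OF that] in \<open>simp add: algebra_simps\<close>)
        have "u (x + y) - u y \<le> u x"
          by (rule ge) (use 2 in \<open>simp add: algebra_simps\<close>)
        then show ?thesis by simp
      qed
      have hom: "u (c *\<^sub>R x) = c * u x" if c: "c \<ge> 0" for c x
      proof -
        have "u (c *\<^sub>R x) = (INF r\<in>C. c * r x)"
          unfolding u_def using CA c by (intro INF_cong) (auto simp: sublinear_def)
        also have "\<dots> = c * u x"
        proof (cases "c = 0")
          case True
          with ne show ?thesis by simp
        next
          case False
          with c have c: "c > 0" by simp
          have "(INF r\<in>C. c * r x) / c \<le> u x"
          proof (rule ge)
            fix r assume r: "r \<in> C"
            have "(INF r\<in>C. c * r x) \<le> c * r x"
              by (rule cINF_lower[OF _ r], rule bdd_belowI2[of _ "c * (- q (- x))"])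
                 (rule mult_left_mono, use low c in auto)
            with c show "(INF r\<in>C. c * r x) / c \<le> r x"
              by (simp add: pos_divide_le_eq mult.commute)
          qed
          moreover have "c * u x \<le> (INF r\<in>C. c * r x)"
            by (rule cINF_greatest[OF ne]) (use le c in auto)
          ultimately show ?thesis
            using c by (simp add: pos_divide_le_eq mult.commute)
        qed
        finally show ?thesis .
      qed
      have "sublinear u"
        unfolding sublinear_def using add hom by blast
      moreover have "u \<le> q"
      proof (rule le_funI)
        fix x
        obtain r where "r \<in> C" using ne by blast
        then show "u x \<le> q x"
          using le[of r x] CA[of r] by (meson le_funD order_trans)
      qed
      ultimately show ?thesis
        using le by (auto simp: le_fun_def)
    qed
  qed
  then obtain m where "m \<in> ?A" and min: "\<And>a. a \<in> ?A \<Longrightarrow> a \<le> m \<Longrightarrow> a = m"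
    by blast
  then show ?thesis
    by (intro that[of m]) (auto intro: order_trans)
qed

text \<open>Applying the minorant construction to \<open>q\<close> and \<open>v\<close> before minimising forces the value \<open>q v\<close> at \<open>v\<close>.\<close>

lemma Hahn_Banach_sublinear:
  assumes q: "sublinear q"
  obtains u :: "'v::real_vector \<Rightarrow> real" where "linear u" and "\<And>x. u x \<le> q x" and "u v = q v"
proof -
  obtain q1 where q1: "sublinear q1" "\<And>x. q1 x \<le> q x" "\<And>x. q1 x \<le> q (x + v) - q v"
    using sublinear_minorant[OF q] by blast
  obtain m where m: "sublinear m" "m \<le> q1" and min: "\<And>r. sublinear r \<Longrightarrow> r \<le> m \<Longrightarrow> r = m"
    using minimal_sublinear_exists[OF q1(1)] by blast
  have sub: "m (x + y) \<le> m x + m y" and hom: "c \<ge> 0 \<Longrightarrow> m (c *\<^sub>R x) = c * m x" for x y c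
    using m(1) by (auto simp: sublinear_def)
  have add: "m (x + y) = m x + m y" for x y
  proof -
    obtain r where r: "sublinear r" "\<And>x. r x \<le> m x" "\<And>x. r x \<le> m (x + y) - m y"
      using sublinear_minorant[OF m(1)] by blast
    have "r = m"
      using min[OF r(1)] r(2) by (simp add: le_fun_def)
    with r(3)[of x] sub[of x y] show ?thesis by simp
  qed
  have m0: "m 0 = 0"
    using hom[of 0 0] by simp
  have neg: "m (- x) = - m x" for x
    using add[of x "- x"] m0 by simp
  have lin: "linear m"
  proof (rule linearI)
    show "m (c *\<^sub>R x) = c *\<^sub>R m x" for c x
    proof (cases "c \<ge> 0")
      case False
      then show ?thesis
        using hom[of "- c" x] neg[of "c *\<^sub>R x"] by simp
    qed (simp add: hom)
  qed (rule add)
  have le: "m x \<le> q x" for x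
    using le_funD[OF m(2), of x] q1(2)[of x] by linarith
  have "q 0 = 0"
    using q by (metis mult_zero_left order_refl scaleR_zero_left sublinear_def)
  then have "m (- v) \<le> - q v"
    using le_funD[OF m(2), of "- v"] q1(3)[of "- v"] by simp
  with neg[of v] le[of v] have "m v = q v"
    by simp
  with lin le show ?thesis
    by (rule that)
qed

section \<open>Riemann sums and null sequences\<close>

text \<open>The error depends on \<open>\<phi>\<close> only through its oscillation. For \<open>\<phi> s = u (T(s) x)\<close> with a functional \<open>u\<close> dominated by a
seminorm \<open>p\<close>, it is therefore controlled by the oscillation of the orbit for \<open>p\<close>, whatever \<open>u\<close> is.\<close>

lemma Riemann_sum_error:
  fixes \<phi> :: "real \<Rightarrow> 'b::banach"
  assumes cont: "continuous_on {0..t} \<phi>" and t: "t \<ge> 0" and n: "n > 0" and e: "e \<ge> 0"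
    and osc: "\<And>r s. r \<in> {0..t} \<Longrightarrow> s \<in> {0..t} \<Longrightarrow> \<bar>r - s\<bar> \<le> t / real n \<Longrightarrow> norm (\<phi> r - \<phi> s) \<le> e"
  shows "norm ((\<Sum>k<n. (t / n) *\<^sub>R \<phi> (real k * t / n)) - integral {0..t} \<phi>) \<le> t * e"
proof -
  define d where "d = t / real n"
  have d: "d \<ge> 0" and nd: "real n * d = t"
    using t n by (auto simp: d_def)
  have "norm ((\<Sum>k<m. d *\<^sub>R \<phi> (real k * d)) - integral {0..m * d} \<phi>) \<le> m * d * e" if "m \<le> n" for m
    using that
  proof (induction m)
    case 0
    then show ?case by simp
  next
    case (Suc m)
    have le: "real m * d \<le> real (Suc m) * d" "real (Suc m) * d \<le> t"
      using d Suc.prems nd by (auto simp: mult_right_mono simp flip: nd)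
    have m0: "0 \<le> real m * d"
      using d by simp
    have int: "\<phi> integrable_on {a..b}" if "0 \<le> a" "b \<le> t" for a b
      by (rule integrable_continuous_interval, rule continuous_on_subset[OF cont]) (use that in auto)
    have split: "integral {0..m * d} \<phi> + integral {m * d..Suc m * d} \<phi> = integral {0..Suc m * d} \<phi>"
      by (rule Henstock_Kurzweil_Integration.integral_combine) (use le m0 int in auto)
    have w: "Suc m * d - m * d = d"
      by (simp add: algebra_simps)
    have "norm (integral {m * d..Suc m * d} (\<lambda>s. \<phi> s - \<phi> (m * d))) \<le> e * (Suc m * d - m * d)"
    proof (rule integral_bound)
      show "continuous_on {m * d..Suc m * d} (\<lambda>s. \<phi> s - \<phi> (m * d))"
        by (intro continuous_intros continuous_on_subset[OF cont]) (use le m0 in auto)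
      show "norm (\<phi> s - \<phi> (m * d)) \<le> e" if "s \<in> {m * d..Suc m * d}" for s
      proof (rule osc)
        show "s \<in> {0..t}" "m * d \<in> {0..t}"
          using that le m0 unfolding atLeastAtMost_iff by linarith+
        show "\<bar>s - m * d\<bar> \<le> t / real n"
          using that by (auto simp: algebra_simps simp flip: d_def)
      qed
    qed (use le in auto)
    moreover have "integral {m * d..Suc m * d} (\<lambda>s. \<phi> s - \<phi> (m * d))
        = integral {m * d..Suc m * d} \<phi> - d *\<^sub>R \<phi> (m * d)"
      using le m0 int w by (subst integral_diff) auto
    ultimately have "norm (integral {m * d..Suc m * d} \<phi> - d *\<^sub>R \<phi> (m * d)) \<le> d * e"
      unfolding w by (simp only: mult.commute)
    then have "norm (d *\<^sub>R \<phi> (m * d) - integral {m * d..Suc m * d} \<phi>) \<le> d * e"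
      by (simp only: norm_minus_commute)
    with Suc.IH Suc.prems
    have "norm (((\<Sum>k<m. d *\<^sub>R \<phi> (real k * d)) - integral {0..m * d} \<phi>) +
        (d *\<^sub>R \<phi> (m * d) - integral {m * d..Suc m * d} \<phi>)) \<le> m * d * e + d * e"
      by (intro norm_triangle_mono) auto
    moreover have "m * d * e + d * e = Suc m * d * e"
      by (simp add: algebra_simps)
    ultimately show ?case
      by (simp only: split[symmetric] sum.lessThan_Suc add_diff_add)
  qed
  from this[of n] show ?thesis
    unfolding nd by (simp add: d_def)
qed

lemma Riemann_sum_tendsto:
  fixes \<phi> :: "real \<Rightarrow> 'b::banach"
  assumes cont: "continuous_on {0..t} \<phi>" and t: "t \<ge> 0"
  shows "(\<lambda>n. \<Sum>k<Suc n. (t / Suc n) *\<^sub>R \<phi> (real k * t / Suc n)) \<longlonglongrightarrow> integral {0..t} \<phi>"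
proof (rule LIMSEQ_I)
  fix e :: real assume e: "e > 0"
  define e' where "e' = e / (t + 1)"
  have e': "e' > 0" and te: "t * e' < e"
    using e t by (auto simp: e'_def field_simps)
  have "uniformly_continuous_on {0..t} \<phi>"
    by (rule compact_uniformly_continuous[OF cont compact_Icc])
  then obtain d where d: "d > 0" and
    osc: "\<And>r s. r \<in> {0..t} \<Longrightarrow> s \<in> {0..t} \<Longrightarrow> dist r s < d \<Longrightarrow> dist (\<phi> r) (\<phi> s) < e'"
    using e' unfolding uniformly_continuous_on_def by metis
  obtain N where N: "t / d < real N"
    using reals_Archimedean2 by blast
  have "norm ((\<Sum>k<Suc n. (t / Suc n) *\<^sub>R \<phi> (real k * t / Suc n)) - integral {0..t} \<phi>) < e" if n: "n \<ge> N" for n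
  proof -
    have "t / d < real (Suc n)"
      using N n by linarith
    then have "t / real (Suc n) < d"
      using d by (simp add: field_simps)
    then have "norm ((\<Sum>k<Suc n. (t / Suc n) *\<^sub>R \<phi> (real k * t / Suc n)) - integral {0..t} \<phi>) \<le> t * e'"
      by (intro Riemann_sum_error[OF cont t]) (use osc e' in \<open>auto simp: dist_norm less_imp_le\<close>)
    with te show ?thesis by simp
  qed
  then show "\<exists>N. \<forall>n\<ge>N. norm ((\<Sum>k<Suc n. (t / Suc n) *\<^sub>R \<phi> (real k * t / Suc n)) - integral {0..t} \<phi>) < e"
    by blast
qed

lemma null_seq_squeeze:
  fixes a b :: "nat \<Rightarrow> real"
  assumes "b \<longlonglongrightarrow> 0" and "\<And>n. 0 \<le> a n" and "\<And>n. a n \<le> b n"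
  shows "a \<longlonglongrightarrow> 0"
  by (rule tendsto_sandwich[OF _ _ tendsto_const assms(1)]) (simp_all add: assms)

section \<open>Sequences in the mixed topology\<close>

context banach_space_over
begin

lemma seminorm_props:
  assumes "seminorm sc q"
  shows "q x \<ge> 0" "q (x + y) \<le> q x + q y" "q (sc c x) = norm c * q x"
    "q (r *\<^sub>R x) = \<bar>r\<bar> * q x" "q 0 = 0" "q (- x) = q x" "q (x - y) \<le> q x + q y"
    "q (x - y) = q (y - x)"
proof -
  show *: "q x \<ge> 0" "q (x + y) \<le> q x + q y" "q (sc c x) = norm c * q x" for x y c
    using assms by (auto simp: seminorm_def)
  show r: "q (r *\<^sub>R x) = \<bar>r\<bar> * q x" for r x
    using *(3)[of "of_real r" x] by (simp add: sc_of_real)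
  show "q 0 = 0"
    using r[of 0 0] by simp
  show m: "q (- x) = q x" for x
    using r[of "-1" x] by simp
  show "q (x - y) \<le> q x + q y"
    using *(2)[of x "- y"] m[of y] by simp
  show "q (x - y) = q (y - x)"
    using m[of "x - y"] by simp
qed

lemma sc_scaleR: "sc c (r *\<^sub>R y) = r *\<^sub>R sc c y"
  by (simp only: sc_of_real[symmetric] scale_left_commute)

end

locale seminormed_space = banach_space_over sc
  for sc :: "'k::real_or_complex \<Rightarrow> 'a::banach \<Rightarrow> 'a" +
  fixes P :: "('a \<Rightarrow> real) set"
  assumes P_nonempty: "P \<noteq> {}"
    and P_seminorm: "p \<in> P \<Longrightarrow> seminorm sc p"
    and P_bdd: "bdd_above ((\<lambda>p. p x) ` P)"
    and norm_eq_SUP: "norm x = (SUP p\<in>P. p x)"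
begin

text \<open>The convergent sequences of the mixed topology, in a form that only involves the seminorms.\<close>

definition conv :: "(nat \<Rightarrow> 'a) \<Rightarrow> 'a \<Rightarrow> bool" where
  "conv s x \<longleftrightarrow> bounded (range s) \<and> (\<forall>p\<in>P. (\<lambda>n. p (s n - x)) \<longlonglongrightarrow> 0)"

lemmas P_props = seminorm_props[OF P_seminorm]

lemma P_le_norm: "p \<in> P \<Longrightarrow> p x \<le> norm x"
  unfolding norm_eq_SUP by (rule cSUP_upper[OF _ P_bdd])

lemma norm_leI: "(\<And>p. p \<in> P \<Longrightarrow> p x \<le> C) \<Longrightarrow> norm x \<le> C"
  unfolding norm_eq_SUP by (rule cSUP_least[OF P_nonempty])

lemma norm_less_P: "C < norm x \<Longrightarrow> \<exists>p\<in>P. C < p x"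
  using norm_leI[of x C] by (meson not_le)

lemma P_sublinear: "p \<in> P \<Longrightarrow> sublinear p"
  by (auto simp: sublinear_def P_props(2,4))

lemma convI:
  assumes "\<And>n. norm (s n) \<le> C" and "\<And>p. p \<in> P \<Longrightarrow> (\<lambda>n. p (s n - x)) \<longlonglongrightarrow> 0"
  shows "conv s x"
  using assms by (auto simp: conv_def bounded_iff)

lemma conv_bound:
  assumes "conv s x"
  obtains C where "C > 0" and "\<And>n. norm (s n) \<le> C"
  using assms unfolding conv_def bounded_pos by auto

lemma convD: "conv s x \<Longrightarrow> p \<in> P \<Longrightarrow> (\<lambda>n. p (s n - x)) \<longlonglongrightarrow> 0"
  by (simp add: conv_def)

lemma conv_0_iff: "conv (\<lambda>n. s n - x) 0 \<longleftrightarrow> conv s x"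
proof -
  have "bounded (range (\<lambda>n. s n - x)) \<longleftrightarrow> bounded (range s)"
    using bounded_plus_comp[of s UNIV "\<lambda>_. - x"] bounded_plus_comp[of "\<lambda>n. s n - x" UNIV "\<lambda>_. x"]
    by auto
  then show ?thesis
    by (simp add: conv_def)
qed

lemma tendsto_imp_conv:
  assumes "s \<longlonglongrightarrow> x"
  shows "conv s x"
  unfolding conv_def
proof (intro conjI ballI)
  show "bounded (range s)"
    using assms by (rule convergent_imp_bounded)
  fix p assume p: "p \<in> P"
  show "(\<lambda>n. p (s n - x)) \<longlonglongrightarrow> 0"
    by (rule Lim_null_comparison[of _ "\<lambda>n. norm (s n - x)"])
       (use P_le_norm[OF p] P_props(1)[OF p] assms in \<open>auto simp: tendsto_norm_zero LIM_zero\<close>)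
qed

lemma conv_const: "conv (\<lambda>_. x) x"
  by (rule tendsto_imp_conv) simp

lemma conv_unique:
  assumes "conv s x" "conv s y"
  shows "x = y"
proof -
  have "norm (x - y) \<le> 0"
  proof (rule norm_leI)
    fix p assume p: "p \<in> P"
    have "(\<lambda>n. p (s n - x) + p (s n - y)) \<longlonglongrightarrow> 0 + 0"
      by (intro tendsto_add convD[OF _ p] assms)
    moreover have "p (x - y) \<le> p (s n - x) + p (s n - y)" for n
      using P_props(7)[OF p, of "s n - y" "s n - x"] by simp
    ultimately show "p (x - y) \<le> 0"
      using LIMSEQ_le_const by fastforce
  qed
  then show ?thesis by simp
qed

lemma conv_add:
  assumes "conv s x" "conv t y"
  shows "conv (\<lambda>n. s n + t n) (x + y)"
  unfolding conv_def
proof (intro conjI ballI)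
  show "bounded (range (\<lambda>n. s n + t n))"
    using assms by (auto simp: conv_def intro: bounded_plus_comp)
  fix p assume p: "p \<in> P"
  show "(\<lambda>n. p (s n + t n - (x + y))) \<longlonglongrightarrow> 0"
  proof (rule null_seq_squeeze)
    show "(\<lambda>n. p (s n - x) + p (t n - y)) \<longlonglongrightarrow> 0"
      using tendsto_add[OF convD[OF assms(1) p] convD[OF assms(2) p]] by simp
    show "p (s n + t n - (x + y)) \<le> p (s n - x) + p (t n - y)" for n
      unfolding add_diff_add by (rule P_props(2)[OF p])
  qed (rule P_props(1)[OF p])
qed

lemma conv_sc:
  assumes "conv s x"
  shows "conv (\<lambda>n. sc c (s n)) (sc c x)"
  unfolding conv_def
proof (intro conjI ballI)
  obtain C where C: "\<And>n. norm (s n) \<le> C" using assms conv_bound by blast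
  have "norm (sc c (s n)) \<le> norm c * C" for n
    unfolding norm_sc by (rule mult_left_mono[OF C]) simp
  then show "bounded (range (\<lambda>n. sc c (s n)))"
    by (auto simp: bounded_iff)
  fix p assume p: "p \<in> P"
  have "(\<lambda>n. norm c * p (s n - x)) \<longlonglongrightarrow> norm c * 0"
    by (intro tendsto_mult tendsto_const convD[OF assms p])
  moreover have "p (sc c (s n) - sc c x) = norm c * p (s n - x)" for n
    unfolding scale_right_diff_distrib[symmetric] by (rule P_props(3)[OF p])
  ultimately show "(\<lambda>n. p (sc c (s n) - sc c x)) \<longlonglongrightarrow> 0"
    by simp
qed

lemma conv_scaleR: "conv s x \<Longrightarrow> conv (\<lambda>n. r *\<^sub>R s n) (r *\<^sub>R x)"
  using conv_sc[of s x "of_real r"] by (simp add: sc_of_real)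

lemma conv_diff: "conv s x \<Longrightarrow> conv t y \<Longrightarrow> conv (\<lambda>n. s n - t n) (x - y)"
  using conv_add[of s x "\<lambda>n. - t n" "- y"] conv_scaleR[of t y "-1"] by simp

lemma conv_norm_le:
  assumes "conv s x" and C: "\<And>n. norm (s n) \<le> C"
  shows "norm x \<le> C"
proof (rule norm_leI)
  fix p assume p: "p \<in> P"
  have "(\<lambda>n. p (s n - x) + C) \<longlonglongrightarrow> 0 + C"
    by (intro tendsto_add convD[OF _ p] assms tendsto_const)
  moreover have "p x \<le> p (s n - x) + C" for n
    using P_props(7)[OF p, of "s n" "s n - x"] P_le_norm[OF p, of "s n"] C[of n] by simp
  ultimately show "p x \<le> C"
    using LIMSEQ_le_const[of "\<lambda>n. p (s n - x) + C" C "p x"] by auto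
qed

lemma conv_compose: "conv s x \<Longrightarrow> filterlim n at_top sequentially \<Longrightarrow> conv (\<lambda>k. s (n k)) x"
  unfolding conv_def
proof (intro conjI ballI)
  assume s: "bounded (range s) \<and> (\<forall>p\<in>P. (\<lambda>n. p (s n - x)) \<longlonglongrightarrow> 0)" and n: "filterlim n at_top sequentially"
  show "bounded (range (\<lambda>k. s (n k)))"
    by (rule bounded_subset[of "range s"]) (use s in auto)
  fix p assume "p \<in> P"
  with s have "(\<lambda>n. p (s n - x)) \<longlonglongrightarrow> 0" by blast
  from filterlim_compose[OF this n] show "(\<lambda>k. p (s (n k) - x)) \<longlonglongrightarrow> 0" .
qed

lemma conv_bounded_scaleR:
  assumes s: "conv s 0" and r: "\<And>n. \<bar>r n\<bar> \<le> C"
  shows "conv (\<lambda>n. r n *\<^sub>R s n) 0"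
proof -
  obtain K where K: "K > 0" "\<And>n. norm (s n) \<le> K"
    using s conv_bound by blast
  have C: "C \<ge> 0"
    using r[of 0] by simp
  show ?thesis
  proof (rule convI)
    show "norm (r n *\<^sub>R s n) \<le> C * K" for n
      unfolding norm_scaleR by (intro mult_mono r K C) simp
    fix p assume p: "p \<in> P"
    show "(\<lambda>n. p (r n *\<^sub>R s n - 0)) \<longlonglongrightarrow> 0"
    proof (rule null_seq_squeeze)
      show "(\<lambda>n. C * p (s n)) \<longlonglongrightarrow> 0"
        using tendsto_mult[OF tendsto_const[of C] convD[OF s p]] by simp
      show "p (r n *\<^sub>R s n - 0) \<le> C * p (s n)" for n
        unfolding diff_0_right P_props(4)[OF p] by (rule mult_right_mono[OF r P_props(1)[OF p]])
    qed (rule P_props(1)[OF p])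
  qed
qed

lemma conv_tendsto_scaleR:
  assumes s: "conv s x" and r: "r \<longlonglongrightarrow> r0"
  shows "conv (\<lambda>n. r n *\<^sub>R s n) (r0 *\<^sub>R x)"
proof -
  obtain C where C: "\<And>n. \<bar>r n\<bar> \<le> C"
    using convergent_imp_bounded[OF r] by (auto simp: bounded_iff)
  have "conv (\<lambda>n. r n *\<^sub>R (s n - x)) 0"
    by (rule conv_bounded_scaleR[OF _ C]) (use s in \<open>simp add: conv_0_iff\<close>)
  moreover have "conv (\<lambda>n. r n *\<^sub>R x) (r0 *\<^sub>R x)"
    by (rule tendsto_imp_conv) (intro tendsto_intros r)
  ultimately have "conv (\<lambda>n. r n *\<^sub>R (s n - x) + r n *\<^sub>R x) (0 + r0 *\<^sub>R x)"
    by (rule conv_add)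
  then show ?thesis
    by (simp add: scaleR_diff_right)
qed

text \<open>Null sequences are closed under uniform norm approximation since each seminorm is dominated by the norm.\<close>

lemma conv_null_approx:
  assumes "\<And>e. e > 0 \<Longrightarrow> \<exists>u. conv u 0 \<and> (\<forall>n. norm (v n - u n) \<le> e)"
  shows "conv v 0"
proof -
  obtain u1 where u1: "conv u1 0" "\<And>n. norm (v n - u1 n) \<le> 1"
    using assms[of 1] by auto
  obtain C where C: "\<And>n. norm (u1 n) \<le> C"
    using u1(1) conv_bound by blast
  show ?thesis
  proof (rule convI)
    show "norm (v n) \<le> 1 + C" for n
      using norm_triangle_ineq[of "v n - u1 n" "u1 n"] u1(2)[of n] C[of n] by simp
    fix p assume p: "p \<in> P"
    show "(\<lambda>n. p (v n - 0)) \<longlonglongrightarrow> 0"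
    proof (rule LIMSEQ_I)
      fix e :: real assume e: "e > 0"
      then obtain u where u: "conv u 0" "\<And>n. norm (v n - u n) \<le> e / 2"
        using assms[of "e / 2"] by auto
      from order_tendstoD(2)[OF convD[OF u(1) p], of "e / 2"] e
      obtain N where N: "\<And>n. n \<ge> N \<Longrightarrow> p (u n - 0) < e / 2"
        by (auto simp: eventually_sequentially)
      have "norm (p (v n - 0) - 0) < e" if "n \<ge> N" for n
        using P_props(2)[OF p, of "v n - u n" "u n"] P_le_norm[OF p, of "v n - u n"] u(2)[of n]
          N[OF that] P_props(1)[OF p, of "v n"] by simp
      then show "\<exists>N. \<forall>n\<ge>N. norm (p (v n - 0) - 0) < e"
        by blast
    qed
  qed
qed

text \<open>Solving \<open>v = s + S v\<close> preserves null sequences: the iterates \<open>u \<mapsto> s + S u\<close> starting from \<open>0\<close> are null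
sequences and approach \<open>v\<close> geometrically and uniformly.\<close>

lemma conv_contraction_fixed_points:
  fixes S :: "'a \<Rightarrow>\<^sub>L 'a"
  assumes S: "norm S \<le> 1 / 2" and S_conv: "\<And>u. conv u 0 \<Longrightarrow> conv (\<lambda>n. S (u n)) 0"
    and s: "conv s 0" and v: "\<And>n. v n = s n + S (v n)" and K: "\<And>n. norm (v n) \<le> K"
  shows "conv v 0"
proof (rule conv_null_approx)
  have approx: "\<exists>u. conv u 0 \<and> (\<forall>n. norm (v n - u n) \<le> (1 / 2) ^ k * K)" for k
  proof (induction k)
    case 0
    then show ?case
      using conv_const[of 0] K by (intro exI[of _ "\<lambda>_. 0"]) auto
  next
    case (Suc k)
    then obtain u where u: "conv u 0" "\<And>n. norm (v n - u n) \<le> (1 / 2) ^ k * K"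
      by blast
    have "conv (\<lambda>n. s n + S (u n)) (0 + 0)"
      by (intro conv_add s S_conv u(1))
    moreover have "norm (v n - (s n + S (u n))) \<le> (1 / 2) ^ Suc k * K" for n
    proof -
      have "v n - (s n + S (u n)) = S (v n - u n)"
        using v[of n] by (simp add: blinfun.diff_right algebra_simps)
      then have "norm (v n - (s n + S (u n))) \<le> norm S * norm (v n - u n)"
        by (simp only: norm_blinfun)
      also have "\<dots> \<le> 1 / 2 * ((1 / 2) ^ k * K)"
        by (rule mult_mono[OF S u(2)]) auto
      finally show ?thesis by simp
    qed
    ultimately show ?case
      by (intro exI[of _ "\<lambda>n. s n + S (u n)"]) auto
  qed
  fix e :: real assume e: "e > 0"
  obtain k where "(1 / 2 :: real) ^ k < e / (\<bar>K\<bar> + 1)"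
    using real_arch_pow_inv[of "e / (\<bar>K\<bar> + 1)" "1 / 2"] e by auto
  then have "(1 / 2) ^ k * (\<bar>K\<bar> + 1) < e"
    by (simp add: pos_less_divide_eq)
  moreover have "(1 / 2) ^ k * K \<le> (1 / 2) ^ k * (\<bar>K\<bar> + 1)"
    by (rule mult_left_mono) auto
  ultimately have "(1 / 2) ^ k * K \<le> e"
    by linarith
  with approx[of k] show "\<exists>u. conv u 0 \<and> (\<forall>n. norm (v n - u n) \<le> e)"
    by (meson order_trans)
qed

definition conv_continuous :: "('a \<Rightarrow> 'b::real_normed_vector) \<Rightarrow> bool" where
  "conv_continuous f \<longleftrightarrow> linear f \<and> (\<forall>s x. conv s x \<longrightarrow> (\<lambda>n. f (s n)) \<longlonglongrightarrow> f x)"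

lemma dominated_conv_continuous:
  fixes u :: "'a \<Rightarrow> real"
  assumes lin: "linear u" and le: "\<And>x. u x \<le> p x" and p: "p \<in> P"
  shows "conv_continuous u" and "\<bar>u x\<bar> \<le> p x"
proof -
  show *: "\<bar>u x\<bar> \<le> p x" for x
    using le[of x] le[of "- x"] P_props(6)[OF p, of x] by (simp add: linear_neg[OF lin] abs_le_iff)
  show "conv_continuous u"
    unfolding conv_continuous_def
  proof (intro conjI allI impI lin)
    fix s x assume "conv s x"
    then have "(\<lambda>n. p (s n - x)) \<longlonglongrightarrow> 0"
      using p by (rule convD)
    then have "(\<lambda>n. u (s n) - u x) \<longlonglongrightarrow> 0"
      by (rule Lim_null_comparison[rotated]) (simp add: * flip: linear_diff[OF lin])
    then show "(\<lambda>n. u (s n)) \<longlonglongrightarrow> u x"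
      by (simp add: LIM_zero_cancel)
  qed
qed

text \<open>Estimates for \<open>p\<close> of a limit of Riemann sums reduce to estimates of scalar integrals by choosing \<open>u\<close> norming
for the vector in question; real-linear functionals suffice for this.\<close>

lemma norming_functional:
  assumes p: "p \<in> P"
  obtains u :: "'a \<Rightarrow> real" where "conv_continuous u" and "\<And>x. \<bar>u x\<bar> \<le> p x" and "u w = p w"
proof -
  obtain u where u: "linear u" "\<And>x. u x \<le> p x" "u w = p w"
    using Hahn_Banach_sublinear[OF P_sublinear[OF p]] by blast
  show ?thesis
    using dominated_conv_continuous[OF u(1,2) p] u(3) that by blast
qed

text \<open>The space \<open>X\<^sup>\<circ>\<close>: by the characterisation of \<open>\<gamma>\<close>-convergence, \<open>\<tau>\<close>-sequential continuity on bounded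
sets is sequential continuity for \<open>conv\<close>.\<close>

definition circ :: "('a \<Rightarrow>\<^sub>L 'k) set" where
  "circ = {f \<in> norm_dual sc. \<forall>s x. conv s x \<longrightarrow> (\<lambda>n. f (s n)) \<longlonglongrightarrow> f x}"

lemma circD:
  assumes "f \<in> circ"
  shows "f (sc c x) = c * f x" and "conv s x \<Longrightarrow> (\<lambda>n. f (s n)) \<longlonglongrightarrow> f x"
    and "conv_continuous f"
  using assms by (auto simp: circ_def norm_dual_def conv_continuous_def bounded_linear.linear[OF blinfun.bounded_linear_right])

lemma circI:
  fixes f :: "'a \<Rightarrow>\<^sub>L 'k"
  assumes "\<And>c x. f (sc c x) = c * f x" and "\<And>s. conv s 0 \<Longrightarrow> (\<lambda>n. f (s n)) \<longlonglongrightarrow> 0"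
  shows "f \<in> circ"
proof -
  have "(\<lambda>n. f (s n)) \<longlonglongrightarrow> f x" if "conv s x" for s x
    using assms(2)[of "\<lambda>n. s n - x"] that by (simp add: conv_0_iff blinfun.diff_right LIM_zero_cancel)
  then show ?thesis
    using assms(1) by (auto simp: circ_def norm_dual_def)
qed

text \<open>A real functional \<open>u\<close> with \<open>u x = p x > 0\<close> is turned into a linear one over the scalar field by
\<open>y \<mapsto> u y - i u (i y)\<close>. This formula also covers real scalars, where \<open>i = 0\<close>.\<close>

lemma circ_separates:
  assumes "\<And>f. f \<in> circ \<Longrightarrow> blinfun_apply f x = 0"
  shows "x = 0"
proof (rule ccontr)
  assume "x \<noteq> 0"
  then obtain p where p: "p \<in> P" "0 < p x"
    using norm_less_P[of 0 x] by auto
  obtain u where u: "conv_continuous u" and le: "\<And>x. \<bar>u x\<bar> \<le> p x" and ux: "u x = p x"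
    using norming_functional[OF p(1)] by blast
  have lin: "linear u"
    using u by (simp add: conv_continuous_def)
  obtain i :: 'k where i: "i = 0 \<or> i * i = - 1" and rep: "\<And>z. \<exists>a b. z = a *\<^sub>R 1 + b *\<^sub>R i"
    using real_or_complex by blast
  define f where "f y = of_real (u y) - i * of_real (u (sc i y))" for y
  have bl: "bounded_linear f"
  proof
    show "f (x + y) = f x + f y" for x y
      by (simp add: f_def linear_add[OF lin] scale_right_distrib algebra_simps)
    show "f (r *\<^sub>R y) = r *\<^sub>R f y" for r y
    proof -
      have "sc i (r *\<^sub>R y) = r *\<^sub>R sc i y"
        by (simp add: sc_of_real[symmetric] mult.commute)
      then show ?thesis
        by (simp add: f_def linear_scale[OF lin] scaleR_conv_of_real algebra_simps)
    qed
    show "\<exists>K. \<forall>y. norm (f y) \<le> norm y * K"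
    proof (intro exI allI)
      fix y
      have "norm (f y) \<le> \<bar>u y\<bar> + norm i * \<bar>u (sc i y)\<bar>"
        unfolding f_def using norm_triangle_ineq4[of "of_real (u y)" "i * of_real (u (sc i y))"]
        by (simp add: norm_mult)
      also have "\<dots> \<le> norm y + norm i * (norm i * norm y)"
        using le[of y] P_le_norm[OF p(1), of y] le[of "sc i y"] P_le_norm[OF p(1), of "sc i y"]
        by (intro add_mono mult_left_mono) (auto simp: norm_sc)
      also have "\<dots> = norm y * (1 + norm i * norm i)"
        by (simp add: algebra_simps)
      finally show "norm (f y) \<le> norm y * (1 + norm i * norm i)" .
    qed
  qed
  have f_sc: "f (sc c y) = c * f y" for c y
  proof -
    obtain a b where c: "c = a *\<^sub>R 1 + b *\<^sub>R i"
      using rep by blast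
    have 1: "sc c y = a *\<^sub>R y + b *\<^sub>R sc i y" for y
      by (simp add: c scale_left_distrib sc_of_real[symmetric] scaleR_conv_of_real)
    have 2: "sc i (sc c y) = a *\<^sub>R sc i y + b *\<^sub>R sc (i * i) y"
      using 1[of "sc i y"] by (simp add: mult.commute)
    have 3: "u (sc c y) = a * u y + b * u (sc i y)"
      by (simp add: 1 linear_add[OF lin] linear_scale[OF lin])
    from i show ?thesis
    proof
      assume "i = 0"
      then show ?thesis
        using 3 by (simp add: f_def c scaleR_conv_of_real linear_0[OF lin])
    next
      assume ii: "i * i = - 1"
      have 4: "u (sc i (sc c y)) = a * u (sc i y) - b * u y"
        unfolding 2 ii by (simp add: linear_add[OF lin] linear_diff[OF lin] linear_scale[OF lin])
      have ii': "i * (i * z) = - z" for z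
        by (simp add: ii flip: mult.assoc)
      show ?thesis
        unfolding f_def 3 4 by (simp add: c scaleR_conv_of_real algebra_simps ii')
    qed
  qed
  have "(\<lambda>n. f (s n)) \<longlonglongrightarrow> 0" if s: "conv s 0" for s
  proof -
    have "(\<lambda>n. of_real (u (s n)) - i * of_real (u (sc i (s n)))) \<longlonglongrightarrow> of_real (u 0) - i * of_real (u 0)"
      using u s conv_sc[OF s, of i] unfolding conv_continuous_def
      by (intro tendsto_intros tendsto_of_real) auto
    then show ?thesis
      by (simp add: f_def linear_0[OF lin])
  qed
  then have "Blinfun f \<in> circ"
    using bl f_sc by (intro circI) (auto simp: bounded_linear_Blinfun_apply)
  then have "f x = 0"
    using assms[of "Blinfun f"] bl by (simp add: bounded_linear_Blinfun_apply)
  then have eq: "of_real (u x) = i * of_real (u (sc i x))"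
    by (simp add: f_def)
  from i have "u x = 0"
  proof
    assume "i = 0"
    with eq show ?thesis by simp
  next
    assume ii: "i * i = - 1"
    have "of_real (u x * u x) = (i * of_real (u (sc i x))) * (i * of_real (u (sc i x)))"
      by (simp add: eq)
    also have "\<dots> = (i * i) * of_real (u (sc i x) * u (sc i x))"
      by (simp add: algebra_simps)
    also have "\<dots> = of_real (- (u (sc i x) * u (sc i x)))"
      by (simp add: ii)
    finally have "u x * u x = - (u (sc i x) * u (sc i x))"
      by (simp only: of_real_eq_iff)
    then have "u x * u x + u (sc i x) * u (sc i x) = 0"
      by simp
    then show ?thesis
      by (simp only: sum_squares_eq_zero_iff)
  qed
  with ux p(2) show False by simp
qed

lemma eq_by_circ:
  assumes "\<And>f. f \<in> circ \<Longrightarrow> blinfun_apply f x = blinfun_apply f y"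
  shows "x = y"
proof -
  have "blinfun_apply f (x - y) = 0" if "f \<in> circ" for f
    using assms[OF that] by (simp add: blinfun.diff_right)
  then show ?thesis
    using circ_separates[of "x - y"] by simp
qed

end

subsection \<open>Topologies generated by seminorms\<close>

lemma openin_seminorm_ball:
  assumes "q \<in> Q" "e > 0"
  shows "openin (seminorm_topology Q) {y. q (y - x) < e}"
proof -
  have "{y. q (y - x) < e} \<in> {{y. q (y - x) < e} |q x e. q \<in> Q \<and> e > 0}"
    unfolding mem_Collect_eq
    by (rule exI[of _ q], rule exI[of _ x], rule exI[of _ e], rule conjI[OF refl], rule conjI[OF assms])
  then show ?thesis
    unfolding seminorm_topology_def by (rule topology_generated_by_Basis)
qed

lemma continuous_map_seminorm_topology:
  assumes "\<And>q x e. q \<in> Q \<Longrightarrow> e > 0 \<Longrightarrow> openin S {z \<in> topspace S. q (h z - x) < e}"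
    and "topspace (seminorm_topology Q) = UNIV"
  shows "continuous_map S (seminorm_topology Q) h"
proof -
  have "openin S (h -` U \<inter> topspace S)" if "U \<in> {{y. q (y - x) < e} |q x e. q \<in> Q \<and> e > 0}" for U
  proof -
    from that obtain q x e where "q \<in> Q" "e > 0" and U: "U = {y. q (y - x) < e}" by blast
    moreover have "h -` U \<inter> topspace S = {z \<in> topspace S. q (h z - x) < e}"
      by (auto simp: U)
    ultimately show ?thesis
      using assms(1) by simp
  qed
  then show ?thesis
    using assms(2) unfolding seminorm_topology_def
    by (intro continuous_on_generated_topo) auto
qed

context banach_space_over
begin

lemma topspace_seminorm_topology:
  assumes "Q \<noteq> {}" "\<And>q. q \<in> Q \<Longrightarrow> seminorm sc q"
  shows "topspace (seminorm_topology Q) = UNIV"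
proof -
  obtain q where q: "q \<in> Q" using assms(1) by blast
  have "x \<in> topspace (seminorm_topology Q)" for x
    using openin_subset[OF openin_seminorm_ball[of q Q 1 x]] q seminorm_props(5)[OF assms(2)[OF q]]
    by auto
  then show ?thesis by auto
qed

lemma linear_seminorm_topology:
  assumes Q: "Q \<noteq> {}" "\<And>q. q \<in> Q \<Longrightarrow> seminorm sc q"
  shows "linear_topology sc (seminorm_topology Q)"
  unfolding linear_topology_def
proof (intro conjI)
  show top: "topspace (seminorm_topology Q) = UNIV"
    by (rule topspace_seminorm_topology[OF Q])
  let ?T = "seminorm_topology Q"
  show "continuous_map (prod_topology ?T ?T) ?T (\<lambda>(x, y). x + y)"
  proof (rule continuous_map_seminorm_topology[OF _ top])
    fix q a and e :: real assume q: "q \<in> Q" and e: "e > 0"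
    note qp = seminorm_props[OF Q(2)[OF q]]
    show "openin (prod_topology ?T ?T) {z \<in> topspace (prod_topology ?T ?T). q ((case z of (x, y) \<Rightarrow> x + y) - a) < e}"
      unfolding openin_prod_topology_alt
    proof (intro allI impI)
      fix x y assume xy: "(x, y) \<in> {z \<in> topspace (prod_topology ?T ?T). q ((case z of (x, y) \<Rightarrow> x + y) - a) < e}"
      define d where "d = (e - q (x + y - a)) / 2"
      have d: "d > 0" using xy by (simp add: d_def)
      have "q (x' + y' - a) < e" if "q (x' - x) < d" "q (y' - y) < d" for x' y'
        using that qp(2)[of "x' - x" "y' - y"] qp(2)[of "x' - x + (y' - y)" "x + y - a"]
        by (simp add: d_def algebra_simps)
      then show "\<exists>U V. openin ?T U \<and> openin ?T V \<and> x \<in> U \<and> y \<in> V \<and>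
          U \<times> V \<subseteq> {z \<in> topspace (prod_topology ?T ?T). q ((case z of (x, y) \<Rightarrow> x + y) - a) < e}"
        using d by (intro exI[of _ "{x'. q (x' - x) < d}"] exI[of _ "{y'. q (y' - y) < d}"])
          (auto simp: openin_seminorm_ball[OF q d] qp(5) top)
    qed
  qed
  show "continuous_map (prod_topology euclidean ?T) ?T (\<lambda>(c, x). sc c x)"
  proof (rule continuous_map_seminorm_topology[OF _ top])
    fix q a and e :: real assume q: "q \<in> Q" and e: "e > 0"
    note qp = seminorm_props[OF Q(2)[OF q]]
    show "openin (prod_topology euclidean ?T) {z \<in> topspace (prod_topology euclidean ?T). q ((case z of (c, x) \<Rightarrow> sc c x) - a) < e}"
      unfolding openin_prod_topology_alt
    proof (intro allI impI)
      fix c x assume cx: "(c, x) \<in> {z \<in> topspace (prod_topology euclidean ?T). q ((case z of (c, x) \<Rightarrow> sc c x) - a) < e}"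
      define d where "d = (e - q (sc c x - a)) / 2"
      have d: "d > 0" using cx by (simp add: d_def)
      define r where "r = min 1 (d / (q x + 1))"
      define r' where "r' = d / (norm c + 1)"
      have qx: "q x \<ge> 0" by (rule qp(1))
      have nc: "norm c + 1 \<noteq> 0"
        using norm_ge_zero[of c] by linarith
      have r: "r > 0" "r' > 0" and r1: "r \<le> 1" and r2: "r \<le> d / (q x + 1)"
        using d qx by (auto simp: r_def r'_def add_nonneg_pos)
      have "q (sc c' x' - a) < e" if c': "norm (c' - c) < r" and x': "q (x' - x) < r'" for c' x'
      proof -
        have "norm c' \<le> norm c + 1"
          using norm_triangle_ineq2[of c' c] c' r1 by simp
        then have "norm c' * q (x' - x) \<le> (norm c + 1) * q (x' - x)"
          by (rule mult_right_mono) (rule qp(1))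
        also have "\<dots> < (norm c + 1) * r'"
          by (rule mult_strict_left_mono[OF x']) (simp add: add_nonneg_pos)
        also have "\<dots> = d"
          by (simp add: r'_def nc)
        finally have 1: "norm c' * q (x' - x) < d" .
        have "norm (c' - c) * q x \<le> r * (q x + 1)"
          using c' qx r(1) by (intro mult_mono) auto
        also have "\<dots> \<le> d"
          using r2 qx by (simp add: pos_le_divide_eq)
        finally have 2: "norm (c' - c) * q x \<le> d" .
        have eq: "sc c' x' - a = (sc c' (x' - x) + sc (c' - c) x) + (sc c x - a)"
          by (simp add: scale_right_diff_distrib scale_left_diff_distrib)
        have "q (sc c' (x' - x) + sc (c' - c) x) \<le> norm c' * q (x' - x) + norm (c' - c) * q x"
          using qp(2)[of "sc c' (x' - x)" "sc (c' - c) x"] unfolding qp(3) .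
        then have "q (sc c' x' - a) \<le> norm c' * q (x' - x) + norm (c' - c) * q x + q (sc c x - a)"
          unfolding eq using qp(2)[of "sc c' (x' - x) + sc (c' - c) x" "sc c x - a"] by linarith
        with 1 2 show ?thesis by (simp add: d_def)
      qed
      then have "ball c r \<times> {x'. q (x' - x) < r'} \<subseteq>
          {z \<in> topspace (prod_topology euclidean ?T). q ((case z of (c, x) \<Rightarrow> sc c x) - a) < e}"
        by (simp add: subset_iff top mem_ball dist_norm norm_minus_commute[of c])
      moreover have "openin euclidean (ball c r)" "c \<in> ball c r" "x \<in> {x'. q (x' - x) < r'}"
        using r by (simp_all add: qp(5))
      ultimately show "\<exists>U V. openin euclidean U \<and> openin ?T V \<and> c \<in> U \<and> x \<in> V \<and>
          U \<times> V \<subseteq> {z \<in> topspace (prod_topology euclidean ?T). q ((case z of (c, x) \<Rightarrow> sc c x) - a) < e}"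
        using openin_seminorm_ball[OF q r(2)] by blast
    qed
  qed
qed

lemma limitin_seminorm_topologyD:
  assumes "topspace (seminorm_topology Q) = UNIV" and "\<And>q. q \<in> Q \<Longrightarrow> seminorm sc q"
    and lim: "limitin (seminorm_topology Q) s x F" and q: "q \<in> Q"
  shows "((\<lambda>n. q (s n - x)) \<longlongrightarrow> 0) F"
proof -
  note qp = seminorm_props[OF assms(2)[OF q]]
  show "((\<lambda>n. q (s n - x)) \<longlongrightarrow> 0) F"
  proof (rule tendstoI)
    fix e :: real assume "e > 0"
    then have "openin (seminorm_topology Q) {y. q (y - x) < e}" "x \<in> {y. q (y - x) < e}"
      using q by (auto simp: qp(5) intro: openin_seminorm_ball)
    with lim have "\<forall>\<^sub>F n in F. s n \<in> {y. q (y - x) < e}"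
      unfolding limitin_def by blast
    then show "\<forall>\<^sub>F n in F. dist (q (s n - x)) 0 < e"
    proof eventually_elim
      case (elim n)
      then show ?case
        using qp(1)[of "s n - x"] by simp
    qed
  qed
qed

lemma limitin_seminorm_topologyI:
  assumes "topspace (seminorm_topology Q) = UNIV" and "\<And>q. q \<in> Q \<Longrightarrow> seminorm sc q"
    and lim: "\<And>q. q \<in> Q \<Longrightarrow> ((\<lambda>n. q (s n - x)) \<longlongrightarrow> 0) F"
  shows "limitin (seminorm_topology Q) s x F"
proof -
  have "\<forall>\<^sub>F n in F. s n \<in> U" if "openin (seminorm_topology Q) U" "x \<in> U" for U
  proof -
    have "generate_topology_on {{y. q (y - x) < e} |q x e. q \<in> Q \<and> e > 0} U"
      by (rule openin_topology_generated_by) (use that(1) in \<open>simp only: seminorm_topology_def\<close>)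
    then show ?thesis
      using that(2)
    proof induction
      case Empty
      then show ?case by simp
    next
      case (Int a b)
      from Int.prems have "x \<in> a" "x \<in> b" by auto
      from Int.IH(1)[OF this(1)] Int.IH(2)[OF this(2)] show ?case
        by eventually_elim (rule IntI)
    next
      case (UN K)
      from UN.prems obtain k where k: "k \<in> K" "x \<in> k" by blast
      from UN.IH[OF k] show ?case
        by eventually_elim (use k in blast)
    next
      case (Basis b)
      from Basis.hyps obtain q a e where q: "q \<in> Q" and b: "b = {y. q (y - a) < e}"
        unfolding mem_Collect_eq by (elim exE conjE)
      note qp = seminorm_props[OF assms(2)[OF q]]
      have "((\<lambda>n. q (s n - x)) \<longlongrightarrow> 0) F" and "e - q (x - a) > 0"
        using lim q Basis.prems b by auto
      then have "\<forall>\<^sub>F n in F. q (s n - x) < e - q (x - a)"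
        by (rule order_tendstoD)
      then show ?case
      proof eventually_elim
        case (elim n)
        then show ?case
          using qp(2)[of "s n - x" "x - a"] by (simp add: b)
      qed
    qed
  qed
  then show "limitin (seminorm_topology Q) s x F"
    by (simp add: limitin_def assms(1))
qed

end

subsection \<open>Convergent sequences of the mixed topology\<close>

lemma continuous_map_id_imp_coarser:
  assumes "continuous_map S T (\<lambda>x. x)" "topspace S = UNIV"
  shows "coarser T S"
  using assms by (auto simp: coarser_def continuous_map_alt)

context seminormed_space
begin

abbreviation \<tau> :: "'a topology" where "\<tau> \<equiv> seminorm_topology P"

abbreviation \<gamma> :: "'a topology" where "\<gamma> \<equiv> mixed_topology sc \<tau>"

lemma topspace_\<tau>: "topspace \<tau> = UNIV"
  by (rule topspace_seminorm_topology[OF P_nonempty P_seminorm])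

lemma seminorm_topology_coarser_euclidean:
  assumes "Q \<noteq> {}" and sem: "\<And>q. q \<in> Q \<Longrightarrow> seminorm sc q" and le: "\<And>q x. q \<in> Q \<Longrightarrow> q x \<le> norm x"
  shows "coarser (seminorm_topology Q) euclidean"
proof (rule continuous_map_id_imp_coarser, rule continuous_map_seminorm_topology)
  show "topspace (seminorm_topology Q) = UNIV"
    by (rule topspace_seminorm_topology[OF assms(1,2)])
  fix q x and e :: real assume q: "q \<in> Q"
  note qp = seminorm_props[OF sem[OF q]]
  have "open {z. q (z - x) < e}"
    unfolding open_dist
  proof (intro ballI exI conjI allI impI)
    fix z y assume "z \<in> {z. q (z - x) < e}"
    then show "e - q (z - x) > 0" by simp
    assume "dist y z < e - q (z - x)"
    then have "q (y - z) < e - q (z - x)"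
      using le[OF q, of "y - z"] by (simp add: dist_norm)
    then show "y \<in> {z. q (z - x) < e}"
      using qp(2)[of "y - z" "z - x"] by simp
  qed
  then show "openin euclidean {z \<in> topspace euclidean. q (z - x) < e}"
    by simp
qed simp

lemma coarser_\<tau>_euclidean: "coarser \<tau> euclidean"
  by (rule seminorm_topology_coarser_euclidean) (simp_all add: P_nonempty P_seminorm P_le_norm)

lemma linear_\<tau>: "linear_topology sc \<tau>"
  by (rule linear_seminorm_topology[OF P_nonempty P_seminorm])

lemmas mixed = mixed_topology[OF linear_\<tau> coarser_\<tau>_euclidean]

lemma mixed_\<gamma>: "topspace \<gamma> = UNIV" "coarser \<tau> \<gamma>" "bounded B \<Longrightarrow> subtopology \<gamma> B = subtopology \<tau> B"
  using mixed(1) by (auto simp: mixed_candidate_def linear_topology_def)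

text \<open>Adding to \<open>\<tau>\<close> a norm-dominated seminorm that is \<open>\<tau>\<close>-continuous on bounded sets produces a topology which
competes in the definition of \<open>\<gamma>\<close>. Hence every such seminorm is \<open>\<gamma>\<close>-continuous.\<close>

lemma mixed_candidate_insert_seminorm:
  assumes q: "seminorm sc q" and le: "\<And>x. q x \<le> norm x"
    and cont: "\<And>B x e. bounded B \<Longrightarrow> x \<in> B \<Longrightarrow> e > 0 \<Longrightarrow> \<exists>U. openin \<tau> U \<and> x \<in> U \<and> (\<forall>z\<in>U \<inter> B. q (z - x) < e)"
  shows "mixed_candidate sc \<tau> (seminorm_topology (insert q P))"
proof -
  let ?Q = "insert q P" let ?G = "seminorm_topology ?Q"
  have sem: "\<And>r. r \<in> ?Q \<Longrightarrow> seminorm sc r" and ne: "?Q \<noteq> {}"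
    using q P_seminorm by auto
  have top: "topspace ?G = UNIV"
    by (rule topspace_seminorm_topology[OF ne sem])
  have "coarser \<tau> ?G"
  proof (rule continuous_map_id_imp_coarser[OF continuous_map_seminorm_topology top])
    show "openin ?G {z \<in> topspace ?G. p (z - x) < e}" if "p \<in> P" "e > 0" for p x e
      using openin_seminorm_ball[of p ?Q e x] that by (simp add: top)
  qed (rule topspace_\<tau>)
  moreover have "coarser ?G euclidean"
    by (rule seminorm_topology_coarser_euclidean[OF ne sem]) (use le P_le_norm in auto)
  moreover have "subtopology ?G B = subtopology \<tau> B" if B: "bounded B" for B
  proof (rule coarser_antisym)
    show "coarser (subtopology \<tau> B) (subtopology ?G B)"
      using \<open>coarser \<tau> ?G\<close> unfolding coarser_def openin_subtopology by blast
    have "continuous_map (subtopology \<tau> B) ?G (\<lambda>x. x)"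
    proof (rule continuous_map_seminorm_topology[OF _ top])
      fix r x and e :: real assume r: "r \<in> ?Q" and e: "e > 0"
      have topB: "topspace (subtopology \<tau> B) = B"
        by (simp add: topspace_\<tau>)
      show "openin (subtopology \<tau> B) {z \<in> topspace (subtopology \<tau> B). r (z - x) < e}"
      proof (cases "r \<in> P")
        case True
        have "{z \<in> B. r (z - x) < e} = {z. r (z - x) < e} \<inter> B"
          by blast
        then show ?thesis
          unfolding topB openin_subtopology using openin_seminorm_ball[OF True e, of x] by blast
      next
        case False
        with r have rq: "r = q" by simp
        show ?thesis
          unfolding topB rq
        proof (subst openin_subopen, intro ballI)
          fix z assume z: "z \<in> {z \<in> B. q (z - x) < e}"
          then obtain U where U: "openin \<tau> U" "z \<in> U" "\<forall>y\<in>U \<inter> B. q (y - z) < e - q (z - x)"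
            using cont[OF B, of z "e - q (z - x)"] by auto
          have "q (y - x) < e" if "y \<in> U \<inter> B" for y
            using bspec[OF U(3) that] seminorm_props(2)[OF q, of "y - z" "z - x"] by simp
          then have "U \<inter> B \<subseteq> {z \<in> B. q (z - x) < e}"
            by blast
          moreover have "openin (subtopology \<tau> B) (U \<inter> B)"
            using U(1) by (rule openin_subtopology_Int)
          ultimately show "\<exists>T. openin (subtopology \<tau> B) T \<and> z \<in> T \<and> T \<subseteq> {z \<in> B. q (z - x) < e}"
            using z U(2) by blast
        qed
      qed
    qed
    then have "openin (subtopology \<tau> B) (U \<inter> B)" if "openin ?G U" for U
      using that by (auto simp: continuous_map_alt topspace_\<tau>)
    then show "coarser (subtopology ?G B) (subtopology \<tau> B)"
      unfolding coarser_def openin_subtopology by blast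
  qed
  ultimately show ?thesis
    using linear_seminorm_topology[OF ne sem] by (simp add: mixed_candidate_def)
qed

text \<open>On a bounded set the tail of the weighted supremum is uniformly small, so that only finitely many
seminorms matter and the supremum is \<open>\<tau>\<close>-continuous there.\<close>

lemma weighted_sup_seminorm:
  fixes pk :: "nat \<Rightarrow> 'a \<Rightarrow> real"
  assumes pk: "\<And>k. pk k \<in> P"
  defines "q \<equiv> \<lambda>x. SUP k. (1/2)^k * pk k x"
  shows "mixed_candidate sc \<tau> (seminorm_topology (insert q P))" and "(1/2)^k * pk k x \<le> q x"
proof -
  note pp = P_props[OF pk]
  have term_le: "(1/2)^k * pk k x \<le> norm x" for k x
  proof -
    have "(1/2)^k * pk k x \<le> 1 * pk k x"
      by (rule mult_right_mono[OF power_le_one pp(1)]) auto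
    with P_le_norm[OF pk, of k x] show ?thesis by linarith
  qed
  have upper: "(1/2)^k * pk k x \<le> q x" for k x
    unfolding q_def by (rule cSUP_upper) (auto intro!: bdd_aboveI2[OF term_le])
  then show "(1/2)^k * pk k x \<le> q x" .
  have least: "q x \<le> C" if "\<And>k. (1/2)^k * pk k x \<le> C" for x C
    unfolding q_def by (rule cSUP_least) (use that in auto)
  have q0: "0 \<le> q x" for x
    using upper[of 0 x] pp(1)[of 0 x] by simp
  have hom_le: "q (sc c x) \<le> norm c * q x" for c x
  proof (rule least)
    fix k
    have "norm c * ((1/2)^k * pk k x) \<le> norm c * q x"
      by (rule mult_left_mono[OF upper]) simp
    then show "(1/2)^k * pk k (sc c x) \<le> norm c * q x"
      by (simp only: pp(3) mult.left_commute)
  qed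
  have q: "seminorm sc q"
    unfolding seminorm_def
  proof (intro conjI allI)
    show "0 \<le> q x" for x by (rule q0)
    show "q (x + y) \<le> q x + q y" for x y
    proof (rule least)
      fix k
      have "(1/2)^k * pk k (x + y) \<le> (1/2)^k * (pk k x + pk k y)"
        by (rule mult_left_mono[OF pp(2)]) simp
      also have "\<dots> \<le> q x + q y"
        unfolding distrib_left by (intro add_mono upper)
      finally show "(1/2)^k * pk k (x + y) \<le> q x + q y" .
    qed
    show "q (sc c x) = norm c * q x" for c x
    proof (cases "c = 0")
      case True
      then show ?thesis
        using hom_le[of 0 x] q0[of 0] by simp
    next
      case False
      have "q x \<le> norm (inverse c) * q (sc c x)"
        using hom_le[of "inverse c" "sc c x"] False by simp
      then have "norm c * q x \<le> norm c * (norm (inverse c) * q (sc c x))"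
        by (rule mult_left_mono) simp
      also have "\<dots> = q (sc c x)"
        using False by (simp add: norm_inverse)
      finally have "norm c * q x \<le> q (sc c x)" .
      with hom_le[of c x] show ?thesis by simp
    qed
  qed
  show "mixed_candidate sc \<tau> (seminorm_topology (insert q P))"
  proof (rule mixed_candidate_insert_seminorm[OF q])
    show "q x \<le> norm x" for x
      by (rule least[OF term_le])
    fix B :: "'a set" and x and e :: real
    assume B: "bounded B" and x: "x \<in> B" and e: "e > 0"
    obtain C where C: "\<And>z. z \<in> B \<Longrightarrow> norm z \<le> C" "C > 0"
      using B unfolding bounded_pos by blast
    obtain K where K: "(1/2::real)^K < e / 2 / (2 * C)"
      using real_arch_pow_inv[of "e / 2 / (2 * C)" "1/2"] e C(2) by auto
    define U where "U = (\<Inter>k\<in>{..<K}. {z. pk k (z - x) < e / 2}) \<inter> topspace \<tau>"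
    have "openin \<tau> U"
      unfolding U_def
    proof (rule openin_INT)
      show "openin \<tau> {z. pk k (z - x) < e / 2}" for k
        by (rule openin_seminorm_ball[OF pk]) (use e in simp)
    qed simp
    moreover have "x \<in> U"
      using e by (simp add: U_def topspace_\<tau> pp(5))
    moreover have "q (z - x) < e" if z: "z \<in> U \<inter> B" for z
    proof -
      have "q (z - x) \<le> e / 2"
      proof (rule least)
        fix k
        show "(1/2)^k * pk k (z - x) \<le> e / 2"
        proof (cases "k < K")
          case True
          have "pk k (z - x) < e / 2"
            using z True unfolding U_def by blast
          moreover have "(1/2)^k * pk k (z - x) \<le> 1 * pk k (z - x)"
            by (rule mult_right_mono[OF power_le_one pp(1)]) auto
          ultimately show ?thesis by linarith
        next
          case False
          have "pk k (z - x) \<le> norm (z - x)"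
            by (rule P_le_norm[OF pk])
          also have "\<dots> \<le> 2 * C"
            using norm_triangle_ineq4[of z x] C(1)[of z] C(1)[OF x] IntD2[OF z] by linarith
          finally have "(1/2)^k * pk k (z - x) \<le> (1/2)^K * (2 * C)"
            using False C(2) by (intro mult_mono power_decreasing pp(1)) auto
          also have "\<dots> \<le> e / 2"
            using K C(2) by (simp add: field_simps)
          finally show ?thesis .
        qed
      qed
      with e show ?thesis by simp
    qed
    ultimately show "\<exists>U. openin \<tau> U \<and> x \<in> U \<and> (\<forall>z\<in>U \<inter> B. q (z - x) < e)"
      by blast
  qed
qed

text \<open>If the sequence were unbounded, there would be \<open>p\<^sub>k\<close> in \<open>P\<close> and indices \<open>n k \<ge> k\<close> with
\<open>p\<^sub>k (s (n k) - x) > 2\<^sup>k\<close>; the \<open>\<gamma>\<close>-continuous seminorm \<open>sup\<^sub>k 2\<^sup>-\<^sup>k p\<^sub>k\<close> would then exceed \<open>1\<close> at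
arbitrarily late members of \<open>s n - x\<close>, which is impossible as these tend to \<open>0\<close>.\<close>

lemma limitin_mixed_imp_bounded:
  assumes lim: "limitin \<gamma> s x sequentially"
  shows "bounded (range s)"
proof (rule ccontr)
  assume unb: "\<not> bounded (range s)"
  have "\<exists>n\<ge>k. norm (s n - x) > 2^k" for k :: nat
  proof (rule ccontr)
    assume "\<not> ?thesis"
    then have "norm (s n) \<le> 2^k + norm x" if "n \<ge> k" for n
      using that norm_triangle_ineq2[of "s n" x] by (metis add_le_cancel_right diff_le_eq not_le order_trans)
    then have "bounded (s ` {k..})"
      by (auto simp: bounded_iff)
    moreover have "range s = s ` {..<k} \<union> s ` {k..}"
      by force
    moreover have "bounded (s ` {..<k})"
      by (simp add: finite_imp_bounded)
    ultimately show False
      using unb by (simp add: bounded_Un)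
  qed
  then obtain n where n: "\<And>k. n k \<ge> k" "\<And>k. norm (s (n k) - x) > 2^k"
    by metis
  have "\<forall>k. \<exists>p. p \<in> P \<and> p (s (n k) - x) > 2^k"
    using norm_less_P[OF n(2)] by blast
  then obtain pk where pk: "\<And>k. pk k \<in> P" "\<And>k. pk k (s (n k) - x) > 2^k"
    by metis
  define q where "q x = (SUP k. (1/2)^k * pk k x)" for x
  have cand: "mixed_candidate sc \<tau> (seminorm_topology (insert q P))" and upper: "\<And>k x. (1/2)^k * pk k x \<le> q x"
    using weighted_sup_seminorm[of pk, OF pk(1)] unfolding q_def by blast+
  have "q 0 \<le> 0"
    unfolding q_def by (rule cSUP_least) (auto simp: P_props(5)[OF pk(1)])
  then have "x \<in> {y. q (y - x) < 1}"
    by simp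
  moreover have "openin \<gamma> {y. q (y - x) < 1}"
    using mixed(2)[OF cand] openin_seminorm_ball[of q "insert q P" 1 x] by (simp add: coarser_def)
  ultimately have "\<forall>\<^sub>F m in sequentially. s m \<in> {y. q (y - x) < 1}"
    using lim unfolding limitin_def by blast
  then obtain N where N: "\<And>m. m \<ge> N \<Longrightarrow> q (s m - x) < 1"
    unfolding eventually_sequentially by auto
  have "1 = (1/2)^N * (2::real)^N"
    by (simp flip: power_mult_distrib)
  also have "\<dots> \<le> (1/2)^N * pk N (s (n N) - x)"
    using pk(2)[of N] by (intro mult_left_mono) auto
  also have "\<dots> \<le> q (s (n N) - x)"
    by (rule upper)
  also have "\<dots> < 1"
    by (rule N[OF n(1)])
  finally show False by simp
qed

lemma limitin_mixed_iff_conv: "limitin \<gamma> s x sequentially \<longleftrightarrow> conv s x"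
proof
  assume lim: "limitin \<gamma> s x sequentially"
  have "limitin \<tau> s x sequentially"
    using lim mixed_\<gamma>(1,2) by (auto simp: limitin_def topspace_\<tau> coarser_def)
  then show "conv s x"
    unfolding conv_def
    using limitin_mixed_imp_bounded[OF lim] limitin_seminorm_topologyD[OF topspace_\<tau> P_seminorm] by blast
next
  assume s: "conv s x"
  define B where "B = insert x (range s)"
  have B: "bounded B" "x \<in> B" "\<And>n. s n \<in> B"
    using s by (auto simp: conv_def B_def)
  have "limitin \<tau> s x sequentially"
    by (rule limitin_seminorm_topologyI[OF topspace_\<tau> P_seminorm]) (use convD[OF s] in auto)
  then have "limitin (subtopology \<gamma> B) s x sequentially"
    using B by (simp add: mixed_\<gamma>(3)[OF B(1)] limitin_subtopology)
  then show "limitin \<gamma> s x sequentially"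
    using B by (simp add: limitin_subtopology)
qed

text \<open>If the Cauchy condition failed for some neighbourhood, differences \<open>s (m N) - s (n N)\<close> outside it would form a
bounded \<open>\<tau>\<close>-null sequence, which is \<open>\<gamma>\<close>-null.\<close>

lemma mixed_Cauchy:
  assumes bdd: "bounded (range s)"
    and Cauchy: "\<And>p e. p \<in> P \<Longrightarrow> e > 0 \<Longrightarrow> \<exists>N. \<forall>m\<ge>N. \<forall>n\<ge>N. p (s m - s n) < e"
  shows "top_Cauchy \<gamma> s"
  unfolding top_Cauchy_def
proof (intro allI impI, rule ccontr)
  fix U assume U: "openin \<gamma> U \<and> 0 \<in> U" and neg: "\<not> (\<exists>N. \<forall>m\<ge>N. \<forall>n\<ge>N. s m - s n \<in> U)"
  then obtain m n where mn: "\<And>N. m N \<ge> N" "\<And>N. n N \<ge> N" "\<And>N. s (m N) - s (n N) \<notin> U"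
    by metis
  obtain C where C: "\<And>n. norm (s n) \<le> C"
    using bdd by (auto simp: bounded_iff)
  have "conv (\<lambda>N. s (m N) - s (n N)) 0"
  proof (rule convI)
    show "norm (s (m N) - s (n N)) \<le> C + C" for N
      by (rule order_trans[OF norm_triangle_ineq4 add_mono[OF C C]])
    fix p assume p: "p \<in> P"
    show "(\<lambda>N. p (s (m N) - s (n N) - 0)) \<longlonglongrightarrow> 0"
    proof (rule LIMSEQ_I)
      fix e :: real assume "e > 0"
      then obtain N where N: "\<And>m n. m \<ge> N \<Longrightarrow> n \<ge> N \<Longrightarrow> p (s m - s n) < e"
        using Cauchy[OF p] by blast
      have "norm (p (s (m k) - s (n k) - 0) - 0) < e" if "k \<ge> N" for k
        using N[of "m k" "n k"] mn(1,2)[of k] that P_props(1)[OF p, of "s (m k) - s (n k)"] by simp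
      then show "\<exists>N. \<forall>k\<ge>N. norm (p (s (m k) - s (n k) - 0) - 0) < e"
        by blast
    qed
  qed
  then have "limitin \<gamma> (\<lambda>N. s (m N) - s (n N)) 0 sequentially"
    by (simp only: limitin_mixed_iff_conv)
  with U have "\<forall>\<^sub>F N in sequentially. s (m N) - s (n N) \<in> U"
    unfolding limitin_def by blast
  with mn(3) show False
    by (simp add: eventually_sequentially)
qed

lemma limitin_mixed_at_right:
  "limitin \<gamma> g y (at_right (0::real)) \<longleftrightarrow>
     (\<forall>t. (\<forall>n. t n > 0) \<and> t \<longlonglongrightarrow> 0 \<longrightarrow> conv (\<lambda>n. g (t n)) y)"
proof
  assume lim: "limitin \<gamma> g y (at_right 0)"
  show "\<forall>t. (\<forall>n. t n > 0) \<and> t \<longlonglongrightarrow> 0 \<longrightarrow> conv (\<lambda>n. g (t n)) y"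
  proof (intro allI impI)
    fix t :: "nat \<Rightarrow> real" assume t: "(\<forall>n. t n > 0) \<and> t \<longlonglongrightarrow> 0"
    then have "filterlim t (at_right 0) sequentially"
      by (intro tendsto_imp_filterlim_at_right always_eventually) auto
    then have "limitin \<gamma> (\<lambda>n. g (t n)) y sequentially"
      using lim by (auto simp: limitin_def filterlim_iff)
    then show "conv (\<lambda>n. g (t n)) y"
      by (simp only: limitin_mixed_iff_conv)
  qed
next
  assume seq: "\<forall>t. (\<forall>n. t n > 0) \<and> t \<longlonglongrightarrow> 0 \<longrightarrow> conv (\<lambda>n. g (t n)) y"
  show "limitin \<gamma> g y (at_right 0)"
    unfolding limitin_def mixed_\<gamma>(1)
  proof (intro conjI allI impI UNIV_I)
    fix U assume U: "openin \<gamma> U \<and> y \<in> U"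
    show "\<forall>\<^sub>F t in at_right 0. g t \<in> U"
    proof (rule sequentially_imp_eventually_at_right[of 0 1])
      fix t :: "nat \<Rightarrow> real" assume "\<And>n. 0 < t n" "t \<longlonglongrightarrow> 0"
      with seq have "limitin \<gamma> (\<lambda>n. g (t n)) y sequentially"
        by (simp add: limitin_mixed_iff_conv)
      with U show "\<forall>\<^sub>F n in sequentially. g (t n) \<in> U"
        unfolding limitin_def by blast
    qed simp
  qed
qed

lemma circ_dual_eq_circ: "circ_dual sc \<tau> = circ"
proof -
  have lim: "limitin \<tau> s x sequentially \<longleftrightarrow> (\<forall>p\<in>P. (\<lambda>n. p (s n - x)) \<longlonglongrightarrow> 0)" for s x
    using limitin_seminorm_topologyD[OF topspace_\<tau> P_seminorm, of s x sequentially]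
      limitin_seminorm_topologyI[OF topspace_\<tau> P_seminorm, of s x sequentially] by blast
  have "(\<forall>B. bounded B \<longrightarrow> (\<forall>s x. range s \<subseteq> B \<and> x \<in> B \<and> limitin \<tau> s x sequentially \<longrightarrow> (\<lambda>n. f (s n)) \<longlonglongrightarrow> f x))
      \<longleftrightarrow> (\<forall>s x. conv s x \<longrightarrow> (\<lambda>n. f (s n)) \<longlonglongrightarrow> f x)" (is "?L \<longleftrightarrow> ?R") for f :: "'a \<Rightarrow>\<^sub>L 'k"
  proof
    assume L: ?L
    show ?R
    proof (intro allI impI)
      fix s x assume s: "conv s x"
      then have "bounded (insert x (range s))"
        by (simp add: conv_def)
      moreover have "limitin \<tau> s x sequentially"
        using s by (simp add: lim conv_def)
      ultimately show "(\<lambda>n. f (s n)) \<longlonglongrightarrow> f x"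
        using L by (metis insertI1 subset_insertI)
    qed
  next
    assume R: ?R
    show ?L
    proof (intro allI impI)
      fix B :: "'a set" and s x
      assume "bounded B" "range s \<subseteq> B \<and> x \<in> B \<and> limitin \<tau> s x sequentially"
      then have "conv s x"
        using bounded_subset by (auto simp: conv_def lim)
      with R show "(\<lambda>n. f (s n)) \<longlonglongrightarrow> f x" by blast
    qed
  qed
  then show ?thesis
    unfolding circ_dual_def circ_def by (intro Collect_cong conj_cong refl)
qed

end

section \<open>Semigroups\<close>

text \<open>A bi-continuous semigroup on a sequentially complete space, expressed by convergent sequences only. In this
form the axioms are inherited by the rescaled semigroup \<open>e\<^sup>-\<^sup>w\<^sup>t T(t)\<close>.\<close>

locale saks_semigroup = seminormed_space sc P
  for sc :: "'k::real_or_complex \<Rightarrow> 'a::banach \<Rightarrow> 'a" and P +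
  fixes T :: "real \<Rightarrow> 'a \<Rightarrow>\<^sub>L 'a"
  assumes complete: "\<lbrakk>bounded (range s); \<And>p e. p \<in> P \<Longrightarrow> e > 0 \<Longrightarrow> \<exists>N. \<forall>m\<ge>N. \<forall>n\<ge>N. p (s m - s n) < e\<rbrakk>
      \<Longrightarrow> \<exists>l. conv s l"
    and T_sc: "t \<ge> 0 \<Longrightarrow> T t (sc c x) = sc c (T t x)"
    and T_0: "T 0 x = x"
    and T_plus: "t \<ge> 0 \<Longrightarrow> r \<ge> 0 \<Longrightarrow> T (t + r) x = T t (T r x)"
    and T_cont: "(\<And>n. h n \<ge> 0) \<Longrightarrow> h \<longlonglongrightarrow> t \<Longrightarrow> conv (\<lambda>n. T (h n) x) (T t x)"
    and T_equi: "conv s x \<Longrightarrow> (\<And>n. h n \<in> {0..a}) \<Longrightarrow> conv (\<lambda>n. T (h n) (s n - x)) 0"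
begin

text \<open>If \<open>norm (T (t N))\<close> were to exceed \<open>(N + 1)\<^sup>2\<close>, vectors \<open>z N\<close> of norm \<open>1 / (N + 1)\<close> could be chosen with
\<open>norm (T (t N) (z N)) > N + 1\<close>. But \<open>z\<close> is a null sequence, and local equicontinuity makes the images
converge, hence bounded.\<close>

lemma T_bounded_on_compact:
  obtains M where "M \<ge> 1" and "\<And>t. t \<in> {0..a} \<Longrightarrow> norm (T t) \<le> M"
proof -
  \<comment> \<open>The square leaves a factor \<open>Suc N\<close> after the test vectors have been shrunk to norm \<open>1 / Suc N\<close>.\<close>
  have "\<exists>N::nat. \<forall>t\<in>{0..a}. norm (T t) \<le> real (Suc N) * real (Suc N)"
  proof (rule ccontr)
    assume "\<not> ?thesis"
    then have "\<forall>N. \<exists>t. t \<in> {0..a} \<and> \<not> norm (T t) \<le> real (Suc N) * real (Suc N)"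
      by blast
    then obtain t where t: "\<And>N. t N \<in> {0..a}" "\<And>N. \<not> norm (T (t N)) \<le> real (Suc N) * real (Suc N)"
      by metis
    have "\<exists>x. \<not> norm (T (t N) x) \<le> real (Suc N) * real (Suc N) * norm x" for N
      using norm_blinfun_bound[of "real (Suc N) * real (Suc N)" "T (t N)"] t(2)[of N] by auto
    then obtain x where x: "\<And>N. \<not> norm (T (t N) (x N)) \<le> real (Suc N) * real (Suc N) * norm (x N)"
      by metis
    define z where "z N = (1 / (real (Suc N) * norm (x N))) *\<^sub>R x N" for N
    have x0: "x N \<noteq> 0" for N
      using x[of N] by auto
    have nz: "norm (z N) = inverse (real (Suc N))" for N
      using x0[of N] by (simp add: z_def divide_inverse)
    have "z \<longlonglongrightarrow> 0"
      by (rule tendsto_norm_zero_cancel) (simp only: nz LIMSEQ_inverse_real_of_nat)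
    then have "conv (\<lambda>N. T (t N) (z N - 0)) 0"
      by (intro T_equi[OF _ t(1)] tendsto_imp_conv)
    then obtain C where C: "\<And>N. norm (T (t N) (z N - 0)) \<le> C"
      using conv_bound by blast
    obtain N :: nat where N: "C < real N"
      using reals_Archimedean2 by blast
    have "norm (T (t N) (z N - 0)) = norm (T (t N) (x N)) / (real (Suc N) * norm (x N))"
      by (simp add: z_def blinfun.scaleR_right)
    also have "\<dots> > real (Suc N)"
    proof (subst pos_less_divide_eq)
      show "0 < real (Suc N) * norm (x N)"
        using x0[of N] by simp
      show "real (Suc N) * (real (Suc N) * norm (x N)) < norm (T (t N) (x N))"
        using x[of N] by (simp only: not_le mult.assoc)
    qed
    finally show False
      using C[of N] N by simp
  qed
  then obtain N :: nat where "\<forall>t\<in>{0..a}. norm (T t) \<le> real (Suc N) * real (Suc N)"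
    by blast
  then show ?thesis
    by (intro that[of "real (Suc N) * real (Suc N)"]) (auto simp: algebra_simps)
qed

lemma T_conv: "conv s x \<Longrightarrow> t \<ge> 0 \<Longrightarrow> conv (\<lambda>n. T t (s n)) (T t x)"
  using T_equi[of s x "\<lambda>_. t" t] by (simp add: blinfun.diff_right conv_0_iff)

lemma orbit_continuous:
  assumes f: "conv_continuous f"
  shows "continuous_on {0..a} (\<lambda>t. f (T t x))"
  unfolding continuous_on_sequentially
proof (intro allI ballI impI)
  fix t t0 assume "t0 \<in> {0..a}" and t: "(\<forall>n. t n \<in> {0..a}) \<and> t \<longlonglongrightarrow> t0"
  then have "conv (\<lambda>n. T (t n) x) (T t0 x)"
    by (intro T_cont) auto
  with f show "((\<lambda>t. f (T t x)) \<circ> t) \<longlonglongrightarrow> f (T t0 x)"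
    unfolding conv_continuous_def comp_def by blast
qed

text \<open>Compactness of \<open>[0, a]\<close>, used through sequences: two sequences of times that approach each other have
subsequences with the same limit \<open>l\<close>, and both orbits then converge to \<open>T(l) x\<close>.\<close>

lemma orbit_uniformly_continuous:
  assumes p: "p \<in> P" and e: "e > 0"
  obtains d where "d > 0" and
    "\<And>r t. r \<in> {0..a} \<Longrightarrow> t \<in> {0..a} \<Longrightarrow> \<bar>r - t\<bar> < d \<Longrightarrow> p (T r x - T t x) < e"
proof -
  have "\<exists>d>0. \<forall>r\<in>{0..a}. \<forall>t\<in>{0..a}. \<bar>r - t\<bar> < d \<longrightarrow> p (T r x - T t x) < e"
  proof (rule ccontr)
    assume neg: "\<not> ?thesis"
    have "\<exists>r t. r \<in> {0..a} \<and> t \<in> {0..a} \<and> \<bar>r - t\<bar> < inverse (real (Suc n)) \<and> \<not> p (T r x - T t x) < e" for n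
    proof -
      have "inverse (real (Suc n)) > 0" by simp
      with neg show ?thesis by blast
    qed
    then obtain r t where rt: "\<And>n. r n \<in> {0..a}" "\<And>n. t n \<in> {0..a}"
      "\<And>n. \<bar>r n - t n\<bar> < inverse (real (Suc n))" "\<And>n. \<not> p (T (r n) x - T (t n) x) < e"
      by metis
    obtain l g where l: "l \<in> {0..a}" and g: "strict_mono g" "(r \<circ> g) \<longlonglongrightarrow> l"
      using compact_Icc[of 0 a] rt(1) unfolding compact_def by metis
    have "(\<lambda>n. t n - r n) \<longlonglongrightarrow> 0"
    proof (rule Lim_null_comparison[OF _ LIMSEQ_inverse_real_of_nat], rule always_eventually, rule allI)
      show "norm (t n - r n) \<le> inverse (real (Suc n))" for n
        using rt(3)[of n] by simp
    qed
    from LIMSEQ_subseq_LIMSEQ[OF this g(1)] have "(\<lambda>n. ((\<lambda>n. t n - r n) \<circ> g) n + (r \<circ> g) n) \<longlonglongrightarrow> 0 + l"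
      by (intro tendsto_add g(2))
    then have tg: "(\<lambda>n. t (g n)) \<longlonglongrightarrow> l"
      by simp
    have "conv (\<lambda>n. T (r (g n)) x) (T l x)" "conv (\<lambda>n. T (t (g n)) x) (T l x)"
      using rt(1,2) g(2) tg by (auto intro!: T_cont simp: comp_def)
    from convD[OF conv_diff[OF this] p] have "(\<lambda>n. p (T (r (g n)) x - T (t (g n)) x)) \<longlonglongrightarrow> 0"
      by simp
    then have "\<forall>\<^sub>F n in sequentially. p (T (r (g n)) x - T (t (g n)) x) < e"
      using e by (rule order_tendstoD)
    with rt(4) show False
      by (simp add: eventually_sequentially)
  qed
  with that show ?thesis by blast
qed

subsection \<open>Integrals of orbits\<close>

definition Riemann_sum :: "real \<Rightarrow> 'a \<Rightarrow> nat \<Rightarrow> 'a" where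
  "Riemann_sum t x n = (\<Sum>k<Suc n. (t / Suc n) *\<^sub>R T (real k * t / Suc n) x)"

lemma functional_Riemann_sum:
  assumes "linear f"
  shows "f (Riemann_sum t x n) = (\<Sum>k<Suc n. (t / Suc n) *\<^sub>R f (T (real k * t / Suc n) x))"
  unfolding Riemann_sum_def by (simp only: linear_sum[OF assms] linear_scale[OF assms])

lemma norm_Riemann_sum_le:
  assumes M: "\<And>s. s \<in> {0..t} \<Longrightarrow> norm (T s) \<le> M" and t: "t \<ge> 0"
  shows "norm (Riemann_sum t x n) \<le> t * M * norm x"
proof -
  have "norm (Riemann_sum t x n) \<le> (\<Sum>k<Suc n. norm ((t / Suc n) *\<^sub>R T (real k * t / Suc n) x))"
    unfolding Riemann_sum_def by (rule norm_sum)
  also have "\<dots> \<le> (\<Sum>k<Suc n. t / Suc n * (M * norm x))"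
  proof (rule sum_mono)
    fix k assume k: "k \<in> {..<Suc n}"
    have "real k * t \<le> real (Suc n) * t"
      using k t by (intro mult_right_mono) auto
    then have "real k * t / Suc n \<in> {0..t}"
      using t by (simp add: field_simps)
    then have "norm (T (real k * t / Suc n) x) \<le> M * norm x"
      by (rule order_trans[OF norm_blinfun mult_right_mono[OF M norm_ge_zero]])
    then show "norm ((t / Suc n) *\<^sub>R T (real k * t / Suc n) x) \<le> t / Suc n * (M * norm x)"
      unfolding norm_scaleR using t by (intro mult_mono) auto
  qed
  also have "\<dots> = t * M * norm x"
    by simp
  finally show ?thesis .
qed

text \<open>A functional that norms the difference of two Riemann sums sees two approximations of the same scalar
integral, with errors controlled by the modulus of continuity of the orbit for \<open>p\<close>. So Riemann sums are
Cauchy for each \<open>p\<close>, and they are norm bounded.\<close>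

lemma Riemann_sum_conv_ex:
  assumes t: "t \<ge> 0"
  shows "\<exists>v. conv (Riemann_sum t x) v"
proof (rule complete)
  obtain M where M: "\<And>s. s \<in> {0..t} \<Longrightarrow> norm (T s) \<le> M"
    using T_bounded_on_compact[of t] by blast
  show "bounded (range (Riemann_sum t x))"
    using norm_Riemann_sum_le[OF M t, of x] by (auto simp: bounded_iff)
  fix p and e :: real assume p: "p \<in> P" and e: "e > 0"
  \<comment> \<open>Two Riemann sums are each within \<open>t * e'\<close> of the integral; adding \<open>1\<close> avoids the case \<open>t = 0\<close>.\<close>
  define e' where "e' = e / 4 / (t + 1)"
  have e': "e' > 0" and te: "2 * (t * e') < e"
    using e t by (auto simp: e'_def field_simps intro!: add_pos_nonneg mult_nonneg_nonneg)
  obtain d where d: "d > 0" and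
    osc: "\<And>r s. r \<in> {0..t} \<Longrightarrow> s \<in> {0..t} \<Longrightarrow> \<bar>r - s\<bar> < d \<Longrightarrow> p (T r x - T s x) < e'"
    using orbit_uniformly_continuous[OF p e'] by blast
  obtain N where N: "t / d < real N"
    using reals_Archimedean2 by blast
  have "p (Riemann_sum t x m - Riemann_sum t x n) < e" if mn: "m \<ge> N" "n \<ge> N" for m n
  proof -
    obtain u :: "'a \<Rightarrow> real" where u: "conv_continuous u" "\<And>x. \<bar>u x\<bar> \<le> p x"
      "u (Riemann_sum t x m - Riemann_sum t x n) = p (Riemann_sum t x m - Riemann_sum t x n)"
      using norming_functional[OF p] by blast
    have lin: "linear u"
      using u(1) by (simp add: conv_continuous_def)
    have close: "\<bar>u (Riemann_sum t x k) - integral {0..t} (\<lambda>s. u (T s x))\<bar> \<le> t * e'" if "k \<ge> N" for k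
    proof -
      have "t / d < real (Suc k)"
        using N that by linarith
      then have tk: "t / real (Suc k) < d"
        using d by (simp add: field_simps)
      have "norm ((\<Sum>i<Suc k. (t / Suc k) *\<^sub>R u (T (real i * t / Suc k) x)) - integral {0..t} (\<lambda>s. u (T s x))) \<le> t * e'"
      proof (rule Riemann_sum_error[OF orbit_continuous[OF u(1)] t])
        fix r s assume rs: "r \<in> {0..t}" "s \<in> {0..t}" "\<bar>r - s\<bar> \<le> t / real (Suc k)"
        have "p (T r x - T s x) < e'"
          using osc[OF rs(1,2)] rs(3) tk by linarith
        with u(2)[of "T r x - T s x"] show "norm (u (T r x) - u (T s x)) \<le> e'"
          by (simp add: linear_diff[OF lin])
      qed (use e' in auto)
      then show ?thesis
        by (simp only: functional_Riemann_sum[OF lin] real_norm_def)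
    qed
    have "p (Riemann_sum t x m - Riemann_sum t x n) = u (Riemann_sum t x m) - u (Riemann_sum t x n)"
      using u(3) by (simp add: linear_diff[OF lin])
    with close[OF mn(1)] close[OF mn(2)] te show ?thesis
      by linarith
  qed
  then show "\<exists>N. \<forall>m\<ge>N. \<forall>n\<ge>N. p (Riemann_sum t x m - Riemann_sum t x n) < e"
    by blast
qed

definition orbit_integral :: "real \<Rightarrow> 'a \<Rightarrow>\<^sub>L 'a" where
  "orbit_integral t = Blinfun (\<lambda>x. SOME v. conv (Riemann_sum t x) v)"

lemma orbit_integral:
  assumes t: "t \<ge> 0"
  shows orbit_integral_conv: "conv (Riemann_sum t x) (orbit_integral t x)"
    and norm_orbit_integral_le: "(\<And>s. s \<in> {0..t} \<Longrightarrow> norm (T s) \<le> M) \<Longrightarrow> norm (orbit_integral t) \<le> t * M"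
    and orbit_integral_sc: "orbit_integral t (sc c x) = sc c (orbit_integral t x)"
proof -
  define V where "V x = (SOME v. conv (Riemann_sum t x) v)" for x
  have V: "conv (Riemann_sum t x) (V x)" for x
    unfolding V_def by (rule someI_ex[OF Riemann_sum_conv_ex[OF t]])
  have V_add: "V (x + y) = V x + V y" for x y
  proof (rule conv_unique[OF V])
    have "Riemann_sum t (x + y) = (\<lambda>n. Riemann_sum t x n + Riemann_sum t y n)"
      by (simp add: fun_eq_iff Riemann_sum_def blinfun.add_right scaleR_add_right sum.distrib)
    then show "conv (Riemann_sum t (x + y)) (V x + V y)"
      using conv_add[OF V V] by simp
  qed
  have sc_scaleR: "sc c (r *\<^sub>R y) = r *\<^sub>R sc c y" for c r y
    by (simp only: sc_of_real[symmetric] scale_left_commute)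
  have V_sc: "V (sc c x) = sc c (V x)" for c x
  proof (rule conv_unique[OF V])
    have "T (real k * t / Suc n) (sc c x) = sc c (T (real k * t / Suc n) x)" for k n
      by (rule T_sc) (use t in simp)
    then have "Riemann_sum t (sc c x) = (\<lambda>n. sc c (Riemann_sum t x n))"
      by (simp add: fun_eq_iff Riemann_sum_def scale_sum_right sc_scaleR scale_right_distrib)
    then show "conv (Riemann_sum t (sc c x)) (sc c (V x))"
      using conv_sc[OF V] by simp
  qed
  have V_norm: "norm (V x) \<le> t * M * norm x" if "\<And>s. s \<in> {0..t} \<Longrightarrow> norm (T s) \<le> M" for M x
    by (rule conv_norm_le[OF V norm_Riemann_sum_le[OF that t]])
  obtain M0 where M0: "\<And>s. s \<in> {0..t} \<Longrightarrow> norm (T s) \<le> M0"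
    using T_bounded_on_compact[of t] by blast
  have "bounded_linear V"
    by (rule bounded_linear_intro[OF V_add, of "t * M0"])
       (use V_sc[of "of_real _"] V_norm[OF M0] in \<open>simp_all add: sc_of_real mult.commute\<close>)
  then have app: "blinfun_apply (orbit_integral t) = V"
    unfolding orbit_integral_def V_def by (rule bounded_linear_Blinfun_apply)
  show "conv (Riemann_sum t x) (orbit_integral t x)" "orbit_integral t (sc c x) = sc c (orbit_integral t x)"
    unfolding app by (rule V, rule V_sc)
  show "norm (orbit_integral t) \<le> t * M" if M: "\<And>s. s \<in> {0..t} \<Longrightarrow> norm (T s) \<le> M"
  proof (rule norm_blinfun_bound)
    have "0 \<le> M"
      using M[of 0] t by (auto intro: order_trans[OF norm_ge_zero])
    with t show "0 \<le> t * M" by simp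
  qed (simp only: app V_norm[OF M])
qed

lemma functional_orbit_integral:
  fixes f :: "'a \<Rightarrow> 'b::banach"
  assumes f: "conv_continuous f" and t: "t \<ge> 0"
  shows "f (orbit_integral t x) = integral {0..t} (\<lambda>s. f (T s x))"
proof (rule LIMSEQ_unique)
  have lin: "linear f"
    using f by (simp add: conv_continuous_def)
  show "(\<lambda>n. f (Riemann_sum t x n)) \<longlonglongrightarrow> f (orbit_integral t x)"
    using f orbit_integral_conv[OF t] by (simp add: conv_continuous_def)
  show "(\<lambda>n. f (Riemann_sum t x n)) \<longlonglongrightarrow> integral {0..t} (\<lambda>s. f (T s x))"
    unfolding functional_Riemann_sum[OF lin] by (rule Riemann_sum_tendsto[OF orbit_continuous[OF f] t])
qed

lemma circ_compose_T: "f \<in> circ \<Longrightarrow> t \<ge> 0 \<Longrightarrow> f o\<^sub>L T t \<in> circ"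
proof (rule circI)
  assume f: "f \<in> circ" and t: "t \<ge> 0"
  show "(f o\<^sub>L T t) (sc c x) = c * (f o\<^sub>L T t) x" for c x
    by (simp add: T_sc[OF t] circD(1)[OF f])
  show "(\<lambda>n. (f o\<^sub>L T t) (s n)) \<longlonglongrightarrow> 0" if "conv s 0" for s
    using circD(2)[OF f T_conv[OF that t]] by simp
qed

text \<open>Otherwise a subsequence of \<open>s\<close> and times \<open>r N\<close> would violate local equicontinuity of the semigroup.\<close>

lemma circ_orbit_uniform:
  assumes f: "f \<in> circ" and s: "conv s 0" and e: "e > 0"
  shows "\<exists>N. \<forall>n\<ge>N. \<forall>r\<in>{0..a}. norm (f (T r (s n))) < e"
proof (rule ccontr)
  assume "\<not> ?thesis"
  then have "\<forall>N. \<exists>n r. n \<ge> N \<and> r \<in> {0..a} \<and> \<not> norm (f (T r (s n))) < e"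
    by blast
  then obtain n r where nr: "\<And>N. n N \<ge> N" "\<And>N. r N \<in> {0..a}" "\<And>N. \<not> norm (f (T (r N) (s (n N)))) < e"
    by metis
  have "filterlim n at_top sequentially"
    by (rule filterlim_at_top_mono[OF filterlim_ident always_eventually]) (simp add: nr(1))
  then have "conv (\<lambda>N. T (r N) (s (n N) - 0)) 0"
    by (intro T_equi[OF _ nr(2)] conv_compose[OF s])
  from circD(2)[OF f this] have "(\<lambda>N. f (T (r N) (s (n N)))) \<longlonglongrightarrow> 0"
    by simp
  from order_tendstoD(2)[OF tendsto_norm_zero[OF this] e] nr(3) show False
    by (simp add: eventually_sequentially)
qed

lemma circ_compose_orbit_integral:
  assumes f: "f \<in> circ" and t: "t \<ge> 0"
  shows "f o\<^sub>L orbit_integral t \<in> circ"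
proof (rule circI)
  show "(f o\<^sub>L orbit_integral t) (sc c x) = c * (f o\<^sub>L orbit_integral t) x" for c x
    by (simp add: orbit_integral_sc[OF t] circD(1)[OF f])
  fix s assume s: "conv s 0"
  show "(\<lambda>n. (f o\<^sub>L orbit_integral t) (s n)) \<longlonglongrightarrow> 0"
  proof (rule LIMSEQ_I)
    fix e :: real assume e: "e > 0"
    define e' where "e' = e / (t + 1)"
    have e': "e' > 0" and te: "t * e' < e"
      using e t by (auto simp: e'_def field_simps)
    obtain N where N: "\<And>n r. n \<ge> N \<Longrightarrow> r \<in> {0..t} \<Longrightarrow> norm (f (T r (s n))) < e'"
      using circ_orbit_uniform[OF f s e', of t] by blast
    have "norm (f (orbit_integral t (s n))) \<le> e' * (t - 0)" if "n \<ge> N" for n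
      unfolding functional_orbit_integral[OF circD(3)[OF f] t]
      by (rule integral_bound[OF t orbit_continuous[OF circD(3)[OF f]]]) (use N[OF that] in \<open>simp add: less_imp_le\<close>)
    then have "norm ((f o\<^sub>L orbit_integral t) (s n) - 0) < e" if "n \<ge> N" for n
      using that te by (fastforce simp: mult.commute)
    then show "\<exists>N. \<forall>n\<ge>N. norm ((f o\<^sub>L orbit_integral t) (s n) - 0) < e"
      by blast
  qed
qed

lemma T_orbit_integral_commute:
  assumes "h \<ge> 0" "t \<ge> 0"
  shows "T h (orbit_integral t x) = orbit_integral t (T h x)"
proof (rule eq_by_circ)
  fix f assume f: "f \<in> circ"
  have "f (T h (orbit_integral t x)) = integral {0..t} (\<lambda>s. f (T h (T s x)))"
    using functional_orbit_integral[OF circD(3)[OF circ_compose_T[OF f assms(1)]] assms(2), of x] by simp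
  also have "\<dots> = integral {0..t} (\<lambda>s. f (T s (T h x)))"
    by (rule integral_cong) (use T_plus[of h _ x] T_plus[of _ h x] assms(1) in \<open>simp add: add.commute\<close>)
  also have "\<dots> = f (orbit_integral t (T h x))"
    using functional_orbit_integral[OF circD(3)[OF f] assms(2)] by simp
  finally show "f (T h (orbit_integral t x)) = f (orbit_integral t (T h x))" .
qed

text \<open>Tested with \<open>f\<close> in \<open>X\<^sup>\<circ>\<close>, both sides are the integral of \<open>s \<mapsto> f (T(s) x)\<close> over \<open>[t, t + h]\<close> minus the
integral over \<open>[0, h]\<close>.\<close>

lemma T_orbit_integral_diff:
  assumes h: "h \<ge> 0" and t: "t \<ge> 0"
  shows "T h (orbit_integral t x) - orbit_integral t x = orbit_integral h (T t x - x)"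
proof -
  have shift: "f (orbit_integral b (T a x)) = integral {a..a + b} (\<lambda>s. f (T s x))"
    if f: "f \<in> circ" and ab: "a \<ge> 0" "b \<ge> 0" for f a b
  proof -
    have "f (orbit_integral b (T a x)) = integral {0..b} (\<lambda>s. f (T s (T a x)))"
      by (rule functional_orbit_integral[OF circD(3)[OF f] ab(2)])
    also have "\<dots> = integral {0..b} ((\<lambda>s. f (T s x)) \<circ> (+) a)"
      by (rule integral_cong) (use T_plus[of _ a x] ab in \<open>simp add: add.commute\<close>)
    also have "\<dots> = integral {a..a + b} (\<lambda>s. f (T s x))"
      by (subst integral_shift_Icc_real) (simp add: add.commute)
    finally show ?thesis .
  qed
  have "orbit_integral t (T h x) + orbit_integral h x = orbit_integral h (T t x) + orbit_integral t x"
  proof (rule eq_by_circ)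
    fix f assume f: "f \<in> circ"
    have int: "(\<lambda>s. f (T s x)) integrable_on {0..t + h}"
      by (rule integrable_continuous_interval[OF orbit_continuous[OF circD(3)[OF f]]])
    have sh: "f (orbit_integral t (T h x)) = integral {h..t + h} (\<lambda>s. f (T s x))"
      "f (orbit_integral h (T t x)) = integral {t..t + h} (\<lambda>s. f (T s x))"
      using shift[OF f h t] shift[OF f t h] by (simp_all only: add.commute)
    have "integral {0..h} (\<lambda>s. f (T s x)) + integral {h..t + h} (\<lambda>s. f (T s x)) = integral {0..t + h} (\<lambda>s. f (T s x))"
      "integral {0..t} (\<lambda>s. f (T s x)) + integral {t..t + h} (\<lambda>s. f (T s x)) = integral {0..t + h} (\<lambda>s. f (T s x))"
      using h t by (auto intro!: Henstock_Kurzweil_Integration.integral_combine[OF _ _ int])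
    then show "f (orbit_integral t (T h x) + orbit_integral h x) = f (orbit_integral h (T t x) + orbit_integral t x)"
      unfolding blinfun.add_right sh functional_orbit_integral[OF circD(3)[OF f] h, of x]
        functional_orbit_integral[OF circD(3)[OF f] t, of x]
      by (simp only: add.commute)
  qed
  then show ?thesis
    by (simp add: T_orbit_integral_commute[OF h t] blinfun.diff_right algebra_simps)
qed

text \<open>For each \<open>p\<close> the average over \<open>[0, h]\<close> differs from \<open>x\<close> by at most the supremum of \<open>p (T(s) x - x)\<close> over that interval,
as one sees by testing with a norming functional.\<close>

lemma mean_orbit_integral_conv:
  assumes h: "\<And>n. h n > 0" "h \<longlonglongrightarrow> 0"
  shows "conv (\<lambda>n. (1 / h n) *\<^sub>R orbit_integral (h n) x) x"
proof -
  obtain a where a: "\<And>n. \<bar>h n\<bar> \<le> a"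
    using convergent_imp_bounded[OF h(2)] by (auto simp: bounded_iff)
  have ha: "h n \<le> a" "0 \<le> h n" for n
    using a[of n] h(1)[of n] by auto
  obtain M where M: "\<And>s. s \<in> {0..a} \<Longrightarrow> norm (T s) \<le> M"
    using T_bounded_on_compact[of a] by blast
  show ?thesis
  proof (rule convI)
    fix n
    have "norm (orbit_integral (h n) x) \<le> h n * M * norm x"
      using norm_orbit_integral_le[of "h n" M] M ha[of n]
      by (intro order_trans[OF norm_blinfun] mult_right_mono) auto
    then show "norm ((1 / h n) *\<^sub>R orbit_integral (h n) x) \<le> M * norm x"
      using h(1)[of n] by (simp add: field_simps)
  next
    fix p assume p: "p \<in> P"
    show "(\<lambda>n. p ((1 / h n) *\<^sub>R orbit_integral (h n) x - x)) \<longlonglongrightarrow> 0"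
    proof (rule LIMSEQ_I)
      fix e :: real assume e: "e > 0"
      obtain d where d: "d > 0" and
        osc: "\<And>r t. r \<in> {0..a} \<Longrightarrow> t \<in> {0..a} \<Longrightarrow> \<bar>r - t\<bar> < d \<Longrightarrow> p (T r x - T t x) < e / 2"
        using orbit_uniformly_continuous[OF p, of "e / 2" a x] e by auto
      from order_tendstoD(2)[OF h(2) d] obtain N where N: "\<And>n. n \<ge> N \<Longrightarrow> h n < d"
        by (auto simp: eventually_sequentially)
      have "p ((1 / h n) *\<^sub>R orbit_integral (h n) x - x) \<le> e / 2" if n: "n \<ge> N" for n
      proof -
        let ?w = "(1 / h n) *\<^sub>R orbit_integral (h n) x - x"
        obtain u :: "'a \<Rightarrow> real" where u: "conv_continuous u" "\<And>x. \<bar>u x\<bar> \<le> p x" "u ?w = p ?w"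
          using norming_functional[OF p] by blast
        have lin: "linear u"
          using u(1) by (simp add: conv_continuous_def)
        have cont: "continuous_on {0..h n} (\<lambda>s. u (T s x))"
          by (rule orbit_continuous[OF u(1)])
        have "norm (integral {0..h n} (\<lambda>s. u (T s x) - u x)) \<le> e / 2 * (h n - 0)"
        proof (rule integral_bound[OF ha(2)])
          show "continuous_on {0..h n} (\<lambda>s. u (T s x) - u x)"
            by (intro continuous_intros cont)
          fix s assume s: "s \<in> {0..h n}"
          have "p (T s x - T 0 x) < e / 2"
            by (rule osc) (use s ha[of n] N[OF n] in auto)
          then show "norm (u (T s x) - u x) \<le> e / 2"
            using u(2)[of "T s x - x"] by (simp add: T_0 linear_diff[OF lin])
        qed
        moreover have "integral {0..h n} (\<lambda>s. u (T s x) - u x) = h n * u ?w"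
          using ha(2)[of n] h(1)[of n] integrable_continuous_interval[OF cont]
          by (subst integral_diff)
            (auto simp: functional_orbit_integral[OF u(1)] linear_diff[OF lin] linear_scale[OF lin] algebra_simps)
        ultimately have "h n * p ?w \<le> h n * (e / 2)"
          by (simp add: u(3) mult.commute)
        then show ?thesis
          using h(1)[of n] by (simp only: mult_le_cancel_left_pos)
      qed
      then have "norm (p ((1 / h n) *\<^sub>R orbit_integral (h n) x - x) - 0) < e" if "n \<ge> N" for n
        using that e P_props(1)[OF p, of "(1 / h n) *\<^sub>R orbit_integral (h n) x - x"] by fastforce
      then show "\<exists>N. \<forall>n\<ge>N. norm (p ((1 / h n) *\<^sub>R orbit_integral (h n) x - x) - 0) < e"
        by blast
    qed
  qed
qed

subsection \<open>The generator\<close>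

text \<open>The graph of the generator, with the limit for \<open>t\<close> tending to \<open>0\<close> from the right taken along sequences.\<close>

definition gen_rel :: "'a \<Rightarrow> 'a \<Rightarrow> bool" where
  "gen_rel x y \<longleftrightarrow>
     (\<forall>h. (\<forall>n. h n > 0) \<and> h \<longlonglongrightarrow> 0 \<longrightarrow> conv (\<lambda>n. (1 / h n) *\<^sub>R (T (h n) x - x)) y)"

lemma gen_relD: "gen_rel x y \<Longrightarrow> (\<And>n. h n > 0) \<Longrightarrow> h \<longlonglongrightarrow> 0 \<Longrightarrow> conv (\<lambda>n. (1 / h n) *\<^sub>R (T (h n) x - x)) y"
  by (simp add: gen_rel_def)

lemma gen_rel_unique: "gen_rel x y \<Longrightarrow> gen_rel x z \<Longrightarrow> y = z"
  using conv_unique[OF gen_relD[of x y "\<lambda>n. inverse (real (Suc n))"] gen_relD[of x z "\<lambda>n. inverse (real (Suc n))"]]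
    LIMSEQ_inverse_real_of_nat by simp

lemma gen_relI:
  assumes "\<And>h. (\<And>n. h n > 0) \<Longrightarrow> h \<longlonglongrightarrow> 0 \<Longrightarrow> conv (\<lambda>n. (1 / h n) *\<^sub>R (T (h n) x - x)) y"
  shows "gen_rel x y"
  using assms by (simp add: gen_rel_def)

lemma gen_rel_diff:
  assumes "gen_rel x y" "gen_rel x' y'"
  shows "gen_rel (x - x') (y - y')"
proof (rule gen_relI)
  fix h :: "nat \<Rightarrow> real" assume h: "\<And>n. h n > 0" "h \<longlonglongrightarrow> 0"
  show "conv (\<lambda>n. (1 / h n) *\<^sub>R (T (h n) (x - x') - (x - x'))) (y - y')"
    using conv_diff[OF gen_relD[OF assms(1) h] gen_relD[OF assms(2) h]]
    by (simp add: blinfun.diff_right scaleR_diff_right algebra_simps)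
qed

lemma gen_rel_T:
  assumes xy: "gen_rel x y" and t: "t \<ge> 0"
  shows "gen_rel (T t x) (T t y)"
proof (rule gen_relI)
  fix h :: "nat \<Rightarrow> real" assume h: "\<And>n. h n > 0" "h \<longlonglongrightarrow> 0"
  have "T t (T (h n) x) = T (h n) (T t x)" for n
    using T_plus[of t "h n" x] T_plus[of "h n" t x] t h(1)[of n] by (simp add: add.commute)
  with T_conv[OF gen_relD[OF xy h] t]
  show "conv (\<lambda>n. (1 / h n) *\<^sub>R (T (h n) (T t x) - T t x)) (T t y)"
    by (simp add: blinfun.scaleR_right blinfun.diff_right)
qed

lemma gen_rel_sc:
  assumes xy: "gen_rel x y"
  shows "gen_rel (sc c x) (sc c y)"
proof (rule gen_relI)
  fix h :: "nat \<Rightarrow> real" assume h: "\<And>n. h n > 0" "h \<longlonglongrightarrow> 0"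
  have "T (h n) (sc c x) = sc c (T (h n) x)" for n
    by (rule T_sc[OF less_imp_le[OF h(1)]])
  with conv_sc[OF gen_relD[OF xy h]] show "conv (\<lambda>n. (1 / h n) *\<^sub>R (T (h n) (sc c x) - sc c x)) (sc c y)"
    by (simp add: sc_scaleR scale_right_diff_distrib)
qed

text \<open>The difference quotients of \<open>V\<^sub>t x\<close> are the averages \<open>V\<^sub>h (T(t) x - x) / h\<close>.\<close>

lemma gen_rel_orbit_integral:
  assumes t: "t \<ge> 0"
  shows "gen_rel (orbit_integral t x) (T t x - x)"
  unfolding gen_rel_def
proof (intro allI impI)
  fix h :: "nat \<Rightarrow> real" assume h: "(\<forall>n. h n > 0) \<and> h \<longlonglongrightarrow> 0"
  have "conv (\<lambda>n. (1 / h n) *\<^sub>R orbit_integral (h n) (T t x - x)) (T t x - x)"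
    by (rule mean_orbit_integral_conv) (use h in auto)
  moreover have "orbit_integral (h n) (T t x - x) = T (h n) (orbit_integral t x) - orbit_integral t x" for n
    by (rule T_orbit_integral_diff[symmetric]) (use h t in \<open>auto simp: less_imp_le\<close>)
  ultimately show "conv (\<lambda>n. (1 / h n) *\<^sub>R (T (h n) (orbit_integral t x) - orbit_integral t x)) (T t x - x)"
    by simp
qed

text \<open>Apply \<open>V\<^sub>t\<close> to the difference quotients of \<open>x\<close>: the results are \<open>V\<^sub>h (T(t) x - x) / h\<close> and tend to
\<open>T(t) x - x\<close>, while \<open>f \<circ> V\<^sub>t\<close> in \<open>X\<^sup>\<circ>\<close> lets \<open>V\<^sub>t\<close> pass to the limit.\<close>

lemma T_minus_id_eq_orbit_integral:
  assumes xy: "gen_rel x y" and t: "t \<ge> 0"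
  shows "T t x - x = orbit_integral t y"
proof (rule eq_by_circ)
  fix f assume f: "f \<in> circ"
  define h where "h n = inverse (real (Suc n))" for n
  have h: "h n > 0" "h \<longlonglongrightarrow> 0" for n
    unfolding h_def by (simp, rule LIMSEQ_inverse_real_of_nat)
  have "(\<lambda>n. (f o\<^sub>L orbit_integral t) ((1 / h n) *\<^sub>R (T (h n) x - x))) \<longlonglongrightarrow> (f o\<^sub>L orbit_integral t) y"
    by (rule circD(2)[OF circ_compose_orbit_integral[OF f t] gen_relD[OF xy h]])
  moreover have "orbit_integral t (T (h n) x - x) = orbit_integral (h n) (T t x - x)" for n
    using T_orbit_integral_diff[of "h n" t x] T_orbit_integral_commute[of "h n" t x] h(1)[of n] t
    by (simp add: blinfun.diff_right)
  ultimately have "(\<lambda>n. f ((1 / h n) *\<^sub>R orbit_integral (h n) (T t x - x))) \<longlonglongrightarrow> f (orbit_integral t y)"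
    by (simp add: blinfun.scaleR_right)
  moreover have "(\<lambda>n. f ((1 / h n) *\<^sub>R orbit_integral (h n) (T t x - x))) \<longlonglongrightarrow> f (T t x - x)"
    by (rule circD(2)[OF f mean_orbit_integral_conv[OF h]])
  ultimately show "f (T t x - x) = f (orbit_integral t y)"
    using LIMSEQ_unique by blast
qed

subsection \<open>Existence of resolvents\<close>

lemma saks_semigroup_rescaled: "saks_semigroup sc P (\<lambda>t. exp (- (w * t)) *\<^sub>R T t)"
proof (unfold_locales)
  show "\<exists>l. conv s l" if "bounded (range s)"
    "\<And>p e. p \<in> P \<Longrightarrow> e > 0 \<Longrightarrow> \<exists>N. \<forall>m\<ge>N. \<forall>n\<ge>N. p (s m - s n) < e" for s
    using that by (rule complete)
  show "(exp (- (w * t)) *\<^sub>R T t) (sc c x) = sc c ((exp (- (w * t)) *\<^sub>R T t) x)" if "t \<ge> 0" for t c x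
    by (simp add: scaleR_blinfun.rep_eq T_sc[OF that] sc_scaleR)
  show "(exp (- (w * 0)) *\<^sub>R T 0) x = x" for x
    by (simp add: scaleR_blinfun.rep_eq T_0)
  show "(exp (- (w * (t + r))) *\<^sub>R T (t + r)) x = (exp (- (w * t)) *\<^sub>R T t) ((exp (- (w * r)) *\<^sub>R T r) x)"
    if "t \<ge> 0" "r \<ge> 0" for t r x
  proof -
    have "exp (- (w * (t + r))) = exp (- (w * t)) * exp (- (w * r))"
      by (simp add: distrib_left flip: exp_add)
    then show ?thesis
      by (simp add: scaleR_blinfun.rep_eq T_plus[OF that] blinfun.scaleR_right)
  qed
  show "conv (\<lambda>n. (exp (- (w * h n)) *\<^sub>R T (h n)) x) ((exp (- (w * t)) *\<^sub>R T t) x)"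
    if h: "\<And>n. h n \<ge> 0" "h \<longlonglongrightarrow> t" for h t x
    unfolding scaleR_blinfun.rep_eq
    by (rule conv_tendsto_scaleR[OF T_cont[OF h]]) (intro tendsto_intros h)
  show "conv (\<lambda>n. (exp (- (w * h n)) *\<^sub>R T (h n)) (s n - x)) 0"
    if s: "conv s x" and h: "\<And>n. h n \<in> {0..a}" for s x h a
    unfolding scaleR_blinfun.rep_eq
  proof (rule conv_bounded_scaleR[OF T_equi[OF s h]])
    fix n
    have "- (w * h n) \<le> \<bar>w\<bar> * h n"
      using h[of n] by (metis abs_ge_minus_self atLeastAtMost_iff minus_mult_left mult_right_mono)
    also have "\<dots> \<le> \<bar>w\<bar> * a"
      using h[of n] by (intro mult_left_mono) auto
    finally show "\<bar>exp (- (w * h n))\<bar> \<le> exp (\<bar>w\<bar> * a)"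
      by simp
  qed
qed

lemma gen_rel_rescaled:
  assumes xy: "gen_rel x y"
  shows "saks_semigroup.gen_rel P (\<lambda>t. exp (- (w * t)) *\<^sub>R T t) x (y - w *\<^sub>R x)"
proof -
  interpret S: saks_semigroup sc P "\<lambda>t. exp (- (w * t)) *\<^sub>R T t"
    by (rule saks_semigroup_rescaled)
  show ?thesis
    unfolding S.gen_rel_def
  proof (intro allI impI)
    fix h :: "nat \<Rightarrow> real" assume h: "(\<forall>n. h n > 0) \<and> h \<longlonglongrightarrow> 0"
    have "((\<lambda>t. exp (- (w * t))) has_real_derivative (- w)) (at 0)"
      by (auto intro!: derivative_eq_intros)
    then have "((\<lambda>t. (exp (- (w * t)) - exp (- (w * 0))) / (t - 0)) \<longlongrightarrow> - w) (at 0)"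
      by (simp only: has_field_derivative_iff)
    moreover have "filterlim h (at 0) sequentially"
      using h by (intro filterlim_atI always_eventually) (auto simp: less_imp_neq[symmetric])
    ultimately have lim: "(\<lambda>n. (exp (- (w * h n)) - exp (- (w * 0))) / (h n - 0)) \<longlonglongrightarrow> - w"
      by (rule filterlim_compose)
    have "conv (\<lambda>n. exp (- (w * h n)) *\<^sub>R ((1 / h n) *\<^sub>R (T (h n) x - x))) (exp (- (w * 0)) *\<^sub>R y)"
      using h by (intro conv_tendsto_scaleR gen_relD[OF xy] tendsto_intros) auto
    moreover have "conv (\<lambda>n. ((exp (- (w * h n)) - exp (- (w * 0))) / (h n - 0)) *\<^sub>R x) ((- w) *\<^sub>R x)"
      by (rule tendsto_imp_conv) (intro tendsto_scaleR lim tendsto_const)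
    ultimately have "conv (\<lambda>n. exp (- (w * h n)) *\<^sub>R ((1 / h n) *\<^sub>R (T (h n) x - x)) +
        ((exp (- (w * h n)) - exp (- (w * 0))) / (h n - 0)) *\<^sub>R x) (exp (- (w * 0)) *\<^sub>R y + (- w) *\<^sub>R x)"
      by (rule conv_add)
    moreover have "exp (- (w * h n)) *\<^sub>R ((1 / h n) *\<^sub>R (T (h n) x - x)) +
        ((exp (- (w * h n)) - exp (- (w * 0))) / (h n - 0)) *\<^sub>R x =
        (1 / h n) *\<^sub>R ((exp (- (w * h n)) *\<^sub>R T (h n)) x - x)" for n
      by (simp add: scaleR_blinfun.rep_eq algebra_simps diff_divide_distrib)
    ultimately show "conv (\<lambda>n. (1 / h n) *\<^sub>R ((exp (- (w * h n)) *\<^sub>R T (h n)) x - x)) (y - w *\<^sub>R x)"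
      by simp
  qed
qed

lemma gen_rel_of_rescaled:
  assumes "saks_semigroup.gen_rel P (\<lambda>t. exp (- (w * t)) *\<^sub>R T t) x z"
  shows "gen_rel x (z + w *\<^sub>R x)"
proof -
  interpret S: saks_semigroup sc P "\<lambda>t. exp (- (w * t)) *\<^sub>R T t"
    by (rule saks_semigroup_rescaled)
  have "(\<lambda>t. exp (- (- w * t)) *\<^sub>R (exp (- (w * t)) *\<^sub>R T t)) = T"
    by (simp add: fun_eq_iff flip: exp_add)
  with S.gen_rel_rescaled[OF assms, of "- w"] show ?thesis
    by simp
qed

text \<open>The two conditions say that \<open>R\<close> is a right and a left inverse of \<open>c - A\<close>.\<close>

definition is_resolvent :: "'k \<Rightarrow> ('a \<Rightarrow>\<^sub>L 'a) \<Rightarrow> bool" where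
  "is_resolvent c R \<longleftrightarrow>
     (\<forall>x. gen_rel (R x) (sc c (R x) - x)) \<and> (\<forall>x y. gen_rel x y \<longrightarrow> R (sc c x - y) = x)"

lemma is_resolventD:
  assumes "is_resolvent c R"
  shows "gen_rel (R x) (sc c (R x) - x)" and "gen_rel x y \<Longrightarrow> R (sc c x - y) = x"
  using assms by (auto simp: is_resolvent_def)

text \<open>The operator \<open>W\<close> is the inverse of \<open>1 - S\<close>, obtained from Banach's fixed point theorem for \<open>w \<mapsto> x + S w\<close>.\<close>

lemma contraction_solvable:
  fixes S :: "'a \<Rightarrow>\<^sub>L 'a"
  assumes S: "norm S \<le> 1 / 2"
  obtains W :: "'a \<Rightarrow>\<^sub>L 'a" where "\<And>x. W x = x + S (W x)" and "\<And>x w. w = x + S w \<Longrightarrow> w = W x"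
proof -
  have S_le: "norm (S w) \<le> 1 / 2 * norm w" for w
    by (rule order_trans[OF norm_blinfun mult_right_mono[OF S norm_ge_zero]])
  have uniq: "v = w" if "v = x + S v" "w = x + S w" for v w x
  proof -
    have "v - w = S (v - w)"
      by (subst that(1), subst that(2)) (simp add: blinfun.diff_right)
    then have "norm (v - w) \<le> 1 / 2 * norm (v - w)"
      using S_le[of "v - w"] by simp
    then show ?thesis by simp
  qed
  have "\<exists>w. w = x + S w" for x
  proof -
    have "\<exists>!w. x + S w = w"
    proof (rule banach_fix_type)
      show "\<forall>v w. dist (x + S v) (x + S w) \<le> 1 / 2 * dist v w"
        using S_le by (auto simp: dist_norm simp flip: blinfun.diff_right)
    qed auto
    then show ?thesis by metis
  qed
  then obtain W where W: "\<And>x. W x = x + S (W x)"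
    by metis
  have "bounded_linear W"
  proof (rule bounded_linear_intro)
    show "W (x + y) = W x + W y" for x y
      by (rule uniq[OF W]) (simp add: blinfun.add_right W[of x, symmetric] W[of y, symmetric] algebra_simps,
          metis W add.assoc add.left_commute)
    show "W (r *\<^sub>R x) = r *\<^sub>R W x" for r x
      by (rule uniq[OF W]) (metis W blinfun.scaleR_right scaleR_add_right)
    show "norm (W x) \<le> norm x * 2" for x
      using norm_triangle_ineq[of x "S (W x)"] S_le[of "W x"] W[of x] by simp
  qed
  then have "blinfun_apply (Blinfun W) = W"
    by (rule bounded_linear_Blinfun_apply)
  with W uniq[OF _ W] show ?thesis
    by (intro that[of "Blinfun W"]) auto
qed

text \<open>Choose \<open>w\<close> so large that \<open>S(t) = e\<^sup>-\<^sup>w\<^sup>t T(t)\<close> has norm at most \<open>1/2\<close> at \<open>t = 1\<close>. The generator of \<open>S\<close> is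
\<open>A - w\<close> and maps \<open>\<integral>\<^sub>0\<^sup>1 S(s) v ds\<close> to \<open>S(1) v - v\<close>; since \<open>1 - S(1)\<close> is invertible, this solves
\<open>(w - A) u = x\<close>. A kernel vector of \<open>A - w\<close> is fixed by \<open>S(1)\<close> and therefore zero.\<close>

lemma resolvent_exists:
  obtains w :: real and R where "is_resolvent (of_real w) R" and "\<And>f. f \<in> circ \<Longrightarrow> f o\<^sub>L R \<in> circ"
proof -
  obtain M where M: "M \<ge> 1" "\<And>s. s \<in> {0..1} \<Longrightarrow> norm (T s) \<le> M"
    using T_bounded_on_compact[of 1] by blast
  \<comment> \<open>This gives \<open>exp (- w) * M = 1 / 2\<close>.\<close>
  define w where "w = ln (2 * M)"
  interpret S: saks_semigroup sc P "\<lambda>t. exp (- (w * t)) *\<^sub>R T t"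
    by (rule saks_semigroup_rescaled)
  define S1 where "S1 = exp (- (w * 1)) *\<^sub>R T 1"
  have "exp (- w) = inverse (2 * M)"
    using M(1) by (simp add: w_def exp_minus)
  then have "norm S1 = inverse (2 * M) * norm (T 1)"
    using M(1) by (simp add: S1_def)
  also have "\<dots> \<le> inverse (2 * M) * M"
    using M by (intro mult_left_mono) auto
  also have "\<dots> = 1 / 2"
    using M(1) by simp
  finally have "norm S1 \<le> 1 / 2" .
  then obtain W where W: "\<And>x. blinfun_apply W x = x + S1 (W x)" and Wu: "\<And>x v. v = x + S1 v \<Longrightarrow> v = blinfun_apply W x"
    using contraction_solvable by metis
  define R where "R = S.orbit_integral 1 o\<^sub>L W"
  have gen_R: "S.gen_rel (R x) (- x)" for x
  proof -
    have "S1 (W x) - W x = - x"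
      using W[of x] by (simp add: algebra_simps)
    then show ?thesis
      using S.gen_rel_orbit_integral[of 1 "W x"] by (simp add: R_def S1_def)
  qed
  have "is_resolvent (of_real w) R"
    unfolding is_resolvent_def
  proof (intro conjI allI impI)
    show "gen_rel (R x) (sc (of_real w) (R x) - x)" for x
      using gen_rel_of_rescaled[OF gen_R[of x]] by (simp add: sc_of_real)
    fix x y assume "gen_rel x y"
    then have x: "S.gen_rel x (y - w *\<^sub>R x)"
      by (rule gen_rel_rescaled)
    define v where "v = x - R (w *\<^sub>R x - y)"
    have "S.gen_rel v ((y - w *\<^sub>R x) - - (w *\<^sub>R x - y))"
      unfolding v_def by (rule S.gen_rel_diff[OF x gen_R])
    then have "S1 v - v = S.orbit_integral 1 ((y - w *\<^sub>R x) - - (w *\<^sub>R x - y))"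
      using S.T_minus_id_eq_orbit_integral[of v _ 1] by (simp add: S1_def)
    then have "v = 0 + S1 v"
      by (simp add: blinfun.zero_right)
    from Wu[OF this] have "v = 0"
      by (simp add: blinfun.zero_right)
    then show "R (sc (of_real w) x - y) = x"
      by (simp add: v_def sc_of_real)
  qed
  moreover have "f o\<^sub>L R \<in> circ" if f: "f \<in> circ" for f
  proof (rule circI)
    have W_sc: "W (sc c x) = sc c (W x)" for c x
    proof (rule Wu[symmetric])
      have "sc c (W x) = sc c (x + S1 (W x))"
        by (rule arg_cong[OF W])
      also have "\<dots> = sc c x + S1 (sc c (W x))"
        using S.T_sc[of 1 c "W x"] by (simp add: S1_def scale_right_distrib)
      finally show "sc c (W x) = sc c x + S1 (sc c (W x))" .
    qed
    show "(f o\<^sub>L R) (sc c x) = c * (f o\<^sub>L R) x" for c x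
      by (simp add: R_def W_sc S.orbit_integral_sc circD(1)[OF f])
    fix s assume s: "conv s 0"
    define g where "g = f o\<^sub>L S.orbit_integral 1"
    have g: "g \<in> circ"
      unfolding g_def by (rule S.circ_compose_orbit_integral[OF f]) simp
    obtain C where C: "C > 0" "\<And>n. norm (s n) \<le> C"
      using s conv_bound by blast
    define v where "v n = W (s n)" for n
    have v: "norm (v n) \<le> norm W * C" for n
      unfolding v_def by (rule order_trans[OF norm_blinfun mult_left_mono[OF C(2) norm_ge_zero]])
    have "conv v 0"
    proof (rule conv_contraction_fixed_points[OF \<open>norm S1 \<le> 1 / 2\<close> _ s _ v])
      show "conv (\<lambda>n. S1 (u n)) 0" if "conv u 0" for u
        using S.T_conv[OF that, of 1] by (simp add: S1_def blinfun.zero_right)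
      show "v n = s n + S1 (v n)" for n
        unfolding v_def by (rule W)
    qed
    from circD(2)[OF g this] show "(\<lambda>n. (f o\<^sub>L R) (s n)) \<longlonglongrightarrow> 0"
      by (simp add: g_def R_def v_def blinfun.zero_right)
  qed
  ultimately show ?thesis
    by (rule that)
qed

lemma resolvent_T:
  assumes R: "is_resolvent c R" and t: "t \<ge> 0"
  shows "R (T t x) = T t (R x)"
proof -
  have "gen_rel (T t (R x)) (T t (sc c (R x) - x))"
    by (rule gen_rel_T[OF is_resolventD(1)[OF R] t])
  from is_resolventD(2)[OF R this] show ?thesis
    by (simp add: blinfun.diff_right T_sc[OF t])
qed

lemma T_resolvent_diff:
  assumes R: "is_resolvent c R" and t: "t \<ge> 0"
  shows "T t (R x) - R x = orbit_integral t (sc c (R x) - x)"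
  by (rule T_minus_id_eq_orbit_integral[OF is_resolventD(1)[OF R] t])

lemma resolvent_sc:
  assumes R: "is_resolvent c R"
  shows "R (sc a x) = sc a (R x)"
proof -
  have "gen_rel (sc a (R x)) (sc a (sc c (R x) - x))"
    by (rule gen_rel_sc[OF is_resolventD(1)[OF R]])
  from is_resolventD(2)[OF R this] show ?thesis
    by (simp add: scale_right_diff_distrib mult.commute)
qed

lemma resolvent_identity:
  assumes R: "is_resolvent b R" and S: "is_resolvent c S"
  shows "R x = S x + sc (c - b) (S (R x))"
proof -
  have "R x = S (sc c (R x) - (sc b (R x) - x))"
    using is_resolventD(2)[OF S is_resolventD(1)[OF R]] by simp
  also have "sc c (R x) - (sc b (R x) - x) = x + sc (c - b) (R x)"
    by (simp add: scale_left_diff_distrib)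
  finally show ?thesis
    by (simp add: blinfun.add_right resolvent_sc[OF S])
qed

section \<open>The bi-sun dual\<close>

lemma circ_add:
  assumes f: "f \<in> circ" and g: "g \<in> circ"
  shows "f + g \<in> circ"
proof (rule circI)
  show "(f + g) (sc c x) = c * (f + g) x" for c x
    by (simp add: blinfun.add_left circD(1)[OF f] circD(1)[OF g] distrib_left)
  show "(\<lambda>n. (f + g) (s n)) \<longlonglongrightarrow> 0" if "conv s 0" for s
    using tendsto_add[OF circD(2)[OF f that] circD(2)[OF g that]] by (simp add: blinfun.add_left blinfun.zero_right)
qed

lemma scale_fun_apply [simp]: "scale_fun c f x = c * f x"
  by (simp add: scale_fun_def)

lemma circ_scale_fun:
  assumes f: "f \<in> circ"
  shows "scale_fun c f \<in> circ"
proof (rule circI)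
  show "scale_fun c f (sc a x) = a * scale_fun c f x" for a x
    by (simp add: circD(1)[OF f])
  show "(\<lambda>n. scale_fun c f (s n)) \<longlonglongrightarrow> 0" if "conv s 0" for s
    using tendsto_mult[OF tendsto_const[of c] circD(2)[OF f that]] by (simp add: blinfun.zero_right)
qed

lemma scale_fun_of_real: "scale_fun (of_real r) f = r *\<^sub>R f"
  by (rule blinfun_eqI) (simp add: scaleR_blinfun.rep_eq scaleR_conv_of_real)

lemma norm_scale_fun_le: "norm (scale_fun c f) \<le> norm c * norm f"
  by (rule norm_blinfun_bound) (simp_all add: norm_mult mult.assoc mult_left_mono norm_blinfun)

text \<open>The bi-sun dual, written in terms of \<open>circ\<close>.\<close>

definition bullet :: "('a \<Rightarrow>\<^sub>L 'k) set" where
  "bullet = {f \<in> circ. ((\<lambda>t. norm ((f o\<^sub>L T t) - f)) \<longlongrightarrow> 0) (at_right 0)}"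

lemma bulletD: "f \<in> bullet \<Longrightarrow> f \<in> circ" "f \<in> bullet \<Longrightarrow> ((\<lambda>t. norm ((f o\<^sub>L T t) - f)) \<longlongrightarrow> 0) (at_right 0)"
  by (auto simp: bullet_def)

lemma eventually_at_right_0_Ioc: "a > 0 \<Longrightarrow> \<forall>\<^sub>F t in at_right (0::real). t \<in> {0<..a}"
  unfolding eventually_at_right_field by (intro exI[of _ a]) auto

lemma bullet_squeeze:
  assumes f: "f \<in> circ" and g: "(g \<longlongrightarrow> 0) (at_right 0)"
    and le: "\<And>t. t \<in> {0<..1} \<Longrightarrow> norm ((f o\<^sub>L T t) - f) \<le> g t"
  shows "f \<in> bullet"
proof -
  have "((\<lambda>t. norm ((f o\<^sub>L T t) - f)) \<longlongrightarrow> 0) (at_right 0)"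
    by (rule Lim_null_comparison[OF _ g])
       (rule eventually_mono[OF eventually_at_right_0_Ioc[of 1]], use le in auto)
  with f show ?thesis
    by (simp add: bullet_def)
qed

lemma tendsto_linear_at_right: "((\<lambda>t. C * t) \<longlongrightarrow> 0) (at_right (0::real))" for C :: real
  by (auto intro!: tendsto_eq_intros)

lemma bullet_0: "0 \<in> bullet"
  by (rule bullet_squeeze[of _ "\<lambda>t. 0"]) (auto intro: circI simp: blinfun.zero_left)

lemma bullet_add: "f \<in> bullet \<Longrightarrow> g \<in> bullet \<Longrightarrow> f + g \<in> bullet"
proof (rule bullet_squeeze)
  assume f: "f \<in> bullet" and g: "g \<in> bullet"
  show "f + g \<in> circ"
    by (intro circ_add bulletD f g)
  show "((\<lambda>t. norm ((f o\<^sub>L T t) - f) + norm ((g o\<^sub>L T t) - g)) \<longlongrightarrow> 0) (at_right 0)"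
    by (intro tendsto_add_zero bulletD f g)
  show "norm (((f + g) o\<^sub>L T t) - (f + g)) \<le> norm ((f o\<^sub>L T t) - f) + norm ((g o\<^sub>L T t) - g)" for t
  proof -
    have eq: "((f + g) o\<^sub>L T t) - (f + g) = ((f o\<^sub>L T t) - f) + ((g o\<^sub>L T t) - g)"
      by (rule blinfun_eqI) (simp add: blinfun.add_left blinfun.diff_left)
    show ?thesis
      unfolding eq by (rule norm_triangle_ineq)
  qed
qed

lemma bullet_scale_fun: "f \<in> bullet \<Longrightarrow> scale_fun c f \<in> bullet"
proof (rule bullet_squeeze)
  assume f: "f \<in> bullet"
  show "scale_fun c f \<in> circ"
    by (intro circ_scale_fun bulletD f)
  show "((\<lambda>t. norm c * norm ((f o\<^sub>L T t) - f)) \<longlongrightarrow> 0) (at_right 0)"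
    by (intro tendsto_mult_right_zero bulletD f)
  show "norm ((scale_fun c f o\<^sub>L T t) - scale_fun c f) \<le> norm c * norm ((f o\<^sub>L T t) - f)" for t
  proof -
    have "(scale_fun c f o\<^sub>L T t) - scale_fun c f = scale_fun c ((f o\<^sub>L T t) - f)"
      by (rule blinfun_eqI) (simp add: blinfun.diff_left right_diff_distrib)
    then show ?thesis
      by (simp only: norm_scale_fun_le)
  qed
qed

lemma bullet_scaleR: "f \<in> bullet \<Longrightarrow> r *\<^sub>R f \<in> bullet"
  using bullet_scale_fun[of f "of_real r"] by (simp only: scale_fun_of_real)

lemma bullet_diff: "f \<in> bullet \<Longrightarrow> g \<in> bullet \<Longrightarrow> f - g \<in> bullet"
  using bullet_add[of f "(-1) *\<^sub>R g"] bullet_scaleR[of g "-1"] by simp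

lemma bullet_compose_T:
  assumes f: "f \<in> bullet" and t: "t \<ge> 0"
  shows "f o\<^sub>L T t \<in> bullet"
proof (rule bullet_squeeze)
  show "f o\<^sub>L T t \<in> circ"
    by (rule circ_compose_T[OF bulletD(1)[OF f] t])
  show "((\<lambda>h. norm ((f o\<^sub>L T h) - f) * norm (T t)) \<longlongrightarrow> 0) (at_right 0)"
    by (intro tendsto_mult_left_zero bulletD f)
  show "norm ((f o\<^sub>L T t o\<^sub>L T h) - (f o\<^sub>L T t)) \<le> norm ((f o\<^sub>L T h) - f) * norm (T t)" if "h \<in> {0<..1}" for h
  proof -
    have "(f o\<^sub>L T t o\<^sub>L T h) - (f o\<^sub>L T t) = ((f o\<^sub>L T h) - f) o\<^sub>L T t"
      by (rule blinfun_eqI)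
         (use that t T_plus[of t h] T_plus[of h t] in \<open>simp add: blinfun.diff_left add.commute\<close>)
    then show ?thesis
      by (simp only: norm_blinfun_compose)
  qed
qed

text \<open>A functional whose differences along the semigroup factor through \<open>V\<^sub>t\<close> varies at a rate linear in \<open>t\<close>, as the norm of
\<open>V\<^sub>t\<close> is of order \<open>t\<close>. This applies to \<open>f \<circ> V\<^sub>t\<close> and to \<open>f \<circ> R\<close> for a resolvent \<open>R\<close>.\<close>

lemma bullet_if_orbit_integral:
  fixes f g :: "'a \<Rightarrow>\<^sub>L 'k" and S :: "'a \<Rightarrow>\<^sub>L 'a"
  assumes g: "g \<in> circ" and S: "\<And>t x. t > 0 \<Longrightarrow> g (T t x) - g x = f (orbit_integral t (S x))"
  shows "g \<in> bullet"
proof -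
  obtain M where M0: "\<And>t. t \<in> {0..1} \<Longrightarrow> norm (T t) \<le> M"
    using T_bounded_on_compact[of 1] by blast
  have M: "norm (orbit_integral t) \<le> t * M" if "t \<in> {0..1}" for t
    by (rule norm_orbit_integral_le) (use that M0 in auto)
  show ?thesis
  proof (rule bullet_squeeze[OF g tendsto_linear_at_right[of "norm f * M * norm S"]])
    fix t :: real assume t: "t \<in> {0<..1}"
    have "(g o\<^sub>L T t) - g = f o\<^sub>L orbit_integral t o\<^sub>L S"
      by (rule blinfun_eqI) (use S t in \<open>simp add: blinfun.diff_left\<close>)
    also have "norm \<dots> \<le> norm f * norm (orbit_integral t) * norm S"
      by (meson norm_blinfun_compose mult_right_mono norm_ge_zero order_trans)
    also have "\<dots> \<le> norm f * (t * M) * norm S"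
      using M[of t] t by (intro mult_right_mono mult_left_mono) auto
    finally show "norm ((g o\<^sub>L T t) - g) \<le> norm f * M * norm S * t"
      by (simp only: ac_simps)
  qed
qed

lemma bullet_compose_orbit_integral:
  assumes f: "f \<in> circ" and t: "t \<ge> 0"
  shows "f o\<^sub>L orbit_integral t \<in> bullet"
proof (rule bullet_if_orbit_integral[OF circ_compose_orbit_integral[OF f t], of f "T t - id_blinfun"])
  fix h :: real and x assume h: "h > 0"
  then show "(f o\<^sub>L orbit_integral t) (T h x) - (f o\<^sub>L orbit_integral t) x = f (orbit_integral h ((T t - id_blinfun) x))"
    using T_orbit_integral_diff[of h t x] T_orbit_integral_commute[of h t x] t
    by (simp add: blinfun.diff_left flip: blinfun.diff_right)
qed

text \<open>The operator \<open>A R\<close> for a resolvent \<open>R\<close> at \<open>c\<close>.\<close>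

lemma bounded_generator_resolvent:
  fixes R :: "'a \<Rightarrow>\<^sub>L 'a"
  obtains S :: "'a \<Rightarrow>\<^sub>L 'a" where "\<And>x. S x = sc c (R x) - x"
proof -
  have bl: "bounded_linear (\<lambda>x. sc c (R x) - x)"
  proof (rule bounded_linear_sub[OF bounded_linear_intro[where K = "norm c * norm R"] bounded_linear_ident])
    show "norm (sc c (R x)) \<le> norm x * (norm c * norm R)" for x
      using mult_left_mono[OF norm_blinfun[of R x] norm_ge_zero[of c]] by (simp add: norm_sc ac_simps)
  qed (simp_all add: blinfun.add_right blinfun.scaleR_right scale_right_distrib sc_scaleR)
  show ?thesis
    by (rule that[of "Blinfun (\<lambda>x. sc c (R x) - x)"]) (simp add: bounded_linear_Blinfun_apply[OF bl])
qed

lemma bullet_compose_resolvent: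
  assumes R: "is_resolvent c R" and fR: "f o\<^sub>L R \<in> circ"
  shows "f o\<^sub>L R \<in> bullet"
proof -
  obtain S where S: "\<And>x. blinfun_apply S x = sc c (R x) - x"
    by (rule bounded_generator_resolvent) (rule that)
  show ?thesis
  proof (rule bullet_if_orbit_integral[OF fR, of f S])
    fix h :: real and x assume h: "h > 0"
    then show "(f o\<^sub>L R) (T h x) - (f o\<^sub>L R) x = f (orbit_integral h (S x))"
      using T_resolvent_diff[OF R, of h x] resolvent_T[OF R, of h x]
      by (simp add: S flip: blinfun.diff_right)
  qed
qed

text \<open>The convergence is in norm: on the bi-sun dual \<open>f \<circ> T(s)\<close> is norm close to \<open>f\<close> for small \<open>s\<close>, and \<open>f \<circ> V\<^sub>t / t\<close> averages these
functionals over \<open>[0, t]\<close>.\<close>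

lemma bullet_mean_orbit_integral:
  assumes f: "f \<in> bullet"
  shows "((\<lambda>t. (1 / t) *\<^sub>R (f o\<^sub>L orbit_integral t)) \<longlongrightarrow> f) (at_right 0)"
proof (rule tendstoI)
  fix e :: real assume e: "e > 0"
  have "\<forall>\<^sub>F t in at_right 0. norm ((f o\<^sub>L T t) - f) < e / 2"
    by (rule order_tendstoD(2)[OF bulletD(2)[OF f]]) (use e in simp)
  then obtain d where d: "d > 0" "\<And>t. 0 < t \<Longrightarrow> t < d \<Longrightarrow> norm ((f o\<^sub>L T t) - f) < e / 2"
    unfolding eventually_at_right_field by blast
  note fc = circD(3)[OF bulletD(1)[OF f]]
  have "norm ((1 / t) *\<^sub>R (f o\<^sub>L orbit_integral t) - f) \<le> e / 2" if t: "0 < t" "t < d" for t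
  proof (rule norm_blinfun_bound)
    fix x
    have cont: "continuous_on {0..t} (\<lambda>s. f (T s x))"
      by (rule orbit_continuous[OF fc])
    have "norm (integral {0..t} (\<lambda>s. f (T s x) - f x)) \<le> e / 2 * norm x * (t - 0)"
    proof (rule integral_bound)
      show "continuous_on {0..t} (\<lambda>s. f (T s x) - f x)"
        by (intro continuous_intros cont)
      fix s assume s: "s \<in> {0..t}"
      show "norm (f (T s x) - f x) \<le> e / 2 * norm x"
      proof (cases "s = 0")
        case True
        with e show ?thesis by (simp add: T_0)
      next
        case False
        have "f (T s x) - f x = ((f o\<^sub>L T s) - f) x"
          by (simp add: blinfun.diff_left)
        also have "norm \<dots> \<le> norm ((f o\<^sub>L T s) - f) * norm x"
          by (rule norm_blinfun)
        also have "\<dots> \<le> e / 2 * norm x"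
          using d(2)[of s] s t False by (intro mult_right_mono) auto
        finally show ?thesis .
      qed
    qed (use t in simp)
    moreover have "integral {0..t} (\<lambda>s. f (T s x) - f x) = t *\<^sub>R (((1 / t) *\<^sub>R (f o\<^sub>L orbit_integral t) - f) x)"
      using t integrable_continuous_interval[OF cont]
      by (subst integral_diff)
        (auto simp: functional_orbit_integral[OF fc] blinfun.diff_left scaleR_blinfun.rep_eq scaleR_diff_right)
    ultimately have "t * norm (((1 / t) *\<^sub>R (f o\<^sub>L orbit_integral t) - f) x) \<le> t * (e / 2 * norm x)"
      using t by (simp add: ac_simps)
    then show "norm (((1 / t) *\<^sub>R (f o\<^sub>L orbit_integral t) - f) x) \<le> e / 2 * norm x"
      using t(1) by (simp only: mult_le_cancel_left_pos)
  qed (use e in simp)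
  then have "dist ((1 / t) *\<^sub>R (f o\<^sub>L orbit_integral t)) f < e" if "0 < t" "t < d" for t
    using that e by (fastforce simp: dist_norm)
  then show "\<forall>\<^sub>F t in at_right 0. dist ((1 / t) *\<^sub>R (f o\<^sub>L orbit_integral t)) f < e"
    unfolding eventually_at_right_field using d(1) by blast
qed

text \<open>The graph of the generator of the semigroup on the bi-sun dual.\<close>

definition bullet_gen_rel :: "('a \<Rightarrow>\<^sub>L 'k) \<Rightarrow> ('a \<Rightarrow>\<^sub>L 'k) \<Rightarrow> bool" where
  "bullet_gen_rel f g \<longleftrightarrow> f \<in> bullet \<and> g \<in> bullet \<and>
     ((\<lambda>t. (1 / t) *\<^sub>R ((f o\<^sub>L T t) - f)) \<longlongrightarrow> g) (at_right 0)"

lemma bullet_gen_rel_if_orbit_integral: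
  assumes f: "f \<in> bullet" and g: "g \<in> bullet" and fS: "f o\<^sub>L S \<in> bullet"
    and S: "\<And>t x. t > 0 \<Longrightarrow> g (T t x) - g x = f (orbit_integral t (S x))"
  shows "bullet_gen_rel g (f o\<^sub>L S)"
  unfolding bullet_gen_rel_def
proof (intro conjI g fS)
  have "((\<lambda>t. (1 / t) *\<^sub>R (f o\<^sub>L orbit_integral t) o\<^sub>L S) \<longlongrightarrow> f o\<^sub>L S) (at_right 0)"
    by (intro bounded_bilinear.tendsto[OF bounded_bilinear_blinfun_compose] bullet_mean_orbit_integral[OF f] tendsto_const)
  moreover have "(1 / t) *\<^sub>R (f o\<^sub>L orbit_integral t) o\<^sub>L S = (1 / t) *\<^sub>R ((g o\<^sub>L T t) - g)" if "t > 0" for t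
    by (rule blinfun_eqI) (simp add: scaleR_blinfun.rep_eq blinfun.diff_left S[OF that])
  ultimately show "((\<lambda>t. (1 / t) *\<^sub>R ((g o\<^sub>L T t) - g)) \<longlongrightarrow> f o\<^sub>L S) (at_right 0)"
    by (rule Lim_transform_eventually[OF _ eventually_mono[OF eventually_at_right_less]]) auto
qed

lemma bullet_gen_rel_orbit_integral:
  assumes f: "f \<in> bullet" and t: "t \<ge> 0"
  shows "bullet_gen_rel (f o\<^sub>L orbit_integral t) ((f o\<^sub>L T t) - f)"
proof -
  have eq: "f o\<^sub>L (T t - id_blinfun) = (f o\<^sub>L T t) - f"
    by (rule blinfun_eqI) (simp add: blinfun.diff_left blinfun.diff_right)
  have "bullet_gen_rel (f o\<^sub>L orbit_integral t) (f o\<^sub>L (T t - id_blinfun))"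
  proof (rule bullet_gen_rel_if_orbit_integral[OF f bullet_compose_orbit_integral[OF bulletD(1)[OF f] t]])
    show "f o\<^sub>L (T t - id_blinfun) \<in> bullet"
      unfolding eq by (intro bullet_diff bullet_compose_T f t)
    fix h :: real and x assume h: "h > 0"
    then show "(f o\<^sub>L orbit_integral t) (T h x) - (f o\<^sub>L orbit_integral t) x = f (orbit_integral h ((T t - id_blinfun) x))"
      using T_orbit_integral_diff[of h t x] T_orbit_integral_commute[of h t x] t
      by (simp add: blinfun.diff_left flip: blinfun.diff_right)
  qed
  then show ?thesis
    by (simp only: eq)
qed

lemma bullet_gen_rel_resolvent:
  assumes R: "is_resolvent c R" and f: "f \<in> bullet" and fR: "f o\<^sub>L R \<in> circ"
  shows "bullet_gen_rel (f o\<^sub>L R) (scale_fun c (f o\<^sub>L R) - f)"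
proof -
  obtain S where S: "\<And>x. blinfun_apply S x = sc c (R x) - x"
    by (rule bounded_generator_resolvent) (rule that)
  have eq: "f o\<^sub>L S = scale_fun c (f o\<^sub>L R) - f"
    by (rule blinfun_eqI)
       (simp add: S blinfun.diff_left blinfun.diff_right circD(1)[OF bulletD(1)[OF f]])
  have fRb: "f o\<^sub>L R \<in> bullet"
    by (rule bullet_compose_resolvent[OF R fR])
  have "bullet_gen_rel (f o\<^sub>L R) (f o\<^sub>L S)"
  proof (rule bullet_gen_rel_if_orbit_integral[OF f fRb])
    show "f o\<^sub>L S \<in> bullet"
      unfolding eq by (intro bullet_diff bullet_scale_fun fRb f)
    fix h :: real and x assume h: "h > 0"
    then show "(f o\<^sub>L R) (T h x) - (f o\<^sub>L R) x = f (orbit_integral h (S x))"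
      using T_resolvent_diff[OF R, of h x] resolvent_T[OF R, of h x]
      by (simp add: S flip: blinfun.diff_right)
  qed
  then show ?thesis
    by (simp only: eq)
qed

lemma bullet_gen_rel_apply:
  assumes fg: "bullet_gen_rel f g" and h: "\<And>n. h n > 0" "h \<longlonglongrightarrow> 0"
  shows "(\<lambda>n. f ((1 / h n) *\<^sub>R (T (h n) x - x))) \<longlonglongrightarrow> g x"
proof -
  have "filterlim h (at_right 0) sequentially"
    using h by (intro tendsto_imp_filterlim_at_right always_eventually) auto
  moreover have "((\<lambda>t. (1 / t) *\<^sub>R ((f o\<^sub>L T t) - f)) \<longlongrightarrow> g) (at_right 0)"
    using fg by (simp add: bullet_gen_rel_def)
  ultimately have "(\<lambda>n. (1 / h n) *\<^sub>R ((f o\<^sub>L T (h n)) - f)) \<longlonglongrightarrow> g"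
    by (rule filterlim_compose[rotated])
  then have "(\<lambda>n. ((1 / h n) *\<^sub>R ((f o\<^sub>L T (h n)) - f)) x) \<longlonglongrightarrow> g x"
    by (intro bounded_bilinear.tendsto[OF bounded_bilinear_blinfun_apply] tendsto_const)
  then show ?thesis
    by (simp add: scaleR_blinfun.rep_eq blinfun.diff_left blinfun.diff_right blinfun.scaleR_right)
qed

text \<open>So the domain of \<open>A\<^sup>\<bullet>\<close> is contained in the range of \<open>R\<^sup>\<bullet>\<close>, for a resolvent \<open>R\<close> at any point \<open>c\<close>. The reason is that
\<open>f (A (R x))\<close> can be computed as a limit of difference quotients on either side of the pairing.\<close>

lemma bullet_gen_rel_in_range_resolvent:
  assumes fg: "bullet_gen_rel f g" and R: "is_resolvent c R"
  shows "f = (scale_fun c f - g) o\<^sub>L R"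
proof (rule blinfun_eqI)
  fix x
  have f: "f \<in> circ"
    using fg by (auto simp: bullet_gen_rel_def bullet_def)
  define h where "h n = inverse (real (Suc n))" for n
  have h: "h n > 0" "h \<longlonglongrightarrow> 0" for n
    unfolding h_def by (simp, rule LIMSEQ_inverse_real_of_nat)
  have "(\<lambda>n. f ((1 / h n) *\<^sub>R (T (h n) (R x) - R x))) \<longlonglongrightarrow> f (sc c (R x) - x)"
    by (rule circD(2)[OF f gen_relD[OF is_resolventD(1)[OF R] h]])
  with bullet_gen_rel_apply[OF fg h, of "R x"] have "g (R x) = f (sc c (R x) - x)"
    by (rule LIMSEQ_unique)
  then show "f x = ((scale_fun c f - g) o\<^sub>L R) x"
    by (simp add: blinfun.diff_left blinfun.diff_right circD(1)[OF f])
qed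

text \<open>If all \<open>f \<circ> V\<^sub>h\<close> vanish at \<open>x\<close>, so does \<open>f\<close>, the limit of \<open>f (V\<^sub>h x) / h\<close>; and \<open>X\<^sup>\<circ>\<close> separates points.\<close>

lemma bullet_separates:
  assumes "\<And>f. f \<in> bullet \<Longrightarrow> blinfun_apply f x = 0"
  shows "x = 0"
proof (rule circ_separates)
  fix f assume f: "f \<in> circ"
  define h where "h n = inverse (real (Suc n))" for n
  have h: "h n > 0" "h \<longlonglongrightarrow> 0" for n
    unfolding h_def by (simp, rule LIMSEQ_inverse_real_of_nat)
  have "f (orbit_integral (h n) x) = 0" for n
    using assms[OF bullet_compose_orbit_integral[OF f, of "h n"]] h(1)[of n] by simp
  moreover have "(\<lambda>n. f ((1 / h n) *\<^sub>R orbit_integral (h n) x)) \<longlonglongrightarrow> f x"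
    by (rule circD(2)[OF f mean_orbit_integral_conv[OF h]])
  ultimately have "(\<lambda>n. 0) \<longlonglongrightarrow> f x"
    by (simp add: blinfun.scaleR_right)
  then show "f x = 0"
    by (simp add: LIMSEQ_const_iff)
qed

end

section \<open>Compactness in weak topologies\<close>

lemma compactin_pullback_topology:
  assumes K: "compactin T (g ` K)" and A: "K \<subseteq> A"
  shows "compactin (pullback_topology A g T) K"
  unfolding compactin_def
proof (intro conjI allI impI)
  show "K \<subseteq> topspace (pullback_topology A g T)"
    using compactin_subset_topspace[OF K] A by (auto simp: topspace_pullback_topology)
  fix \<U> assume \<U>: "(\<forall>U\<in>\<U>. openin (pullback_topology A g T) U) \<and> K \<subseteq> \<Union>\<U>"
  then have "\<forall>U\<in>\<U>. \<exists>V. openin T V \<and> (\<forall>x. x \<in> U \<longleftrightarrow> g x \<in> V \<and> x \<in> A)"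
    unfolding openin_pullback_topology by fastforce
  then obtain V where V: "\<And>U. U \<in> \<U> \<Longrightarrow> openin T (V U)"
    "\<And>U x. U \<in> \<U> \<Longrightarrow> x \<in> U \<longleftrightarrow> g x \<in> V U \<and> x \<in> A"
    by metis
  have cover: "g ` K \<subseteq> \<Union>(V ` \<U>)"
  proof (rule image_subsetI)
    fix x assume "x \<in> K"
    then have "x \<in> \<Union>\<U>"
      using \<U> by (elim conjE subsetD)
    then obtain U where U: "U \<in> \<U>" "x \<in> U"
      by (rule UnionE)
    with V(2)[OF U(1), of x] have "g x \<in> V U" by simp
    with U(1) show "g x \<in> \<Union>(V ` \<U>)"
      by (rule UN_I)
  qed
  have "\<exists>\<F>. finite \<F> \<and> \<F> \<subseteq> V ` \<U> \<and> g ` K \<subseteq> \<Union>\<F>"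
    by (rule compactinD[OF K _ cover]) (use V(1) in auto)
  then obtain \<F> where F: "finite \<F>" "\<F> \<subseteq> V ` \<U>" "g ` K \<subseteq> \<Union>\<F>"
    by blast
  then obtain \<G> where G: "finite \<G>" "\<G> \<subseteq> \<U>" "\<F> = V ` \<G>"
    by (meson finite_subset_image)
  have "K \<subseteq> \<Union>\<G>"
  proof
    fix x assume x: "x \<in> K"
    then obtain U where U: "U \<in> \<G>" "g x \<in> V U"
      using F(3) G(3) by blast
    have "x \<in> U"
      using V(2)[OF subsetD[OF G(2) U(1)], of x] U(2) subsetD[OF A x] by simp
    with U(1) show "x \<in> \<Union>\<G>"
      by (rule UnionI)
  qed
  with G show "\<exists>\<F>. finite \<F> \<and> \<F> \<subseteq> \<U> \<and> K \<subseteq> \<Union>\<F>" by blast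
qed

lemma compactin_sequence_cluster_point:
  fixes s :: "nat \<Rightarrow> 'a"
  assumes K: "compactin T K" and s: "\<And>n. s n \<in> K"
  obtains z where "z \<in> K" and "\<And>U. openin T U \<Longrightarrow> z \<in> U \<Longrightarrow> \<exists>\<^sub>F n in sequentially. s n \<in> U"
proof -
  have "\<exists>z\<in>K. \<forall>U. openin T U \<and> z \<in> U \<longrightarrow> (\<exists>\<^sub>F n in sequentially. s n \<in> U)"
  proof (rule ccontr)
    assume "\<not> ?thesis"
    then have "\<forall>z\<in>K. \<exists>U. openin T U \<and> z \<in> U \<and> (\<forall>\<^sub>F n in sequentially. s n \<notin> U)"
      by (auto simp: not_frequently)
    then obtain U where U: "\<And>z. z \<in> K \<Longrightarrow> openin T (U z)" "\<And>z. z \<in> K \<Longrightarrow> z \<in> U z"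
      "\<And>z. z \<in> K \<Longrightarrow> \<forall>\<^sub>F n in sequentially. s n \<notin> U z"
      by metis
    have "\<exists>\<F>. finite \<F> \<and> \<F> \<subseteq> U ` K \<and> K \<subseteq> \<Union>\<F>"
      by (rule compactinD[OF K]) (use U(1,2) in auto)
    then obtain \<F> where F: "finite \<F>" "\<F> \<subseteq> U ` K" "K \<subseteq> \<Union>\<F>"
      by blast
    have "\<forall>\<^sub>F n in sequentially. \<forall>V\<in>\<F>. s n \<notin> V"
      using F(1,2) U(3) by (intro eventually_ball_finite) auto
    then obtain n where "\<forall>V\<in>\<F>. s n \<notin> V"
      unfolding eventually_sequentially by blast
    with F(3) s[of n] show False by blast
  qed
  with that show ?thesis by blast
qed

lemma continuous_map_weak_top_space_eval:
  assumes "f \<in> W"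
  shows "continuous_map (weak_top_space W) euclidean (blinfun_apply f)"
proof -
  have "continuous_map (weak_top_space W) euclidean ((\<lambda>z. z f) \<circ> (\<lambda>x. restrict (\<lambda>f. blinfun_apply f x) W))"
    unfolding weak_top_space_def weak_topology_def
    by (rule continuous_map_pullback) (rule continuous_map_product_projection[OF assms])
  then show ?thesis
    using assms by (simp add: comp_def)
qed

text \<open>A cluster point of a sequence in a weakly compact set: a functional that converges along the whole sequence takes
its limit at the cluster point.\<close>

lemma weak_compact_sequence:
  assumes K: "compactin (weak_top_space W) K" and s: "\<And>n. s n \<in> K"
  obtains z where "z \<in> K" and "\<And>f l. f \<in> W \<Longrightarrow> (\<lambda>n. blinfun_apply f (s n)) \<longlonglongrightarrow> l \<Longrightarrow> blinfun_apply f z = l"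
proof -
  obtain z where z: "z \<in> K" "\<And>U. openin (weak_top_space W) U \<Longrightarrow> z \<in> U \<Longrightarrow> \<exists>\<^sub>F n in sequentially. s n \<in> U"
    by (rule compactin_sequence_cluster_point[where s = s, OF K s]) (rule that)
  have lim: "f z = l" if f: "f \<in> W" and l: "(\<lambda>n. f (s n)) \<longlonglongrightarrow> l" for f l
  proof (rule ccontr)
    assume "f z \<noteq> l"
    then obtain U V where UV: "open U" "open V" "f z \<in> U" "l \<in> V" "U \<inter> V = {}"
      by (meson hausdorff)
    have "z \<in> topspace (weak_top_space W)"
      using compactin_subset_topspace[OF K] z(1) by blast
    moreover have "openin (weak_top_space W) {x \<in> topspace (weak_top_space W). f x \<in> U}"
      by (rule openin_continuous_map_preimage[OF continuous_map_weak_top_space_eval[OF f]]) (use UV in auto)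
    ultimately have "\<exists>\<^sub>F n in sequentially. s n \<in> {x \<in> topspace (weak_top_space W). f x \<in> U}"
      using UV by (intro z(2)) auto
    moreover have "\<forall>\<^sub>F n in sequentially. f (s n) \<in> V"
      by (rule topological_tendstoD[OF l UV(2,4)])
    ultimately have "\<exists>\<^sub>F n in sequentially. f (s n) \<in> U \<and> f (s n) \<in> V"
      by (rule frequently_rev_mp[OF _ eventually_mono]) auto
    then show False
      using UV(5) by (blast dest: frequently_ex)
  qed
  show ?thesis
    by (rule that[OF z(1) lim])
qed

lemma continuous_map_weak_top_space:
  assumes "\<And>f. f \<in> W2 \<Longrightarrow> f o\<^sub>L Q \<in> W1"
  shows "continuous_map (weak_top_space W1) (weak_top_space W2) (blinfun_apply Q)"
  unfolding weak_top_space_def[of W2] weak_topology_def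
proof (rule continuous_map_pullback')
  show "continuous_map (weak_top_space W1) (product_topology (\<lambda>_. euclidean) W2)
      ((\<lambda>x. restrict (\<lambda>f. blinfun_apply f x) W2) \<circ> blinfun_apply Q)"
    unfolding continuous_map_componentwise
  proof (intro conjI ballI)
    fix f assume f: "f \<in> W2"
    have "continuous_map (weak_top_space W1) euclidean (blinfun_apply (f o\<^sub>L Q))"
      by (rule continuous_map_weak_top_space_eval[OF assms[OF f]])
    with f show "continuous_map (weak_top_space W1) euclidean
        (\<lambda>x. ((\<lambda>x. restrict (\<lambda>f. blinfun_apply f x) W2) \<circ> blinfun_apply Q) x f)"
      by (simp add: comp_def blinfun_compose.rep_eq)
  qed auto
qed auto

context saks_semigroup
begin

section \<open>Compactness of the unit ball and surjectivity of the canonical map\<close>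

lemma bullet_dual_eq: "bullet_dual sc \<tau> T = bullet"
  by (simp add: bullet_dual_def bullet_def circ_dual_eq_circ dual_op_def)

lemma bullet_gen_domain_eq: "bullet_gen_domain sc \<tau> T = {f. \<exists>g. bullet_gen_rel f g}"
  by (auto simp: bullet_gen_domain_def bullet_gen_rel_def bullet_dual_eq dual_op_def)

lemma gen_domain_eq: "gen_domain sc \<tau> T = {x. \<exists>y. gen_rel x y}"
  by (simp add: gen_domain_def gen_rel_def limitin_mixed_at_right)

lemma generator_eq: "gen_rel x y \<Longrightarrow> generator sc \<tau> T x = y"
  unfolding generator_def limitin_mixed_at_right gen_rel_def[symmetric]
  by (rule the_equality) (auto intro: gen_rel_unique)

abbreviation bullet_ball :: "'a set" where
  "bullet_ball \<equiv> {x. bullet_norm sc \<tau> T x \<le> 1}"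

text \<open>The ball is described without a supremum, as the set on which every \<open>f\<close> in the bi-sun dual is at most
its norm.\<close>

lemma bullet_ball_iff: "x \<in> bullet_ball \<longleftrightarrow> (\<forall>f\<in>bullet. norm (blinfun_apply f x) \<le> norm f)"
proof
  have bdd: "bdd_above ((\<lambda>f. norm (blinfun_apply f x)) ` {f \<in> bullet. norm f \<le> 1})"
  proof (rule bdd_aboveI2)
    fix f assume "f \<in> {f \<in> bullet. norm f \<le> 1}"
    then show "norm (blinfun_apply f x) \<le> 1 * norm x"
      by (intro order_trans[OF norm_blinfun] mult_right_mono) auto
  qed
  assume x: "x \<in> bullet_ball"
  show "\<forall>f\<in>bullet. norm (blinfun_apply f x) \<le> norm f"
  proof
    fix f assume f: "f \<in> bullet"
    show "norm (f x) \<le> norm f"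
    proof (cases "f = 0")
      case False
      have "norm (((1 / norm f) *\<^sub>R f) x) \<le> bullet_norm sc \<tau> T x"
        unfolding bullet_norm_def bullet_dual_eq
        by (rule cSUP_upper[OF _ bdd]) (use False bullet_scaleR[OF f] in simp)
      with x have "norm (((1 / norm f) *\<^sub>R f) x) \<le> 1"
        by simp
      with False show ?thesis
        by (simp add: scaleR_blinfun.rep_eq)
    qed simp
  qed
next
  assume "\<forall>f\<in>bullet. norm (blinfun_apply f x) \<le> norm f"
  then have "bullet_norm sc \<tau> T x \<le> 1"
    unfolding bullet_norm_def bullet_dual_eq
    by (intro cSUP_least) (use bullet_0 in \<open>auto intro: order_trans\<close>)
  then show "x \<in> bullet_ball" by simp
qed

lemma scaled_in_bullet_ball:
  assumes "\<And>f. f \<in> bullet \<Longrightarrow> norm (blinfun_apply f x) \<le> K * norm f" and "K > 0"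
  shows "(1 / K) *\<^sub>R x \<in> bullet_ball"
  unfolding bullet_ball_iff using assms by (simp add: blinfun.scaleR_right pos_divide_le_eq mult.commute)

lemma sub_dualD:
  assumes "y \<in> sub_dual bullet"
  shows "f \<in> bullet \<Longrightarrow> g \<in> bullet \<Longrightarrow> y (f + g) = y f + y g"
    and "f \<in> bullet \<Longrightarrow> y (scale_fun c f) = c * y f"
    and "f \<in> bullet \<Longrightarrow> y (r *\<^sub>R f) = r *\<^sub>R y f"
    and "f \<in> bullet \<Longrightarrow> g \<in> bullet \<Longrightarrow> y (f - g) = y f - y g"
    and "\<exists>C>0. \<forall>f\<in>bullet. norm (y f) \<le> C * norm f"
    and "y \<in> extensional bullet"
proof -
  show add: "y (f + g) = y f + y g" if "f \<in> bullet" "g \<in> bullet" for f g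
    using assms that by (simp add: sub_dual_def)
  show sf: "y (scale_fun c f) = c * y f" if "f \<in> bullet" for c f
    using assms that by (simp add: sub_dual_def)
  show sR: "y (r *\<^sub>R f) = r *\<^sub>R y f" if "f \<in> bullet" for r f
    using sf[OF that, of "of_real r"] by (simp add: scale_fun_of_real scaleR_conv_of_real)
  show "y (f - g) = y f - y g" if "f \<in> bullet" "g \<in> bullet" for f g
    using add[OF that(1) bullet_scaleR[OF that(2), of "-1"]] sR[OF that(2), of "-1"] by simp
  have "\<exists>C. \<forall>f\<in>bullet. norm (y f) \<le> C * norm f"
    using assms by (simp add: sub_dual_def)
  then obtain C where C: "\<And>f. f \<in> bullet \<Longrightarrow> norm (y f) \<le> C * norm f"
    by blast
  have "norm (y f) \<le> (\<bar>C\<bar> + 1) * norm f" if "f \<in> bullet" for f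
    by (rule order_trans[OF C[OF that] mult_right_mono]) auto
  then show "\<exists>C>0. \<forall>f\<in>bullet. norm (y f) \<le> C * norm f"
    by (intro exI[of _ "\<bar>C\<bar> + 1"]) auto
  show "y \<in> extensional bullet"
    using assms by (simp add: sub_dual_def)
qed

lemma sub_dual_tendsto:
  assumes y: "y \<in> sub_dual bullet" and lim: "(s \<longlongrightarrow> f) F" and s: "\<And>n. s n \<in> bullet" and f: "f \<in> bullet"
  shows "((\<lambda>n. y (s n)) \<longlongrightarrow> y f) F"
proof -
  obtain C where C: "\<And>f. f \<in> bullet \<Longrightarrow> norm (y f) \<le> C * norm f"
    using sub_dualD(5)[OF y] by blast
  have "((\<lambda>n. y (s n) - y f) \<longlongrightarrow> 0) F"
  proof (rule Lim_null_comparison[OF always_eventually])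
    show "\<forall>n. norm (y (s n) - y f) \<le> C * norm (s n - f)"
      using C[OF bullet_diff[OF s f]] by (simp add: sub_dualD(4)[OF y s f])
    show "((\<lambda>n. C * norm (s n - f)) \<longlongrightarrow> 0) F"
      by (intro tendsto_mult_right_zero tendsto_norm_zero LIM_zero lim)
  qed
  then show ?thesis
    by (rule LIM_zero_cancel)
qed

lemma canonical_map_in_sub_dual: "canonical_map sc \<tau> T x \<in> sub_dual bullet"
  unfolding sub_dual_def canonical_map_def bullet_dual_eq
proof (intro CollectI conjI ballI allI)
  show "\<exists>C. \<forall>f\<in>bullet. norm ((\<lambda>f\<in>bullet. blinfun_apply f x) f) \<le> C * norm f"
    using norm_blinfun[of _ x] by (intro exI[of _ "norm x"]) (auto simp: mult.commute)
qed (auto simp: bullet_add bullet_scale_fun blinfun.add_left)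

lemma canonical_map_eqI:
  "y \<in> sub_dual bullet \<Longrightarrow> (\<And>f. f \<in> bullet \<Longrightarrow> blinfun_apply f x = y f) \<Longrightarrow> canonical_map sc \<tau> T x = y"
  unfolding canonical_map_def bullet_dual_eq
  by (rule extensionalityI[of _ bullet]) (auto simp: sub_dualD(6))

lemma sub_dual_norm_bounds:
  assumes "\<And>f. f \<in> bullet \<Longrightarrow> norm (y f) \<le> K * norm f" and K: "K \<ge> 0"
  shows "0 \<le> sub_dual_norm bullet y" and "sub_dual_norm bullet y \<le> K"
proof -
  have le: "norm (y f) \<le> K" if "f \<in> {f \<in> bullet. norm f \<le> 1}" for f
    using assms(1)[of f] mult_left_mono[of "norm f" 1 K] K that by simp
  then show "sub_dual_norm bullet y \<le> K"
    unfolding sub_dual_norm_def by (rule cSUP_least[rotated]) (use bullet_0 in auto)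
  have "norm (y 0) \<le> sub_dual_norm bullet y"
    unfolding sub_dual_norm_def by (rule cSUP_upper[OF _ bdd_aboveI2[OF le]]) (use bullet_0 in auto)
  with norm_ge_zero[of "y 0"] show "0 \<le> sub_dual_norm bullet y"
    by linarith
qed

lemma mean_in_bullet: "f \<in> circ \<Longrightarrow> h \<ge> 0 \<Longrightarrow> (1 / h) *\<^sub>R (f o\<^sub>L orbit_integral h) \<in> bullet"
  by (intro bullet_scaleR bullet_compose_orbit_integral)

text \<open>On the dual side the averaged functional varies at a rate linear in \<open>t\<close>, because \<open>(T(t) - 1) V\<^sub>h = V\<^sub>t (T(h) - 1)\<close>.
The bound \<open>C M\<close> does not depend on \<open>h\<close>, which is what keeps the representing points in one multiple of the ball.\<close>

lemma mean_in_bullet_bullet_dual: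
  assumes y: "y \<in> sub_dual bullet" and C: "\<And>f. f \<in> bullet \<Longrightarrow> norm (y f) \<le> C * norm f" "C > 0"
    and M: "\<And>t. t \<in> {0..1} \<Longrightarrow> norm (orbit_integral t) \<le> t * M" "M \<ge> 1" and h: "0 < h" "h \<le> 1"
  defines "z \<equiv> \<lambda>f\<in>bullet. y ((1 / h) *\<^sub>R (f o\<^sub>L orbit_integral h))"
  shows "z \<in> bullet_bullet_dual sc \<tau> T" and "f \<in> bullet \<Longrightarrow> norm (z f) \<le> C * M * norm f"
proof -
  have V: "(1 / h) *\<^sub>R (f o\<^sub>L orbit_integral h) \<in> bullet" if "f \<in> bullet" for f
    by (rule mean_in_bullet[OF bulletD(1)[OF that]]) (use h in simp)
  have z: "z f = y ((1 / h) *\<^sub>R (f o\<^sub>L orbit_integral h))" if "f \<in> bullet" for f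
    using that by (simp add: z_def)
  show z_le: "norm (z f) \<le> C * M * norm f" if f: "f \<in> bullet" for f
  proof -
    have "norm ((1 / h) *\<^sub>R (f o\<^sub>L orbit_integral h)) \<le> (1 / h) * (norm f * norm (orbit_integral h))"
      using h mult_left_mono[OF norm_blinfun_compose[of f "orbit_integral h"], of "1 / h"] by simp
    also have "\<dots> \<le> (1 / h) * (norm f * (h * M))"
      using h by (intro mult_left_mono M) auto
    also have "\<dots> = norm f * M"
      using h by simp
    finally have "C * norm ((1 / h) *\<^sub>R (f o\<^sub>L orbit_integral h)) \<le> C * (norm f * M)"
      using C(2) by (intro mult_left_mono) auto
    with C(1)[OF V[OF f]] show ?thesis
      by (simp add: z[OF f] ac_simps)
  qed
  have z_add: "z (f + g) = z f + z g" if "f \<in> bullet" "g \<in> bullet" for f g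
  proof -
    have "(1 / h) *\<^sub>R (f + g o\<^sub>L orbit_integral h) =
        (1 / h) *\<^sub>R (f o\<^sub>L orbit_integral h) + (1 / h) *\<^sub>R (g o\<^sub>L orbit_integral h)"
      by (rule blinfun_eqI) (simp add: blinfun.add_left scaleR_blinfun.rep_eq scaleR_add_right)
    then show ?thesis
      using that by (simp add: z bullet_add sub_dualD(1)[OF y V V])
  qed
  have z_scale: "z (scale_fun c f) = c * z f" if "f \<in> bullet" for c f
  proof -
    have "(1 / h) *\<^sub>R (scale_fun c f o\<^sub>L orbit_integral h) = scale_fun c ((1 / h) *\<^sub>R (f o\<^sub>L orbit_integral h))"
      by (rule blinfun_eqI) (simp add: scaleR_blinfun.rep_eq)
    then show ?thesis
      using that by (simp add: z bullet_scale_fun sub_dualD(2)[OF y V])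
  qed
  have zs: "z \<in> sub_dual bullet"
    unfolding sub_dual_def using z_add z_scale z_le by (auto simp: z_def intro: exI[of _ "C * M"])
  have diff_le: "norm (z (f o\<^sub>L T t) - z f) \<le> (C * (1 / h) * M * norm (T h - id_blinfun) * t) * norm f"
    if f: "f \<in> bullet" and t: "t \<in> {0<..1}" for f t
  proof -
    have fT: "f o\<^sub>L T t \<in> bullet"
      by (rule bullet_compose_T[OF f]) (use t in simp)
    have eq2: "(1 / h) *\<^sub>R (f o\<^sub>L T t o\<^sub>L orbit_integral h) - (1 / h) *\<^sub>R (f o\<^sub>L orbit_integral h) =
        (1 / h) *\<^sub>R (f o\<^sub>L orbit_integral t o\<^sub>L (T h - id_blinfun))"
    proof (rule blinfun_eqI)
      fix x
      have "T t (orbit_integral h x) - orbit_integral h x = orbit_integral t (T h x - x)"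
        by (rule T_orbit_integral_diff) (use t h in auto)
      then have "f (T t (orbit_integral h x)) - f (orbit_integral h x) = f (orbit_integral t (T h x - x))"
        by (simp flip: blinfun.diff_right)
      then show "((1 / h) *\<^sub>R (f o\<^sub>L T t o\<^sub>L orbit_integral h) - (1 / h) *\<^sub>R (f o\<^sub>L orbit_integral h)) x =
          ((1 / h) *\<^sub>R (f o\<^sub>L orbit_integral t o\<^sub>L (T h - id_blinfun))) x"
        by (simp add: blinfun.diff_left scaleR_blinfun.rep_eq flip: scaleR_diff_right)
    qed
    have "z (f o\<^sub>L T t) - z f =
        y ((1 / h) *\<^sub>R (f o\<^sub>L T t o\<^sub>L orbit_integral h) - (1 / h) *\<^sub>R (f o\<^sub>L orbit_integral h))"
      by (simp only: z[OF f] z[OF fT] sub_dualD(4)[OF y V[OF fT] V[OF f]])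
    then have eq: "z (f o\<^sub>L T t) - z f = y ((1 / h) *\<^sub>R (f o\<^sub>L orbit_integral t o\<^sub>L (T h - id_blinfun)))"
      by (simp only: eq2)
    have "norm (z (f o\<^sub>L T t) - z f) \<le> C * norm ((1 / h) *\<^sub>R (f o\<^sub>L orbit_integral t o\<^sub>L (T h - id_blinfun)))"
      unfolding eq by (rule C(1)) (unfold eq2[symmetric], intro bullet_diff V f fT)
    also have "norm ((1 / h) *\<^sub>R (f o\<^sub>L orbit_integral t o\<^sub>L (T h - id_blinfun))) \<le>
        (1 / h) * (norm f * (t * M) * norm (T h - id_blinfun))"
    proof -
      have "norm (f o\<^sub>L orbit_integral t o\<^sub>L (T h - id_blinfun)) \<le> norm f * norm (orbit_integral t) * norm (T h - id_blinfun)"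
        by (meson norm_blinfun_compose mult_right_mono norm_ge_zero order_trans)
      also have "\<dots> \<le> norm f * (t * M) * norm (T h - id_blinfun)"
        using t by (intro mult_right_mono mult_left_mono M) auto
      finally show ?thesis
        using h by (simp add: divide_right_mono)
    qed
    finally show ?thesis
      using C(2) by (simp add: mult_left_mono ac_simps)
  qed
  have "((\<lambda>t. sub_dual_norm bullet (\<lambda>f\<in>bullet. z (f o\<^sub>L T t) - z f)) \<longlongrightarrow> 0) (at_right 0)"
  proof (rule Lim_null_comparison[OF _ tendsto_linear_at_right[of "C * (1 / h) * M * norm (T h - id_blinfun)"]])
    show "\<forall>\<^sub>F t in at_right 0. norm (sub_dual_norm bullet (\<lambda>f\<in>bullet. z (f o\<^sub>L T t) - z f)) \<le>
        C * (1 / h) * M * norm (T h - id_blinfun) * t"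
      using eventually_at_right_0_Ioc[of 1, simplified]
    proof eventually_elim
      case (elim t)
      then have t: "t \<in> {0<..1}" by simp
      have K: "0 \<le> C * (1 / h) * M * norm (T h - id_blinfun) * t"
        using C(2) M(2) h t by (intro mult_nonneg_nonneg) auto
      have le: "norm ((\<lambda>f\<in>bullet. z (f o\<^sub>L T t) - z f) f) \<le> (C * (1 / h) * M * norm (T h - id_blinfun) * t) * norm f"
        if "f \<in> bullet" for f
        unfolding restrict_apply'[OF that] by (rule diff_le[OF that t])
      show ?case
        using sub_dual_norm_bounds[OF le K] by (simp only: real_norm_def abs_of_nonneg)
    qed
  qed
  with zs show "z \<in> bullet_bullet_dual sc \<tau> T"
    by (simp add: bullet_bullet_dual_def bullet_dual_eq dual_op_def)
qed

text \<open>The averages of \<open>y\<close> are represented by points \<open>x n\<close>, by reflexivity. A cluster point \<open>Q b\<close> of \<open>Q (x n) / k\<close> yields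
\<open>y (g \<circ> Q) = (g \<circ> Q) (k b)\<close> for all \<open>g\<close> in the bi-sun dual. Since the functionals \<open>g \<circ> Q\<close> include all \<open>f \<circ> V\<^sub>h\<close>, and \<open>f \<circ> V\<^sub>h / h\<close>
tends to \<open>f\<close>, the point \<open>k b\<close> represents \<open>y\<close>. The operator \<open>Q\<close> is the identity in one application and a resolvent in the other.\<close>

lemma canonical_map_surj_if_compact:
  assumes refl: "bullet_reflexive sc \<tau> T"
    and Q: "\<And>f. f \<in> bullet \<Longrightarrow> f o\<^sub>L Q \<in> bullet"
    and range: "\<And>f h. f \<in> bullet \<Longrightarrow> h > 0 \<Longrightarrow> \<exists>g\<in>bullet. f o\<^sub>L orbit_integral h = g o\<^sub>L Q"
    and K: "compactin (weak_top_space bullet) (blinfun_apply Q ` bullet_ball)"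
  shows "range (canonical_map sc \<tau> T) = sub_dual bullet"
proof (intro equalityI subsetI)
  show "y \<in> sub_dual bullet" if "y \<in> range (canonical_map sc \<tau> T)" for y
    using that canonical_map_in_sub_dual by blast
  fix y assume y: "y \<in> sub_dual bullet"
  obtain C where C: "\<And>f. f \<in> bullet \<Longrightarrow> norm (y f) \<le> C * norm f" "C > 0"
    using sub_dualD(5)[OF y] by blast
  obtain M where M0: "M \<ge> 1" "\<And>t. t \<in> {0..1} \<Longrightarrow> norm (T t) \<le> M"
    using T_bounded_on_compact[of 1] by blast
  have M: "norm (orbit_integral t) \<le> t * M" if "t \<in> {0..1}" for t
    by (rule norm_orbit_integral_le) (use that M0 in auto)
  define h where "h n = inverse (real (Suc n))" for n
  have h: "h n > 0" "h n \<le> 1" "h \<longlonglongrightarrow> 0" for n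
    unfolding h_def by (simp, simp add: inverse_le_1_iff, rule LIMSEQ_inverse_real_of_nat)
  have hf: "filterlim h (at_right 0) sequentially"
    using h by (intro tendsto_imp_filterlim_at_right always_eventually) auto
  define z where "z n = (\<lambda>f\<in>bullet. y ((1 / h n) *\<^sub>R (f o\<^sub>L orbit_integral (h n))))" for n
  have z: "z n \<in> bullet_bullet_dual sc \<tau> T" "f \<in> bullet \<Longrightarrow> norm (z n f) \<le> C * M * norm f" for n f
    unfolding z_def using mean_in_bullet_bullet_dual[OF y C M M0(1) h(1,2)] by blast+
  have "\<exists>x. canonical_map sc \<tau> T x = z n" for n
  proof -
    have "z n \<in> canonical_map sc \<tau> T ` cont_space T"
      using refl z(1)[of n] by (simp only: bullet_reflexive_def)
    then show ?thesis
      by (elim imageE) (rule exI, erule sym)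
  qed
  then obtain x where x: "\<And>n. canonical_map sc \<tau> T (x n) = z n"
    by metis
  have fx: "f (x n) = z n f" if "f \<in> bullet" for f n
  proof -
    have "canonical_map sc \<tau> T (x n) f = z n f"
      by (simp only: x)
    with that show ?thesis
      by (simp add: canonical_map_def bullet_dual_eq)
  qed
  define k where "k = C * M"
  have k: "k > 0"
    using C(2) M0(1) by (simp add: k_def)
  have in_ball: "Q ((1 / k) *\<^sub>R x n) \<in> Q ` bullet_ball" for n
    by (intro imageI scaled_in_bullet_ball[OF _ k]) (use z(2) in \<open>simp add: fx k_def\<close>)
  obtain v where v: "v \<in> Q ` bullet_ball" and
    lim: "\<And>f l. f \<in> bullet \<Longrightarrow> (\<lambda>n. f (Q ((1 / k) *\<^sub>R x n))) \<longlonglongrightarrow> l \<Longrightarrow> f v = l"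
    by (rule weak_compact_sequence[where s = "\<lambda>n. Q ((1 / k) *\<^sub>R x n)", OF K in_ball]) (rule that)
  obtain b where b: "v = Q b"
    using v by blast
  have means: "(\<lambda>n. (1 / h n) *\<^sub>R (f o\<^sub>L orbit_integral (h n))) \<longlonglongrightarrow> f" if "f \<in> bullet" for f
    by (rule filterlim_compose[OF bullet_mean_orbit_integral[OF that] hf])
  have mb: "(1 / h n) *\<^sub>R (f o\<^sub>L orbit_integral (h n)) \<in> bullet" if "f \<in> bullet" for f n
    by (rule mean_in_bullet[OF bulletD(1)[OF that] less_imp_le[OF h(1)]])
  have yQ: "y (g o\<^sub>L Q) = (g o\<^sub>L Q) (k *\<^sub>R b)" if g: "g \<in> bullet" for g
  proof -
    have "(\<lambda>n. (1 / k) *\<^sub>R y ((1 / h n) *\<^sub>R ((g o\<^sub>L Q) o\<^sub>L orbit_integral (h n)))) \<longlonglongrightarrow> (1 / k) *\<^sub>R y (g o\<^sub>L Q)"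
      by (intro tendsto_scaleR tendsto_const sub_dual_tendsto[OF y means[OF Q[OF g]] mb[OF Q[OF g]] Q[OF g]])
    moreover have "g (Q ((1 / k) *\<^sub>R x n)) = (1 / k) *\<^sub>R y ((1 / h n) *\<^sub>R ((g o\<^sub>L Q) o\<^sub>L orbit_integral (h n)))" for n
      using fx[OF Q[OF g], of n] Q[OF g] by (simp add: blinfun.scaleR_right z_def)
    ultimately have "g v = (1 / k) *\<^sub>R y (g o\<^sub>L Q)"
      using lim[OF g] by simp
    with k show ?thesis
      by (simp add: b blinfun.scaleR_right)
  qed
  have "f (k *\<^sub>R b) = y f" if f: "f \<in> bullet" for f
  proof (rule LIMSEQ_unique)
    show "(\<lambda>n. y ((1 / h n) *\<^sub>R (f o\<^sub>L orbit_integral (h n)))) \<longlonglongrightarrow> y f"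
      by (rule sub_dual_tendsto[OF y means[OF f] mb[OF f] f])
    have "y ((1 / h n) *\<^sub>R (f o\<^sub>L orbit_integral (h n))) = ((1 / h n) *\<^sub>R (f o\<^sub>L orbit_integral (h n))) (k *\<^sub>R b)" for n
    proof -
      obtain g where g: "g \<in> bullet" "f o\<^sub>L orbit_integral (h n) = g o\<^sub>L Q"
        using range[OF f h(1)] by blast
      show ?thesis
        using sub_dualD(3)[OF y Q[OF g(1)], of "1 / h n"] yQ[OF g(1)] by (simp add: g(2) scaleR_blinfun.rep_eq)
    qed
    moreover have "(\<lambda>n. ((1 / h n) *\<^sub>R (f o\<^sub>L orbit_integral (h n))) (k *\<^sub>R b)) \<longlonglongrightarrow> f (k *\<^sub>R b)"
      by (intro bounded_bilinear.tendsto[OF bounded_bilinear_blinfun_apply] means[OF f] tendsto_const)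
    ultimately show "(\<lambda>n. y ((1 / h n) *\<^sub>R (f o\<^sub>L orbit_integral (h n)))) \<longlonglongrightarrow> f (k *\<^sub>R b)"
      by simp
  qed
  then have "canonical_map sc \<tau> T (k *\<^sub>R b) = y"
    by (rule canonical_map_eqI[OF y])
  then show "y \<in> range (canonical_map sc \<tau> T)" by blast
qed

text \<open>Banach-Alaoglu. The functionals on the bi-sun dual of norm at most one form a closed subset of a product of compact
balls, and surjectivity says that this subset is exactly the image of the ball.\<close>

lemma compact_ball_if_canonical_map_surj:
  assumes surj: "range (canonical_map sc \<tau> T) = sub_dual bullet"
  shows "compactin (weak_top_space bullet) bullet_ball"
  unfolding weak_top_space_def weak_topology_def
proof (rule compactin_pullback_topology)
  let ?X = "product_topology (\<lambda>_. euclidean) bullet :: (('a \<Rightarrow>\<^sub>L 'k) \<Rightarrow> 'k) topology"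
  let ?E = "\<Pi>\<^sub>E f\<in>bullet. cball 0 (norm f)"
  \<comment> \<open>Linearity is an intersection of equations between continuous functions of \<open>y\<close>.\<close>
  define L where "L = (\<Inter>(f, g)\<in>bullet \<times> bullet. {y \<in> topspace ?X. y (f + g) = y f + y g}) \<inter>
    (\<Inter>(c, f)\<in>UNIV \<times> bullet. {y \<in> topspace ?X. y (scale_fun c f) = c * y f})"
  have proj: "continuous_map ?X euclidean (\<lambda>y. y f)" if "f \<in> bullet" for f
    by (rule continuous_map_product_projection[OF that])
  have "closedin ?X L"
    unfolding L_def
  proof (intro closedin_Int closedin_INT)
    show "bullet \<times> bullet \<noteq> {}" "(UNIV :: 'k set) \<times> bullet \<noteq> {}"
      using bullet_0 by auto
    show "closedin ?X (case fg of (f, g) \<Rightarrow> {y \<in> topspace ?X. y (f + g) = y f + y g})"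
      if "fg \<in> bullet \<times> bullet" for fg
    proof (cases fg)
      case (Pair f g)
      with that have "f \<in> bullet" "g \<in> bullet" by auto
      then have "closedin ?X {y \<in> topspace ?X. y (f + g) = y f + y g}"
        by (intro closedin_continuous_maps_eq[OF Hausdorff_space_euclidean] continuous_map_add proj bullet_add)
      then show ?thesis by (simp only: Pair case_prod_conv)
    qed
    show "closedin ?X (case cf of (c, f) \<Rightarrow> {y \<in> topspace ?X. y (scale_fun c f) = c * y f})"
      if "cf \<in> UNIV \<times> bullet" for cf
    proof (cases cf)
      case (Pair c f)
      with that have f: "f \<in> bullet" by auto
      have "continuous_map euclidean euclidean ((*) c)"
        by (simp add: continuous_on_mult_left)
      from continuous_map_compose[OF proj[OF f] this] have "continuous_map ?X euclidean (\<lambda>y. c * y f)"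
        by (simp add: comp_def)
      then have "closedin ?X {y \<in> topspace ?X. y (scale_fun c f) = c * y f}"
        by (intro closedin_continuous_maps_eq[OF Hausdorff_space_euclidean] proj bullet_scale_fun f)
      then show ?thesis by (simp only: Pair case_prod_conv)
    qed
  qed
  moreover have "compactin ?X ?E"
    by (simp add: compactin_PiE compact_cball_scalar)
  ultimately have "compactin ?X (L \<inter> ?E)"
    by (rule closed_Int_compactin)
  moreover have "(\<lambda>x. restrict (\<lambda>f. blinfun_apply f x) bullet) ` bullet_ball = L \<inter> ?E"
  proof (intro equalityI subsetI)
    fix y assume "y \<in> (\<lambda>x. restrict (\<lambda>f. blinfun_apply f x) bullet) ` bullet_ball"
    then obtain x where x: "x \<in> bullet_ball" and y: "y = (\<lambda>f\<in>bullet. blinfun_apply f x)" by blast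
    show "y \<in> L \<inter> ?E"
      using x unfolding bullet_ball_iff y
      by (auto simp: L_def bullet_add bullet_scale_fun blinfun.add_left PiE_iff)
  next
    fix y assume y: "y \<in> L \<inter> ?E"
    then have yf: "norm (y f) \<le> norm f" if "f \<in> bullet" for f
      using that by (auto simp: PiE_iff)
    have "y \<in> sub_dual bullet"
      using y by (auto simp: sub_dual_def L_def PiE_iff intro!: exI[of _ 1])
    then obtain x where x: "y = (\<lambda>f\<in>bullet. blinfun_apply f x)"
      using surj by (auto simp: canonical_map_def bullet_dual_eq)
    have "x \<in> bullet_ball"
      unfolding bullet_ball_iff using yf by (simp add: x)
    with x show "y \<in> (\<lambda>x. restrict (\<lambda>f. blinfun_apply f x) bullet) ` bullet_ball" by blast
  qed
  ultimately show "compactin ?X ((\<lambda>x. restrict (\<lambda>f. blinfun_apply f x) bullet) ` bullet_ball)"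
    by simp
qed simp

section \<open>The set of admissible resolvent points\<close>

abbreviation D :: "'a set" where "D \<equiv> gen_domain sc \<tau> T"

abbreviation A :: "'a \<Rightarrow> 'a" where "A \<equiv> generator sc \<tau> T"

text \<open>The set \<open>\<Lambda>\<close> of the statement.\<close>

definition adm_points :: "'k set" where
  "adm_points = {c \<in> resolvent_set sc D A.
     dual_op (resolvent sc D A c) ` bullet_dual sc \<tau> T \<subseteq> bullet_gen_domain sc \<tau> T}"

lemma is_resolvent_resolvent:
  assumes c: "c \<in> resolvent_set sc D A"
  shows "is_resolvent c (resolvent sc D A c)"
proof -
  define F where "F x = sc c x - A x" for x
  have bij: "bij_betw F D UNIV"
    using c by (simp add: resolvent_set_def F_def[abs_def])
  then have inj: "inj_on F D" and im: "F ` D = UNIV"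
    by (simp_all add: bij_betw_def)
  have "the_inv_into D F \<in> blinfun_apply ` bounded_ops sc"
    using c by (simp add: resolvent_set_def resolvent_fun_def F_def[abs_def])
  then have R: "blinfun_apply (resolvent sc D A c) = the_inv_into D F"
    by (auto simp: resolvent_def resolvent_fun_def F_def[abs_def] blinfun_apply_inverse)
  show ?thesis
    unfolding is_resolvent_def R
  proof (intro conjI allI impI)
    fix x
    have "the_inv_into D F x \<in> D"
      by (rule the_inv_into_into[OF inj]) (simp_all add: im)
    then obtain y where y: "gen_rel (the_inv_into D F x) y"
      by (auto simp: gen_domain_eq)
    have "F (the_inv_into D F x) = x"
      by (rule f_the_inv_into_f[OF inj]) (simp add: im)
    then have "sc c (the_inv_into D F x) - x = y"
      using generator_eq[OF y] by (simp add: F_def algebra_simps)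
    with y show "gen_rel (the_inv_into D F x) (sc c (the_inv_into D F x) - x)"
      by simp
  next
    fix x y assume xy: "gen_rel x y"
    then have "x \<in> D" by (auto simp: gen_domain_eq)
    from the_inv_into_f_f[OF inj this] show "the_inv_into D F (sc c x - y) = x"
      by (simp add: F_def generator_eq[OF xy])
  qed
qed

lemma resolvent_eqI:
  assumes R: "is_resolvent c R"
  shows "c \<in> resolvent_set sc D A" and "resolvent sc D A c = R"
proof -
  define F where "F x = sc c x - A x" for x
  have RF: "R (F x) = x" if "x \<in> D" for x
    using that is_resolventD(2)[OF R] by (auto simp: gen_domain_eq F_def generator_eq)
  have FR: "R x \<in> D" "F (R x) = x" for x
    using is_resolventD(1)[OF R, of x] generator_eq[OF is_resolventD(1)[OF R, of x]]
    by (auto simp: gen_domain_eq F_def)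
  have inj: "inj_on F D"
    by (rule inj_on_inverseI[where g = "blinfun_apply R"]) (rule RF)
  have "bij_betw F D UNIV"
    unfolding bij_betw_def using inj FR by (metis UNIV_eq_I image_eqI)
  moreover have inv: "the_inv_into D F = blinfun_apply R"
    by (rule ext) (rule the_inv_into_f_eq[OF inj FR(2) FR(1)])
  moreover have "R \<in> bounded_ops sc"
    by (simp add: bounded_ops_def resolvent_sc[OF R])
  ultimately show "c \<in> resolvent_set sc D A"
    by (simp add: resolvent_set_def resolvent_fun_def F_def[abs_def, symmetric])
  show "resolvent sc D A c = R"
    by (simp add: resolvent_def resolvent_fun_def F_def[abs_def, symmetric] inv blinfun_apply_inverse)
qed

lemma adm_pointsD:
  assumes c: "c \<in> adm_points"
  shows "is_resolvent c (resolvent sc D A c)" and "f \<in> bullet \<Longrightarrow> f o\<^sub>L resolvent sc D A c \<in> bullet"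
proof -
  show "is_resolvent c (resolvent sc D A c)"
    using c by (intro is_resolvent_resolvent) (simp add: adm_points_def)
  assume "f \<in> bullet"
  then have "dual_op (resolvent sc D A c) f \<in> bullet_gen_domain sc \<tau> T"
    using c by (auto simp: adm_points_def bullet_dual_eq)
  then show "f o\<^sub>L resolvent sc D A c \<in> bullet"
    by (auto simp: bullet_gen_domain_eq bullet_gen_rel_def dual_op_def)
qed

lemma adm_points_nonempty: "adm_points \<noteq> {}"
proof -
  obtain w R where R: "is_resolvent (of_real w) R" and circ: "\<And>f. f \<in> circ \<Longrightarrow> f o\<^sub>L R \<in> circ"
    by (rule resolvent_exists) (rule that)
  have "bullet_gen_rel (f o\<^sub>L R) (scale_fun (of_real w) (f o\<^sub>L R) - f)" if "f \<in> bullet" for f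
    by (rule bullet_gen_rel_resolvent[OF R that circ[OF bulletD(1)[OF that]]])
  then have "of_real w \<in> adm_points"
    using resolvent_eqI[OF R]
    by (auto simp: adm_points_def bullet_dual_eq bullet_gen_domain_eq dual_op_def)
  then show ?thesis by blast
qed

text \<open>The resolvent \<open>S\<close> at one large real point maps \<open>X\<^sup>\<circ>\<close> into the bi-sun dual by adjunction. By the resolvent
identity \<open>f \<circ> R = f \<circ> S + (w - c) (f \<circ> S \<circ> R)\<close>, and membership of \<open>c\<close> in \<open>\<Lambda>\<close> handles the last term.\<close>

lemma adm_resolvent_circ_to_bullet:
  assumes c: "c \<in> adm_points" and f: "f \<in> circ"
  shows "f o\<^sub>L resolvent sc D A c \<in> bullet"
proof -
  let ?R = "resolvent sc D A c"
  obtain w S where S: "is_resolvent (of_real w) S" and circ: "\<And>f. f \<in> circ \<Longrightarrow> f o\<^sub>L S \<in> circ"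
    by (rule resolvent_exists) (rule that)
  have g: "f o\<^sub>L S \<in> bullet"
    by (rule bullet_compose_resolvent[OF S circ[OF f]])
  have "f o\<^sub>L ?R = (f o\<^sub>L S) + scale_fun (of_real w - c) ((f o\<^sub>L S) o\<^sub>L ?R)"
  proof (rule blinfun_eqI)
    fix x
    have "f (?R x) = f (S x + sc (of_real w - c) (S (?R x)))"
      by (rule arg_cong[OF resolvent_identity[OF adm_pointsD(1)[OF c] S]])
    then show "(f o\<^sub>L ?R) x = ((f o\<^sub>L S) + scale_fun (of_real w - c) ((f o\<^sub>L S) o\<^sub>L ?R)) x"
      by (simp add: blinfun.add_left blinfun.add_right circD(1)[OF f])
  qed
  then show ?thesis
    using bullet_add[OF g bullet_scale_fun[OF adm_pointsD(2)[OF c g]]] by simp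
qed

lemma surj_if_resolvent_image_compact:
  assumes refl: "bullet_reflexive sc \<tau> T" and c: "c \<in> adm_points"
    and K: "compactin (weak_top_space bullet) (resolvent sc D A c ` bullet_ball)"
  shows "range (canonical_map sc \<tau> T) = sub_dual bullet"
proof (rule canonical_map_surj_if_compact[OF refl adm_pointsD(2)[OF c] _ K])
  fix f and h :: real assume f: "f \<in> bullet" and h: "h > 0"
  have fg: "bullet_gen_rel (f o\<^sub>L orbit_integral h) ((f o\<^sub>L T h) - f)"
    by (rule bullet_gen_rel_orbit_integral[OF f less_imp_le[OF h]])
  then have "f o\<^sub>L orbit_integral h \<in> bullet" "(f o\<^sub>L T h) - f \<in> bullet"
    by (simp_all add: bullet_gen_rel_def)
  then have "scale_fun c (f o\<^sub>L orbit_integral h) - ((f o\<^sub>L T h) - f) \<in> bullet"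
    by (rule bullet_diff[OF bullet_scale_fun])
  with bullet_gen_rel_in_range_resolvent[OF fg adm_pointsD(1)[OF c]]
  show "\<exists>g\<in>bullet. f o\<^sub>L orbit_integral h = g o\<^sub>L resolvent sc D A c"
    by (rule bexI)
qed

lemma surj_if_ball_compact:
  assumes refl: "bullet_reflexive sc \<tau> T" and K: "compactin (weak_top_space bullet) bullet_ball"
  shows "range (canonical_map sc \<tau> T) = sub_dual bullet"
proof (rule canonical_map_surj_if_compact[OF refl, of id_blinfun])
  have id: "f o\<^sub>L id_blinfun = f" for f :: "'a \<Rightarrow>\<^sub>L 'k"
    by (rule blinfun_eqI) simp
  show "f o\<^sub>L id_blinfun \<in> bullet" if "f \<in> bullet" for f
    using that by (simp add: id)
  show "\<exists>g\<in>bullet. f o\<^sub>L orbit_integral h = g o\<^sub>L id_blinfun" if "f \<in> bullet" "h > 0" for f h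
    using bullet_compose_orbit_integral[OF bulletD(1)[OF that(1)], of h] that(2) by (simp add: id)
  show "compactin (weak_top_space bullet) (id_blinfun ` bullet_ball)"
    using K by simp
qed

lemma compactin_circ_imp_bullet:
  assumes "compactin (weak_top_space circ) K"
  shows "compactin (weak_top_space bullet) K"
proof -
  have "continuous_map (weak_top_space circ) (weak_top_space bullet) (id_blinfun :: 'a \<Rightarrow>\<^sub>L 'a)"
  proof (rule continuous_map_weak_top_space)
    fix f :: "'a \<Rightarrow>\<^sub>L 'k" assume "f \<in> bullet"
    moreover have "f o\<^sub>L id_blinfun = f"
      by (rule blinfun_eqI) simp
    ultimately show "f o\<^sub>L id_blinfun \<in> circ"
      by (simp add: bulletD)
  qed
  from image_compactin[OF assms this] show ?thesis by simp
qed

lemma resolvent_image_circ_compact_if_surj: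
  assumes surj: "range (canonical_map sc \<tau> T) = sub_dual bullet" and c: "c \<in> adm_points"
  shows "compactin (weak_top_space circ) (resolvent sc D A c ` bullet_ball)"
  by (rule image_compactin[OF compact_ball_if_canonical_map_surj[OF surj]
        continuous_map_weak_top_space[OF adm_resolvent_circ_to_bullet[OF c]]])

section \<open>The Favard space\<close>

lemma favard_iff:
  "x \<in> favard_space T \<longleftrightarrow> (\<exists>C. \<forall>\<^sub>F t in at_right 0. norm ((1 / t) *\<^sub>R (T t x - x)) \<le> C)"
proof -
  have eq: "\<forall>\<^sub>F t in at_right 0. 1 / t * norm (T t x - x) = norm ((1 / t) *\<^sub>R (T t x - x))"
    using eventually_at_right_less[of 0] by eventually_elim simp
  show ?thesis
  proof
    assume "x \<in> favard_space T"
    then have "Limsup (at_right 0) (\<lambda>t. ereal (1 / t * norm (T t x - x))) < \<infinity>"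
      by (simp add: favard_space_def)
    then obtain C where "Limsup (at_right 0) (\<lambda>t. ereal (1 / t * norm (T t x - x))) < ereal C"
      using ereal_dense2 by blast
    from Limsup_lessD[OF this] eq have "\<forall>\<^sub>F t in at_right 0. norm ((1 / t) *\<^sub>R (T t x - x)) \<le> C"
    proof eventually_elim
      case (elim t)
      from elim(1) have "1 / t * norm (T t x - x) < C"
        by (simp only: less_ereal.simps(1))
      with elim(2) show ?case by linarith
    qed
    then show "\<exists>C. \<forall>\<^sub>F t in at_right 0. norm ((1 / t) *\<^sub>R (T t x - x)) \<le> C" by blast
  next
    assume "\<exists>C. \<forall>\<^sub>F t in at_right 0. norm ((1 / t) *\<^sub>R (T t x - x)) \<le> C"
    then obtain C where "\<forall>\<^sub>F t in at_right 0. norm ((1 / t) *\<^sub>R (T t x - x)) \<le> C" by blast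
    with eq have "\<forall>\<^sub>F t in at_right 0. ereal (1 / t * norm (T t x - x)) \<le> ereal C"
      by eventually_elim (simp only: ereal_less_eq(3))
    from Limsup_bounded[OF this] show "x \<in> favard_space T"
      by (auto simp: favard_space_def intro: le_less_trans)
  qed
qed

text \<open>Difference quotients that are unbounded near \<open>0\<close> would be unbounded along some null sequence of times, but there
they converge.\<close>

lemma gen_domain_subset_favard: "D \<subseteq> favard_space T"
proof
  fix x assume "x \<in> D"
  then obtain y where xy: "gen_rel x y"
    by (auto simp: gen_domain_eq)
  show "x \<in> favard_space T"
    unfolding favard_iff
  proof (rule ccontr)
    assume neg: "\<not> (\<exists>C. \<forall>\<^sub>F t in at_right 0. norm ((1 / t) *\<^sub>R (T t x - x)) \<le> C)"
    have "\<exists>t>0. t < inverse (real (Suc n)) \<and> \<not> norm ((1 / t) *\<^sub>R (T t x - x)) \<le> real n" for n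
    proof -
      have "\<not> (\<forall>\<^sub>F t in at_right 0. norm ((1 / t) *\<^sub>R (T t x - x)) \<le> real n)"
        using neg by blast
      then show ?thesis
        unfolding eventually_at_right_field by (metis inverse_positive_iff_positive of_nat_0_less_iff zero_less_Suc)
    qed
    then obtain t where t: "\<And>n. t n > 0" "\<And>n. t n < inverse (real (Suc n))"
      "\<And>n. \<not> norm ((1 / t n) *\<^sub>R (T (t n) x - x)) \<le> real n"
      by metis
    have "t \<longlonglongrightarrow> 0"
      by (rule null_seq_squeeze[OF LIMSEQ_inverse_real_of_nat]) (rule less_imp_le, rule t)+
    from gen_relD[OF xy t(1) this]
    obtain C where C: "\<And>n. norm ((1 / t n) *\<^sub>R (T (t n) x - x)) \<le> C"
      using conv_bound by blast
    obtain n :: nat where "C \<le> real n"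
      using real_arch_simple by blast
    with C[of n] t(3)[of n] show False by linarith
  qed
qed

text \<open>Let \<open>y\<close> be a cluster point of the difference quotients of \<open>x\<close>. Then \<open>f y = (A\<^sup>\<bullet> f) x\<close> for \<open>f\<close> in the domain of \<open>A\<^sup>\<bullet>\<close>.
Inserting \<open>f = g \<circ> R\<close> gives \<open>g x = g (R (w x - y))\<close> for all \<open>g\<close> in the bi-sun dual, so \<open>x\<close> is in the range of \<open>R\<close>.\<close>

lemma favard_subset_gen_domain:
  assumes K: "compactin (weak_top_space bullet) bullet_ball"
  shows "favard_space T \<subseteq> D"
proof
  fix x assume "x \<in> favard_space T"
  then obtain C where "\<forall>\<^sub>F t in at_right 0. norm ((1 / t) *\<^sub>R (T t x - x)) \<le> C"
    unfolding favard_iff by blast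
  then obtain d where d: "d > 0" "\<And>t. 0 < t \<Longrightarrow> t < d \<Longrightarrow> norm ((1 / t) *\<^sub>R (T t x - x)) \<le> C"
    unfolding eventually_at_right_field by blast
  define k where "k = \<bar>C\<bar> + 1"
  have k: "k > 0" "C \<le> k" by (auto simp: k_def)
  \<comment> \<open>The times stay below \<open>d\<close>, so that the bound \<open>C\<close> is available for every index.\<close>
  define h where "h n = d / 2 * inverse (real (Suc n))" for n
  have h: "h n > 0" "h n < d" for n
  proof -
    have "inverse (real (Suc n)) \<le> 1"
      by (simp add: inverse_le_1_iff)
    then have "h n \<le> d / 2 * 1"
      unfolding h_def using d(1) by (intro mult_left_mono) auto
    with d(1) show "h n < d" by simp
    show "h n > 0" using d(1) by (simp add: h_def)
  qed
  have h0: "h \<longlonglongrightarrow> 0"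
    unfolding h_def by (rule tendsto_mult_right_zero[OF LIMSEQ_inverse_real_of_nat])
  define q where "q n = (1 / h n) *\<^sub>R (T (h n) x - x)" for n
  have in_ball: "(1 / k) *\<^sub>R q n \<in> bullet_ball" for n
  proof (rule scaled_in_bullet_ball[OF _ k(1)])
    fix f :: "'a \<Rightarrow>\<^sub>L 'k"
    have "norm (q n) \<le> k"
      using d(2)[OF h] k(2) unfolding q_def by (rule order_trans)
    then have "norm f * norm (q n) \<le> norm f * k"
      by (rule mult_left_mono) simp
    with norm_blinfun[of f "q n"] show "norm (f (q n)) \<le> k * norm f"
      by (simp only: mult.commute[of k])
  qed
  obtain b where "b \<in> bullet_ball" and
    lim: "\<And>f l. f \<in> bullet \<Longrightarrow> (\<lambda>n. blinfun_apply f ((1 / k) *\<^sub>R q n)) \<longlonglongrightarrow> l \<Longrightarrow> blinfun_apply f b = l"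
    by (rule weak_compact_sequence[where s = "\<lambda>n. (1 / k) *\<^sub>R q n", OF K in_ball]) (rule that)
  define y where "y = k *\<^sub>R b"
  have gx: "f y = g x" if fg: "bullet_gen_rel f g" for f g
  proof -
    have f: "f \<in> bullet" using fg by (simp add: bullet_gen_rel_def)
    have "(\<lambda>n. (1 / k) *\<^sub>R f (q n)) \<longlonglongrightarrow> (1 / k) *\<^sub>R g x"
      unfolding q_def by (intro tendsto_scaleR tendsto_const bullet_gen_rel_apply[OF fg h(1) h0])
    then have "f b = (1 / k) *\<^sub>R g x"
      by (intro lim[OF f]) (simp add: blinfun.scaleR_right)
    with k(1) show ?thesis
      by (simp add: y_def blinfun.scaleR_right)
  qed
  obtain w R where R: "is_resolvent (of_real w) R" and circ: "\<And>f. f \<in> circ \<Longrightarrow> f o\<^sub>L R \<in> circ"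
    by (rule resolvent_exists) (rule that)
  have "x - R (w *\<^sub>R x - y) = 0"
  proof (rule bullet_separates)
    fix g assume g: "g \<in> bullet"
    have "g (R y) = of_real w * g (R x) - g x"
      using gx[OF bullet_gen_rel_resolvent[OF R g circ[OF bulletD(1)[OF g]]]]
      by (simp add: blinfun.diff_left)
    then show "g (x - R (w *\<^sub>R x - y)) = 0"
      by (simp add: blinfun.diff_right blinfun.scaleR_right scaleR_conv_of_real)
  qed
  then have "x = R (w *\<^sub>R x - y)" by simp
  with is_resolventD(1)[OF R, of "w *\<^sub>R x - y"] show "x \<in> D"
    by (auto simp: gen_domain_eq)
qed

end

lemma seq_complete_saks_imp_complete:
  assumes "seminormed_space sc P" and complete: "seq_complete_saks sc (seminorm_topology P)"
    and s: "bounded (range s)" "\<And>p e. p \<in> P \<Longrightarrow> e > 0 \<Longrightarrow> \<exists>N. \<forall>m\<ge>N. \<forall>n\<ge>N. p (s m - s n) < e"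
  shows "\<exists>l. seminormed_space.conv P s l"
proof -
  interpret seminormed_space sc P by fact
  have "top_Cauchy \<gamma> s"
    by (rule mixed_Cauchy[OF s])
  with complete obtain l where "limitin \<gamma> s l sequentially"
    unfolding seq_complete_saks_def sequentially_complete_in_def by blast
  then show ?thesis
    unfolding limitin_mixed_iff_conv by blast
qed

lemma bicontinuous_semigroup_imp_saks_semigroup:
  assumes P: "seminormed_space sc P" and complete: "seq_complete_saks sc (seminorm_topology P)"
    and T: "bicontinuous_semigroup sc (seminorm_topology P) T"
  shows "saks_semigroup sc P T"
proof -
  interpret seminormed_space sc P by fact
  show ?thesis
  proof unfold_locales
    show "\<exists>l. conv s l" if "bounded (range s)"
      "\<And>p e. p \<in> P \<Longrightarrow> e > 0 \<Longrightarrow> \<exists>N. \<forall>m\<ge>N. \<forall>n\<ge>N. p (s m - s n) < e" for s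
      using seq_complete_saks_imp_complete[OF P complete that] .
    show "T t (sc c x) = sc c (T t x)" if "t \<ge> 0" for t c x
      using T that by (simp add: bicontinuous_semigroup_def bounded_ops_def)
    show "T 0 x = x" for x
      using T by (simp add: bicontinuous_semigroup_def)
    show "T (t + r) x = T t (T r x)" if "t \<ge> 0" "r \<ge> 0" for t r x
      using T that by (simp add: bicontinuous_semigroup_def)
    show "conv (\<lambda>n. T (h n) x) (T t x)" if h: "\<And>n. h n \<ge> 0" "h \<longlonglongrightarrow> t" for h t x
    proof -
      have cont: "continuous_map (top_of_set {0..}) \<gamma> (\<lambda>t. T t x)"
        using T by (simp add: bicontinuous_semigroup_def)
      have "t \<ge> 0"
        using LIMSEQ_le_const[OF h(2)] h(1) by blast
      then have "limitin (top_of_set {0..}) h t sequentially"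
        using h by (simp add: limitin_subtopology)
      from continuous_map_limit[OF cont this] show ?thesis
        by (simp add: comp_def limitin_mixed_iff_conv)
    qed
    show "conv (\<lambda>n. T (h n) (s n - x)) 0" if s: "conv s x" and h: "\<And>n. h n \<in> {0..a}" for s x h a
    proof -
      have "a \<ge> 0"
        using h[of 0] by auto
      moreover have "limitin \<gamma> s x sequentially"
        using s by (simp add: limitin_mixed_iff_conv)
      moreover have "\<forall>s x. limitin \<gamma> s x sequentially \<longrightarrow> (\<forall>a\<ge>0. \<forall>U. openin \<gamma> U \<and> 0 \<in> U \<longrightarrow>
          (\<forall>\<^sub>F n in sequentially. \<forall>t\<in>{0..a}. T t (s n - x) \<in> U))"
        using T unfolding bicontinuous_semigroup_def by (elim conjE)
      ultimately have ev: "openin \<gamma> U \<and> 0 \<in> U \<longrightarrow> (\<forall>\<^sub>F n in sequentially. \<forall>t\<in>{0..a}. T t (s n - x) \<in> U)" for U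
        by blast
      have "limitin \<gamma> (\<lambda>n. T (h n) (s n - x)) 0 sequentially"
        unfolding limitin_def mixed_\<gamma>(1)
      proof (intro conjI allI impI UNIV_I)
        fix U assume "openin \<gamma> U \<and> 0 \<in> U"
        with ev have "\<forall>\<^sub>F n in sequentially. \<forall>t\<in>{0..a}. T t (s n - x) \<in> U"
          by blast
        then show "\<forall>\<^sub>F n in sequentially. T (h n) (s n - x) \<in> U"
          by (rule eventually_mono) (use h in blast)
      qed
      then show ?thesis
        by (simp only: limitin_mixed_iff_conv)
    qed
  qed
qed

theorem theorem6p12:
  fixes sc :: "'k::real_or_complex \<Rightarrow> 'a::banach \<Rightarrow> 'a"
    and \<tau> :: "'a topology"
    and T :: "real \<Rightarrow> 'a \<Rightarrow>\<^sub>L 'a"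
  assumes "saks_space sc \<tau>"
    and "seq_complete_saks sc \<tau>"
    and "d_consistent sc \<tau>"
    and "mazur_saks sc \<tau>"
    and "bicontinuous_semigroup sc \<tau> T"
    and "bullet_reflexive sc \<tau> T"
  defines "D \<equiv> gen_domain sc \<tau> T"
    and "A \<equiv> generator sc \<tau> T"
    and "Xcirc \<equiv> circ_dual sc \<tau>"
    and "Xbullet \<equiv> bullet_dual sc \<tau> T"
  defines "R \<equiv> resolvent sc D A"
    and "B \<equiv> {x. bullet_norm sc \<tau> T x \<le> 1}"
  defines "\<Lambda> \<equiv> {\<mu> \<in> resolvent_set sc D A. dual_op (R \<mu>) ` Xbullet \<subseteq> bullet_gen_domain sc \<tau> T}"
  defines "cond_i \<equiv> canonical_map sc \<tau> T ` UNIV = sub_dual Xbullet"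
    and "cond_ii \<equiv> \<lambda>\<mu>. compactin (weak_top_space Xcirc) (R \<mu> ` B)"
    and "cond_iii \<equiv> \<lambda>\<mu>. compactin (weak_top_space Xbullet) (R \<mu> ` B)"
    and "cond_iv \<equiv> compactin (weak_top_space Xbullet) B"
  shows "(cond_i \<longleftrightarrow> (\<exists>\<mu>\<in>\<Lambda>. cond_ii \<mu>)) \<and>
         (cond_i \<longleftrightarrow> (\<forall>\<mu>\<in>\<Lambda>. cond_ii \<mu>)) \<and>
         (cond_i \<longleftrightarrow> (\<exists>\<mu>\<in>\<Lambda>. cond_iii \<mu>)) \<and>
         (cond_i \<longleftrightarrow> (\<forall>\<mu>\<in>\<Lambda>. cond_iii \<mu>)) \<and>
         (cond_i \<longleftrightarrow> cond_iv) \<and>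
         (cond_i \<or> (\<exists>\<mu>\<in>\<Lambda>. cond_ii \<mu>) \<or> (\<forall>\<mu>\<in>\<Lambda>. cond_ii \<mu>) \<or>
          (\<exists>\<mu>\<in>\<Lambda>. cond_iii \<mu>) \<or> (\<forall>\<mu>\<in>\<Lambda>. cond_iii \<mu>) \<or> cond_iv
          \<longrightarrow> favard_space T = D)"
proof -
  have "\<exists>P. directed_seminorms P \<and> (\<forall>p\<in>P. seminorm sc p) \<and> \<tau> = seminorm_topology P \<and>
      (\<forall>x. bdd_above ((\<lambda>p. p x) ` P) \<and> norm x = (SUP p\<in>P. p x))"
    using assms(1) unfolding saks_space_def by (elim conjE)
  then obtain P where P: "directed_seminorms P" "\<forall>p\<in>P. seminorm sc p" "\<tau> = seminorm_topology P"
    "\<forall>x. bdd_above ((\<lambda>p. p x) ` P) \<and> norm x = (SUP p\<in>P. p x)"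
    by (elim exE conjE)
  interpret P: seminormed_space sc P
  proof (intro seminormed_space.intro seminormed_space_axioms.intro)
    show "banach_space_over sc"
      using assms(1) by (simp add: saks_space_def)
  qed (use P in \<open>simp_all add: directed_seminorms_def\<close>)
  interpret T: saks_semigroup sc P T
    by (rule bicontinuous_semigroup_imp_saks_semigroup)
       (use P.seminormed_space_axioms assms(2,5) P(3) in simp_all)
  have eqs: "Xcirc = P.circ" "Xbullet = T.bullet" "B = T.bullet_ball" "D = T.D" "R = resolvent sc T.D T.A"
    by (simp_all add: Xcirc_def Xbullet_def B_def D_def A_def R_def P(3) P.circ_dual_eq_circ T.bullet_dual_eq)
  have \<Lambda>: "\<Lambda> = T.adm_points"
    unfolding \<Lambda>_def R_def D_def A_def Xbullet_def T.adm_points_def P(3) ..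
  have refl: "bullet_reflexive sc P.\<tau> T"
    using assms(6) by (simp only: P(3))
  have "cond_i \<Longrightarrow> \<mu> \<in> \<Lambda> \<Longrightarrow> cond_ii \<mu>" for \<mu>
    unfolding cond_i_def cond_ii_def eqs \<Lambda> P(3) by (rule T.resolvent_image_circ_compact_if_surj)
  moreover have "cond_ii \<mu> \<Longrightarrow> cond_iii \<mu>" for \<mu>
    unfolding cond_ii_def cond_iii_def eqs by (rule T.compactin_circ_imp_bullet)
  moreover have "\<mu> \<in> \<Lambda> \<Longrightarrow> cond_iii \<mu> \<Longrightarrow> cond_i" for \<mu>
    unfolding cond_i_def cond_iii_def eqs \<Lambda> P(3) by (rule T.surj_if_resolvent_image_compact[OF refl])
  moreover have "cond_i \<Longrightarrow> cond_iv"
    unfolding cond_i_def cond_iv_def eqs P(3) by (rule T.compact_ball_if_canonical_map_surj)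
  moreover have "cond_iv \<Longrightarrow> cond_i"
    unfolding cond_i_def cond_iv_def eqs P(3) by (rule T.surj_if_ball_compact[OF refl])
  moreover have "cond_iv \<Longrightarrow> favard_space T = D"
    unfolding cond_iv_def eqs
    by (intro equalityI T.favard_subset_gen_domain T.gen_domain_subset_favard)
  moreover obtain \<mu> where "\<mu> \<in> \<Lambda>"
    using T.adm_points_nonempty unfolding \<Lambda> by blast
  ultimately show ?thesis by blast
qed

end
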